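(* Let $M$ be a smooth manifold with a pseudo-Riemannian metric $g$ and a bivector field $\pi$. Suppose that $(g,\pi)$ is $D^\pi$-compatible, i.e. $D^\pi\pi=0$ (so that $\pi$ is a Poisson tensor), and let $S$ be a symplectic leaf of $\pi$ with symplectic form $\omega_S$. For vector fields $X,Y$ tangent to $S$ put $$\nabla^S_XY=\#_\pi(D^\pi_\alpha\beta),$$ where $\alpha,\beta$ are (local) 1-forms on $M$ such that $\#_\pi(\alpha)=X$ and $\#_\pi(\beta)=Y$ along $S$. Then: (i) $\nabla^S_XY$ does not depend on the choice of $\alpha,\beta$, and $\nabla^S$ is a (covariant) connection on $S$; (ii) $\nabla^S\omega_S=0$; (iii) if the restriction of $g$ to $S$ is non-degenerate, then $\nabla^S$ is the Levi-Civita connection of the restriction of $g$ to $S$.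
   Context: All objects are smooth. For a bivector field $\pi$, the map $\#_\pi:T^*M\to TM$ is defined by $\beta(\#_\pi(\alpha))=\pi(\alpha,\beta)$, and the bracket on 1-forms by $$[\alpha,\beta]_\pi=L_{\#_\pi(\alpha)}\beta-L_{\#_\pi(\beta)}\alpha-d(\pi(\alpha,\beta)).$$ Let $\#_g:T^*M\to TM$ be the isomorphism given by $g$ and $\widetilde g(\alpha,\beta)=g(\#_g(\alpha),\#_g(\beta))$ the induced metric on $T^*M$. The contravariant connection $D^\pi$ on 1-forms is defined by $$2\widetilde g(D^\pi_\alpha\beta,\gamma)=\#_\pi(\alpha)\cdot\widetilde g(\beta,\gamma)+\#_\pi(\beta)\cdot\widetilde g(\alpha,\gamma)-\#_\pi(\gamma)\cdot\widetilde g(\alpha,\beta)+\widetilde g([\gamma,\alpha]_\pi,\beta)+\widetilde g([\gamma,\beta]_\pi,\alpha)+\widetilde g([\alpha,\beta]_\pi,\gamma).$$ The pair $(g,\pi)$ is called $D^\pi$-compatible if $D^\pi\pi=0$, i.e. for all 1-forms $\alpha,\beta,\gamma$, $$\#_\pi(\alpha)\cdot\pi(\beta,\gamma)-\pi(D^\pi_\alpha\beta,\gamma)-\pi(\beta,D^\pi_\alpha\gamma)=0 .$$ This condition implies that $\pi$ is a Poisson tensor. The symplectic leaves of $\pi$ are the maximal connected immersed submanifolds $S$ with $T_xS=\#_\pi(T_x^*M)$ for all $x\in S$; the symplectic form of $S$ is $\omega_S(\#_\pi(\alpha),\#_\pi(\beta))=\pi(\alpha,\beta)$. *)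

theory Defs
  imports "HOL-Analysis.Analysis"
begin

text \<open>
  Tensor fields are functions on the type of points; only their values on the open set under
  consideration are meaningful, and they are only ever compared there.
\<close>

section \<open>Smooth maps and smooth manifolds\<close>

primrec Ck_on :: "nat \<Rightarrow> ('e::euclidean_space \<Rightarrow> 'b::real_normed_vector) \<Rightarrow> 'e set \<Rightarrow> bool" where
  "Ck_on 0 F N \<longleftrightarrow> continuous_on N F"
| "Ck_on (Suc k) F N \<longleftrightarrow> (\<forall>x\<in>N. F differentiable (at x)) \<and>
     (\<forall>v. Ck_on k (\<lambda>x. frechet_derivative F (at x) v) N)"

text \<open>
  Smoothness on an arbitrary subset of Euclidean space means local extendability to smooth maps on
  open sets. On an open subset of Euclidean space, or of a linear subspace, this is the usual
  notion.
\<close>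

definition smooth_on :: "'e::euclidean_space set \<Rightarrow> ('e \<Rightarrow> 'b::real_normed_vector) \<Rightarrow> bool" where
  "smooth_on \<Omega> f \<longleftrightarrow> (\<forall>x\<in>\<Omega>. \<exists>N F. open N \<and> x \<in> N \<and> (\<forall>k. Ck_on k F N) \<and>
     (\<forall>y\<in>N \<inter> \<Omega>. F y = f y))"

text \<open>
  The model space is a linear subspace of the Euclidean type, so that the dimension is not tied to
  the type: dimension 0 is allowed (Euclidean types have dimension at least 1), and submanifolds
  can be modelled in the same type. An atlas is a set of pairs (domain, chart map); it need not be
  maximal.
\<close>

record ('a, 'e) mfd =
  topo :: "'a topology"
  model :: "'e set"
  atlas :: "('a set \<times> ('a \<Rightarrow> 'e)) set"

abbreviation carrier :: "('a, 'e::euclidean_space) mfd \<Rightarrow> 'a set" where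
  "carrier M \<equiv> topspace (topo M)"

definition smooth_manifold :: "('a, 'e::euclidean_space) mfd \<Rightarrow> bool" where
  "smooth_manifold M \<longleftrightarrow>
     Hausdorff_space (topo M) \<and> second_countable (topo M) \<and> subspace (model M) \<and>
     (\<Union>(D, \<phi>)\<in>atlas M. D) = carrier M \<and>
     (\<forall>(D, \<phi>)\<in>atlas M. openin (topo M) D \<and> openin (top_of_set (model M)) (\<phi> ` D) \<and>
        homeomorphic_map (subtopology (topo M) D) (top_of_set (\<phi> ` D)) \<phi>) \<and>
     (\<forall>(D, \<phi>)\<in>atlas M. \<forall>(E, \<psi>)\<in>atlas M. smooth_on (\<phi> ` (D \<inter> E)) (\<psi> \<circ> inv_into D \<phi>))"

definition smooth_fun :: "('a, 'e::euclidean_space) mfd \<Rightarrow> 'a set \<Rightarrow> ('a \<Rightarrow> real) \<Rightarrow> bool" where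
  "smooth_fun M U f \<longleftrightarrow> (\<forall>(D, \<phi>)\<in>atlas M. smooth_on (\<phi> ` (U \<inter> D)) (f \<circ> inv_into D \<phi>))"

definition smooth_near :: "('a, 'e::euclidean_space) mfd \<Rightarrow> 'a \<Rightarrow> ('a \<Rightarrow> real) \<Rightarrow> bool" where
  "smooth_near M p f \<longleftrightarrow> (\<exists>U. openin (topo M) U \<and> p \<in> U \<and> smooth_fun M U f)"

section \<open>Linear algebra on spaces of real-valued functions\<close>

definition linear_over :: "('b \<Rightarrow> real) set \<Rightarrow> (('b \<Rightarrow> real) \<Rightarrow> real) \<Rightarrow> bool" where
  "linear_over V F \<longleftrightarrow> (\<forall>v\<in>V. \<forall>w\<in>V. \<forall>c d. F (\<lambda>z. c * v z + d * w z) = c * F v + d * F w)"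

text \<open>Functionals are made canonical by letting them vanish off the space.\<close>

definition dual :: "('b \<Rightarrow> real) set \<Rightarrow> (('b \<Rightarrow> real) \<Rightarrow> real) set" where
  "dual V = {F. linear_over V F \<and> (\<forall>v. v \<notin> V \<longrightarrow> F v = 0)}"

definition bilinear_over :: "('b \<Rightarrow> real) set \<Rightarrow> (('b \<Rightarrow> real) \<Rightarrow> ('b \<Rightarrow> real) \<Rightarrow> real) \<Rightarrow> bool" where
  "bilinear_over V B \<longleftrightarrow> (\<forall>u\<in>V. linear_over V (B u) \<and> linear_over V (\<lambda>v. B v u))"

definition nondegenerate_over :: "('b \<Rightarrow> real) set \<Rightarrow> (('b \<Rightarrow> real) \<Rightarrow> ('b \<Rightarrow> real) \<Rightarrow> real) \<Rightarrow> bool" where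
  "nondegenerate_over V B \<longleftrightarrow> (\<forall>u\<in>V. (\<forall>v\<in>V. B u v = 0) \<longrightarrow> u = (\<lambda>z. 0))"

section \<open>Tangent vectors, vector fields, 1-forms\<close>

type_synonym 'a tvec = "('a \<Rightarrow> real) \<Rightarrow> real"
type_synonym 'a covec = "'a tvec \<Rightarrow> real"

text \<open>
  Tangent vectors are derivations of the smooth functions defined near the point, extended by 0 to
  all functions. That the value depends only on the germ of the function follows from the Leibniz
  rule.
\<close>

definition tangent :: "('a, 'e::euclidean_space) mfd \<Rightarrow> 'a \<Rightarrow> 'a tvec set" where
  "tangent M p = {v.
     (\<forall>f h c d. smooth_near M p f \<and> smooth_near M p h \<longrightarrow>
        v (\<lambda>q. c * f q + d * h q) = c * v f + d * v h \<and>
        v (\<lambda>q. f q * h q) = f p * v h + h p * v f) \<and>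
     (\<forall>f. \<not> smooth_near M p f \<longrightarrow> v f = 0)}"

definition cotangent :: "('a, 'e::euclidean_space) mfd \<Rightarrow> 'a \<Rightarrow> 'a covec set" where
  "cotangent M p = dual (tangent M p)"

definition vector_fields :: "('a, 'e::euclidean_space) mfd \<Rightarrow> 'a set \<Rightarrow> ('a \<Rightarrow> 'a tvec) set" where
  "vector_fields M U = {X. (\<forall>p\<in>U. X p \<in> tangent M p) \<and>
     (\<forall>W f. openin (topo M) W \<and> W \<subseteq> U \<and> smooth_fun M W f \<longrightarrow> smooth_fun M W (\<lambda>p. X p f))}"

definition one_forms :: "('a, 'e::euclidean_space) mfd \<Rightarrow> 'a set \<Rightarrow> ('a \<Rightarrow> 'a covec) set" where
  "one_forms M U = {\<alpha>. (\<forall>p\<in>U. \<alpha> p \<in> cotangent M p) \<and>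
     (\<forall>W. openin (topo M) W \<and> W \<subseteq> U \<longrightarrow>
        (\<forall>X\<in>vector_fields M W. smooth_fun M W (\<lambda>p. \<alpha> p (X p))))}"

definition lie_bracket ::
  "('a, 'e::euclidean_space) mfd \<Rightarrow> ('a \<Rightarrow> 'a tvec) \<Rightarrow> ('a \<Rightarrow> 'a tvec) \<Rightarrow> 'a \<Rightarrow> 'a tvec" where
  "lie_bracket M X Y p =
     (\<lambda>f. if smooth_near M p f then X p (\<lambda>q. Y q f) - Y p (\<lambda>q. X q f) else 0)"

definition differential :: "('a, 'e::euclidean_space) mfd \<Rightarrow> ('a \<Rightarrow> real) \<Rightarrow> 'a \<Rightarrow> 'a covec" where
  "differential M f p = (\<lambda>v. if v \<in> tangent M p then v f else 0)"

text \<open>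
  The operators below are local: their values at a point are characterised by test fields or test
  forms defined on neighbourhoods of that point, so they apply to local as well as to global fields
  and forms. The Lie derivative is given by \<open>(L\<^sub>X \<beta>)(Z) = X (\<beta>(Z)) - \<beta>([X, Z])\<close>.
\<close>

definition lie_deriv ::
  "('a, 'e::euclidean_space) mfd \<Rightarrow> ('a \<Rightarrow> 'a tvec) \<Rightarrow> ('a \<Rightarrow> 'a covec) \<Rightarrow> 'a \<Rightarrow> 'a covec" where
  "lie_deriv M X \<beta> p = (THE \<delta>. \<delta> \<in> cotangent M p \<and>
     (\<forall>W Z. openin (topo M) W \<and> p \<in> W \<and> Z \<in> vector_fields M W \<longrightarrow>
        \<delta> (Z p) = X p (\<lambda>q. \<beta> q (Z q)) - \<beta> p (lie_bracket M X Z p)))"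

section \<open>Metrics, bivector fields and the contravariant connection\<close>

definition pseudo_riemannian ::
  "('a, 'e::euclidean_space) mfd \<Rightarrow> ('a \<Rightarrow> 'a tvec \<Rightarrow> 'a tvec \<Rightarrow> real) \<Rightarrow> bool" where
  "pseudo_riemannian M g \<longleftrightarrow>
     (\<forall>p\<in>carrier M. bilinear_over (tangent M p) (g p) \<and>
        (\<forall>u\<in>tangent M p. \<forall>v\<in>tangent M p. g p u v = g p v u) \<and>
        nondegenerate_over (tangent M p) (g p)) \<and>
     (\<forall>W. openin (topo M) W \<longrightarrow> (\<forall>X\<in>vector_fields M W. \<forall>Y\<in>vector_fields M W.
        smooth_fun M W (\<lambda>p. g p (X p) (Y p))))"

definition bivector_field ::
  "('a, 'e::euclidean_space) mfd \<Rightarrow> ('a \<Rightarrow> 'a covec \<Rightarrow> 'a covec \<Rightarrow> real) \<Rightarrow> bool" where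
  "bivector_field M \<pi> \<longleftrightarrow>
     (\<forall>p\<in>carrier M. bilinear_over (cotangent M p) (\<pi> p) \<and>
        (\<forall>a\<in>cotangent M p. \<forall>b\<in>cotangent M p. \<pi> p a b = - \<pi> p b a)) \<and>
     (\<forall>W. openin (topo M) W \<longrightarrow> (\<forall>\<alpha>\<in>one_forms M W. \<forall>\<beta>\<in>one_forms M W.
        smooth_fun M W (\<lambda>p. \<pi> p (\<alpha> p) (\<beta> p))))"

definition sharp_biv ::
  "('a, 'e::euclidean_space) mfd \<Rightarrow> ('a \<Rightarrow> 'a covec \<Rightarrow> 'a covec \<Rightarrow> real) \<Rightarrow> 'a \<Rightarrow> 'a covec \<Rightarrow> 'a tvec" where
  "sharp_biv M \<pi> p a = (THE v. v \<in> tangent M p \<and> (\<forall>b\<in>cotangent M p. b v = \<pi> p a b))"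

definition sharp_metric ::
  "('a, 'e::euclidean_space) mfd \<Rightarrow> ('a \<Rightarrow> 'a tvec \<Rightarrow> 'a tvec \<Rightarrow> real) \<Rightarrow> 'a \<Rightarrow> 'a covec \<Rightarrow> 'a tvec" where
  "sharp_metric M g p a = (THE v. v \<in> tangent M p \<and> (\<forall>w\<in>tangent M p. g p v w = a w))"

definition cometric ::
  "('a, 'e::euclidean_space) mfd \<Rightarrow> ('a \<Rightarrow> 'a tvec \<Rightarrow> 'a tvec \<Rightarrow> real) \<Rightarrow> 'a \<Rightarrow> 'a covec \<Rightarrow> 'a covec \<Rightarrow> real" where
  "cometric M g p a b = g p (sharp_metric M g p a) (sharp_metric M g p b)"

definition sharp_form ::
  "('a, 'e::euclidean_space) mfd \<Rightarrow> ('a \<Rightarrow> 'a covec \<Rightarrow> 'a covec \<Rightarrow> real) \<Rightarrow> ('a \<Rightarrow> 'a covec) \<Rightarrow> 'a \<Rightarrow> 'a tvec" where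
  "sharp_form M \<pi> \<alpha> = (\<lambda>p. sharp_biv M \<pi> p (\<alpha> p))"

definition form_bracket ::
  "('a, 'e::euclidean_space) mfd \<Rightarrow> ('a \<Rightarrow> 'a covec \<Rightarrow> 'a covec \<Rightarrow> real) \<Rightarrow>
   ('a \<Rightarrow> 'a covec) \<Rightarrow> ('a \<Rightarrow> 'a covec) \<Rightarrow> 'a \<Rightarrow> 'a covec" where
  "form_bracket M \<pi> \<alpha> \<beta> p = (\<lambda>v.
     lie_deriv M (sharp_form M \<pi> \<alpha>) \<beta> p v - lie_deriv M (sharp_form M \<pi> \<beta>) \<alpha> p v
     - differential M (\<lambda>q. \<pi> q (\<alpha> q) (\<beta> q)) p v)"

definition contra_conn ::
  "('a, 'e::euclidean_space) mfd \<Rightarrow> ('a \<Rightarrow> 'a tvec \<Rightarrow> 'a tvec \<Rightarrow> real) \<Rightarrow>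
   ('a \<Rightarrow> 'a covec \<Rightarrow> 'a covec \<Rightarrow> real) \<Rightarrow> ('a \<Rightarrow> 'a covec) \<Rightarrow> ('a \<Rightarrow> 'a covec) \<Rightarrow> 'a \<Rightarrow> 'a covec" where
  "contra_conn M g \<pi> \<alpha> \<beta> p = (THE \<delta>. \<delta> \<in> cotangent M p \<and>
     (\<forall>W \<gamma>. openin (topo M) W \<and> p \<in> W \<and> \<gamma> \<in> one_forms M W \<longrightarrow>
        2 * cometric M g p \<delta> (\<gamma> p) =
          sharp_form M \<pi> \<alpha> p (\<lambda>q. cometric M g q (\<beta> q) (\<gamma> q))
        + sharp_form M \<pi> \<beta> p (\<lambda>q. cometric M g q (\<alpha> q) (\<gamma> q))
        - sharp_form M \<pi> \<gamma> p (\<lambda>q. cometric M g q (\<alpha> q) (\<beta> q))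
        + cometric M g p (form_bracket M \<pi> \<gamma> \<alpha> p) (\<beta> p)
        + cometric M g p (form_bracket M \<pi> \<gamma> \<beta> p) (\<alpha> p)
        + cometric M g p (form_bracket M \<pi> \<alpha> \<beta> p) (\<gamma> p)))"

definition contra_compatible ::
  "('a, 'e::euclidean_space) mfd \<Rightarrow> ('a \<Rightarrow> 'a tvec \<Rightarrow> 'a tvec \<Rightarrow> real) \<Rightarrow>
   ('a \<Rightarrow> 'a covec \<Rightarrow> 'a covec \<Rightarrow> real) \<Rightarrow> bool" where
  "contra_compatible M g \<pi> \<longleftrightarrow>
     (\<forall>\<alpha>\<in>one_forms M (carrier M). \<forall>\<beta>\<in>one_forms M (carrier M). \<forall>\<gamma>\<in>one_forms M (carrier M).
      \<forall>p\<in>carrier M.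
        sharp_form M \<pi> \<alpha> p (\<lambda>q. \<pi> q (\<beta> q) (\<gamma> q))
        - \<pi> p (contra_conn M g \<pi> \<alpha> \<beta> p) (\<gamma> p) - \<pi> p (\<beta> p) (contra_conn M g \<pi> \<alpha> \<gamma> p) = 0)"

section \<open>Immersed submanifolds and symplectic leaves\<close>

text \<open>
  \<open>incl_deriv M x\<close> is the differential at \<open>x\<close> of the inclusion of a submanifold \<open>S\<close> into \<open>M\<close>: a
  derivation on functions smooth on \<open>S\<close> near \<open>x\<close> is restricted to functions smooth on \<open>M\<close> near \<open>x\<close>.
\<close>

definition incl_deriv :: "('a, 'e::euclidean_space) mfd \<Rightarrow> 'a \<Rightarrow> 'a tvec \<Rightarrow> 'a tvec" where
  "incl_deriv M x v = (\<lambda>f. if smooth_near M x f then v f else 0)"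

definition immersed_submanifold ::
  "('a, 'e::euclidean_space) mfd \<Rightarrow> ('a, 'e) mfd \<Rightarrow> bool" where
  "immersed_submanifold M S \<longleftrightarrow>
     smooth_manifold S \<and> carrier S \<subseteq> carrier M \<and> continuous_map (topo S) (topo M) (\<lambda>x. x) \<and>
     (\<forall>(D, \<phi>)\<in>atlas S. \<forall>(E, \<psi>)\<in>atlas M. smooth_on (\<phi> ` (D \<inter> E)) (\<psi> \<circ> inv_into D \<phi>)) \<and>
     (\<forall>x\<in>carrier S. inj_on (incl_deriv M x) (tangent S x))"

definition integral_submanifold ::
  "('a, 'e::euclidean_space) mfd \<Rightarrow> ('a \<Rightarrow> 'a covec \<Rightarrow> 'a covec \<Rightarrow> real) \<Rightarrow> ('a, 'e) mfd \<Rightarrow> bool" where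
  "integral_submanifold M \<pi> S \<longleftrightarrow>
     immersed_submanifold M S \<and> connected_space (topo S) \<and> carrier S \<noteq> {} \<and>
     (\<forall>x\<in>carrier S. incl_deriv M x ` tangent S x = sharp_biv M \<pi> x ` cotangent M x)"

definition symplectic_leaf ::
  "('a, 'e::euclidean_space) mfd \<Rightarrow> ('a \<Rightarrow> 'a covec \<Rightarrow> 'a covec \<Rightarrow> real) \<Rightarrow> ('a, 'e) mfd \<Rightarrow> bool" where
  "symplectic_leaf M \<pi> S \<longleftrightarrow> integral_submanifold M \<pi> S \<and>
     (\<forall>S'. integral_submanifold M \<pi> S' \<and> carrier S \<subseteq> carrier S' \<longrightarrow> carrier S' = carrier S)"

definition leaf_form ::
  "('a, 'e::euclidean_space) mfd \<Rightarrow> ('a \<Rightarrow> 'a covec \<Rightarrow> 'a covec \<Rightarrow> real) \<Rightarrow> 'a \<Rightarrow> 'a tvec \<Rightarrow> 'a tvec \<Rightarrow> real" where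
  "leaf_form M \<pi> x u v = (THE r. \<exists>a\<in>cotangent M x. \<exists>b\<in>cotangent M x.
     sharp_biv M \<pi> x a = incl_deriv M x u \<and> sharp_biv M \<pi> x b = incl_deriv M x v \<and> r = \<pi> x a b)"

definition restricted_metric ::
  "('a, 'e::euclidean_space) mfd \<Rightarrow> ('a \<Rightarrow> 'a tvec \<Rightarrow> 'a tvec \<Rightarrow> real) \<Rightarrow> 'a \<Rightarrow> 'a tvec \<Rightarrow> 'a tvec \<Rightarrow> real" where
  "restricted_metric M g x u v = g x (incl_deriv M x u) (incl_deriv M x v)"

section \<open>Connections\<close>

text \<open>The first clause for \<open>\<D>\<close> says that it acts on sections, i.e. ignores values off \<open>N\<close>.\<close>

definition covariant_connection ::
  "('a, 'e::euclidean_space) mfd \<Rightarrow> (('a \<Rightarrow> 'a tvec) \<Rightarrow> ('a \<Rightarrow> 'a tvec) \<Rightarrow> 'a \<Rightarrow> 'a tvec) \<Rightarrow> bool" where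
  "covariant_connection N \<D> \<longleftrightarrow> (let \<X> = vector_fields N (carrier N) in
     (\<forall>X\<in>\<X>. \<forall>X'\<in>\<X>. \<forall>Y\<in>\<X>. \<forall>Y'\<in>\<X>.
        (\<forall>p\<in>carrier N. X p = X' p \<and> Y p = Y' p) \<longrightarrow> (\<forall>p\<in>carrier N. \<D> X Y p = \<D> X' Y' p)) \<and>
     (\<forall>X\<in>\<X>. \<forall>Y\<in>\<X>. \<D> X Y \<in> \<X>) \<and>
     (\<forall>X\<in>\<X>. \<forall>X'\<in>\<X>. \<forall>Y\<in>\<X>. \<forall>p\<in>carrier N.
        \<D> (\<lambda>q f. X q f + X' q f) Y p = (\<lambda>f. \<D> X Y p f + \<D> X' Y p f)) \<and>
     (\<forall>X\<in>\<X>. \<forall>Y\<in>\<X>. \<forall>Y'\<in>\<X>. \<forall>p\<in>carrier N.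
        \<D> X (\<lambda>q f. Y q f + Y' q f) p = (\<lambda>f. \<D> X Y p f + \<D> X Y' p f)) \<and>
     (\<forall>h. smooth_fun N (carrier N) h \<longrightarrow> (\<forall>X\<in>\<X>. \<forall>Y\<in>\<X>. \<forall>p\<in>carrier N.
        \<D> (\<lambda>q f. h q * X q f) Y p = (\<lambda>f. h p * \<D> X Y p f) \<and>
        \<D> X (\<lambda>q f. h q * Y q f) p = (\<lambda>f. X p h * Y p f + h p * \<D> X Y p f))))"

definition parallel_form ::
  "('a, 'e::euclidean_space) mfd \<Rightarrow> (('a \<Rightarrow> 'a tvec) \<Rightarrow> ('a \<Rightarrow> 'a tvec) \<Rightarrow> 'a \<Rightarrow> 'a tvec) \<Rightarrow>
   ('a \<Rightarrow> 'a tvec \<Rightarrow> 'a tvec \<Rightarrow> real) \<Rightarrow> bool" where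
  "parallel_form N \<D> B \<longleftrightarrow> (let \<X> = vector_fields N (carrier N) in
     \<forall>X\<in>\<X>. \<forall>Y\<in>\<X>. \<forall>Z\<in>\<X>. \<forall>p\<in>carrier N.
       X p (\<lambda>q. B q (Y q) (Z q)) - B p (\<D> X Y p) (Z p) - B p (Y p) (\<D> X Z p) = 0)"

definition torsion_free ::
  "('a, 'e::euclidean_space) mfd \<Rightarrow> (('a \<Rightarrow> 'a tvec) \<Rightarrow> ('a \<Rightarrow> 'a tvec) \<Rightarrow> 'a \<Rightarrow> 'a tvec) \<Rightarrow> bool" where
  "torsion_free N \<D> \<longleftrightarrow> (let \<X> = vector_fields N (carrier N) in
     \<forall>X\<in>\<X>. \<forall>Y\<in>\<X>. \<forall>p\<in>carrier N.
       (\<lambda>f. \<D> X Y p f - \<D> Y X p f) = lie_bracket N X Y p)"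

definition levi_civita ::
  "('a, 'e::euclidean_space) mfd \<Rightarrow> ('a \<Rightarrow> 'a tvec \<Rightarrow> 'a tvec \<Rightarrow> real) \<Rightarrow>
   (('a \<Rightarrow> 'a tvec) \<Rightarrow> ('a \<Rightarrow> 'a tvec) \<Rightarrow> 'a \<Rightarrow> 'a tvec) \<Rightarrow> bool" where
  "levi_civita N h \<D> \<longleftrightarrow> covariant_connection N \<D> \<and> torsion_free N \<D> \<and> parallel_form N \<D> h"

text \<open>
  \<open>local_lift M \<pi> S X x \<alpha>\<close>: \<open>\<alpha>\<close> is a 1-form on an open subset of \<open>M\<close> containing \<open>x\<close>, and
  \<open>#\<^sub>\<pi>(\<alpha>) = X\<close> along \<open>S\<close> near \<open>x\<close>, where near refers to the topology of \<open>S\<close>. (The trace on \<open>S\<close> of an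
  open subset of \<open>M\<close> may accumulate at \<open>x\<close>, so one cannot ask for equality on the whole trace.)
\<close>

definition local_lift ::
  "('a, 'e::euclidean_space) mfd \<Rightarrow> ('a \<Rightarrow> 'a covec \<Rightarrow> 'a covec \<Rightarrow> real) \<Rightarrow> ('a, 'e) mfd \<Rightarrow>
   ('a \<Rightarrow> 'a tvec) \<Rightarrow> 'a \<Rightarrow> ('a \<Rightarrow> 'a covec) \<Rightarrow> bool" where
  "local_lift M \<pi> S X x \<alpha> \<longleftrightarrow> (\<exists>U W. openin (topo M) U \<and> \<alpha> \<in> one_forms M U \<and>
     openin (topo S) W \<and> x \<in> W \<and> W \<subseteq> U \<and>
     (\<forall>y\<in>W. sharp_form M \<pi> \<alpha> y = incl_deriv M y (X y)))"

definition leaf_conn ::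
  "('a, 'e::euclidean_space) mfd \<Rightarrow> ('a \<Rightarrow> 'a tvec \<Rightarrow> 'a tvec \<Rightarrow> real) \<Rightarrow>
   ('a \<Rightarrow> 'a covec \<Rightarrow> 'a covec \<Rightarrow> real) \<Rightarrow> ('a, 'e) mfd \<Rightarrow>
   ('a \<Rightarrow> 'a tvec) \<Rightarrow> ('a \<Rightarrow> 'a tvec) \<Rightarrow> 'a \<Rightarrow> 'a tvec" where
  "leaf_conn M g \<pi> S X Y x = (THE v. v \<in> tangent S x \<and>
     (\<exists>\<alpha> \<beta>. local_lift M \<pi> S X x \<alpha> \<and> local_lift M \<pi> S Y x \<beta> \<and>
        incl_deriv M x v = sharp_form M \<pi> (contra_conn M g \<pi> \<alpha> \<beta>) x))"

end

(*
  D^pi is torsion-free and metric for the cometric, and it is tensorial in its first argument.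
  Two identities carry the theorem. First, compatibility makes # a homomorphism from the bracket
  of 1-forms to the Lie bracket: the defect is cyclic, and D^pi pi = 0 shows that it is three
  times itself. Secondly, compatibility says
    gamma(# D_alpha beta) = #alpha . gamma(#beta) - (D_alpha gamma)(#beta),
  where #alpha is tangent to the leaf; so # D_alpha beta at a point depends on beta only through
  #beta along the leaf. Torsion-freeness and the homomorphism property transfer this to alpha.

  Parallelism of omega_S is then the compatibility condition itself. The restriction of g is
  parallel because D^pi commutes with the endomorphism J of the cotangent bundle relating pi to
  the cometric, and g(#beta, #gamma) is the cometric of J beta and J gamma.

  Lifts exist because a leaf is locally embedded, by the inverse function theorem: functions and
  vector fields on the leaf extend locally to M.
*)

theory Submission
  imports Defs
begin

section \<open>Smooth maps between Euclidean spaces\<close>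

text \<open>The objects of the statement (\<open>sharp_biv\<close>, \<open>lie_deriv\<close>,
  \<open>contra_conn\<close>, \<open>leaf_conn\<close>) are definite descriptions, so each must
  first be shown to denote. For \<open>lie_deriv\<close> and \<open>contra_conn\<close> the
  mechanism is tensoriality: a functional on germs of vector fields that is linear over functions is
  a covector. Hence everything is phrased with germs, that is, with \<open>eventually\<close> in
  \<open>nhdsin\<close>. Compatibility is assumed for global forms; bump functions carry it over to
  germs. Since tangent vectors are derivations, coordinate frames rest on Hadamard's lemma. Two
  topologies meet on a leaf: forms are germs in M, whereas the equality of #\<alpha> with a field on
  S is required only near the point in S. As for the dependence on \<alpha>: in # D_\<alpha> \<beta>
  = # D_\<beta> \<alpha> + [#\<alpha>, #\<beta>] the first summand is settled by the result on the
  second argument. In the bracket, evaluated on h, the function #\<alpha>(h) is differentiated along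
  #\<beta>, which is tangent to S, so only the values of #\<alpha> along S enter.\<close>

lemma has_derivative_cong_open:
  assumes "open N" "x \<in> N" "\<And>y. y \<in> N \<Longrightarrow> F y = G y"
  shows "(F has_derivative F') (at x) \<longleftrightarrow> (G has_derivative F') (at x)"
  using assms by (metis has_derivative_transform_within_open)

lemma Ck_on_cong:
  "open N \<Longrightarrow> (\<forall>x\<in>N. F x = G x) \<Longrightarrow> Ck_on k F N \<longleftrightarrow> Ck_on k G N"
proof (induction k arbitrary: F G)
  case 0
  then show ?case by (simp cong: continuous_on_cong)
next
  case (Suc k)
  have hd: "(F has_derivative F') (at x) \<longleftrightarrow> (G has_derivative F') (at x)" if "x \<in> N" for x F'
    using has_derivative_cong_open[OF Suc.prems(1) that] Suc.prems(2) by blast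
  have "Ck_on k (\<lambda>x. frechet_derivative F (at x) v) N \<longleftrightarrow>
      Ck_on k (\<lambda>x. frechet_derivative G (at x) v) N" for v
    by (rule Suc.IH) (auto simp: Suc.prems frechet_derivative_def hd)
  then show ?case
    by (auto simp: differentiable_def hd)
qed

lemma Ck_on_Suc_has_derivative:
  assumes "Ck_on (Suc k) F N" "x \<in> N"
  shows "(F has_derivative frechet_derivative F (at x)) (at x)"
  using assms frechet_derivative_works by auto

text \<open>\<open>Ck_on\<close> speaks of \<open>frechet_derivative\<close>, a choice operator,
  while the inductions below compute derivatives explicitly. Uniqueness of the derivative identifies
  the two on N, and \<open>Ck_on_cong\<close> exchanges them because N is open.\<close>

lemma Ck_on_SucI:
  assumes "open N" "\<And>x. x \<in> N \<Longrightarrow> (F has_derivative F' x) (at x)"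
    and "\<And>v. Ck_on k (\<lambda>x. F' x v) N"
  shows "Ck_on (Suc k) F N"
proof -
  have fd: "frechet_derivative F (at x) = F' x" if "x \<in> N" for x
    using assms(2)[OF that] by (metis frechet_derivative_at)
  have "Ck_on k (\<lambda>x. frechet_derivative F (at x) v) N" for v
    using Ck_on_cong[OF assms(1), of "\<lambda>x. frechet_derivative F (at x) v" "\<lambda>x. F' x v" k] fd assms(3)
    by simp
  then show ?thesis
    using assms(2) by (auto simp: differentiable_def)
qed

lemma Ck_on_subset: "Ck_on k F N \<Longrightarrow> N' \<subseteq> N \<Longrightarrow> Ck_on k F N'"
  by (induction k arbitrary: F) (auto intro: continuous_on_subset)

lemma Ck_on_Suc_lower: "Ck_on (Suc k) F N \<Longrightarrow> Ck_on k F N"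
proof (induction k arbitrary: F)
  case 0
  then show ?case
    by (auto intro!: continuous_at_imp_continuous_on differentiable_imp_continuous_within)
next
  case (Suc k)
  then show ?case by simp
qed

lemma Ck_on_continuous: "Ck_on k F N \<Longrightarrow> continuous_on N F"
proof (induction k)
  case (Suc k)
  then show ?case using Ck_on_Suc_lower by blast
qed simp

lemma Ck_on_const: "Ck_on k (\<lambda>x. c) N"
  by (induction k arbitrary: c) auto

lemma Ck_on_bounded_linear: "bounded_linear f \<Longrightarrow> open N \<Longrightarrow> Ck_on k f N"
proof (induction k)
  case 0
  then show ?case by (simp add: linear_continuous_on)
next
  case (Suc k)
  then show ?case
    by (intro Ck_on_SucI[where F' = "\<lambda>_. f"] bounded_linear_imp_has_derivative Ck_on_const)
qed

lemma Ck_on_add: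
  "open N \<Longrightarrow> Ck_on k F N \<Longrightarrow> Ck_on k G N \<Longrightarrow> Ck_on k (\<lambda>x. F x + G x) N"
proof (induction k arbitrary: F G)
  case 0
  then show ?case by (auto intro: continuous_on_add)
next
  case (Suc k)
  show ?case
    by (rule Ck_on_SucI[OF Suc.prems(1)
          has_derivative_add[OF Ck_on_Suc_has_derivative Ck_on_Suc_has_derivative]])
      (use Suc in auto)
qed

lemma (in bounded_bilinear) Ck_on:
  "open N \<Longrightarrow> Ck_on k F N \<Longrightarrow> Ck_on k G N \<Longrightarrow> Ck_on k (\<lambda>x. prod (F x) (G x)) N"
proof (induction k arbitrary: F G)
  case 0
  then show ?case by (auto intro: continuous_on)
next
  case (Suc k)
  have lower: "Ck_on k F N" "Ck_on k G N"
    using Suc.prems Ck_on_Suc_lower by blast+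
  show ?case
    by (rule Ck_on_SucI[OF Suc.prems(1) FDERIV[OF Ck_on_Suc_has_derivative Ck_on_Suc_has_derivative]])
      (use Suc lower in \<open>auto intro!: Ck_on_add\<close>)
qed

lemmas Ck_on_scaleR = bounded_bilinear.Ck_on[OF bounded_bilinear_scaleR]
lemmas Ck_on_mult = bounded_bilinear.Ck_on[OF bounded_bilinear_mult]

lemmas Ck_on_inner = bounded_bilinear.Ck_on[OF bounded_bilinear_inner]

lemma Ck_on_neg: "open N \<Longrightarrow> Ck_on k F N \<Longrightarrow> Ck_on k (\<lambda>x. - F x) N"
  using Ck_on_scaleR[OF _ Ck_on_const[of k "-1::real"], of N F] by simp

lemma Ck_on_sum:
  "open N \<Longrightarrow> (\<And>i. i \<in> I \<Longrightarrow> Ck_on k (F i) N) \<Longrightarrow> Ck_on k (\<lambda>x. \<Sum>i\<in>I. F i x) N"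
  by (induction I rule: infinite_finite_induct) (auto intro: Ck_on_const Ck_on_add)

lemma linear_expand_Basis:
  fixes f :: "'e::euclidean_space \<Rightarrow> 'b::real_vector"
  assumes "linear f"
  shows "f x = (\<Sum>b\<in>Basis. (x \<bullet> b) *\<^sub>R f b)"
proof -
  have "f x = f (\<Sum>b\<in>Basis. (x \<bullet> b) *\<^sub>R b)" by (simp add: euclidean_representation)
  also have "\<dots> = (\<Sum>b\<in>Basis. (x \<bullet> b) *\<^sub>R f b)"
    by (simp only: linear_sum[OF assms] linear_cmul[OF assms])
  finally show ?thesis .
qed

text \<open>By the chain rule the derivative in direction v is G'(F x)(F' x v), where the direction
  fed to G' moves with x. Expanding it in \<open>Basis\<close> leaves products of coordinates of F'
  x v with G'(F x) b for fixed b, which the induction hypothesis covers.\<close>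

lemma Ck_on_compose:
  fixes F :: "'e::euclidean_space \<Rightarrow> 'd::euclidean_space" and G :: "'d \<Rightarrow> 'b::real_normed_vector"
  shows "open N \<Longrightarrow> open N' \<Longrightarrow> Ck_on k F N \<Longrightarrow> Ck_on k G N' \<Longrightarrow> F ` N \<subseteq> N'
    \<Longrightarrow> Ck_on k (\<lambda>x. G (F x)) N"
proof (induction k arbitrary: F G)
  case 0
  then show ?case by (auto intro: continuous_on_compose2)
next
  case (Suc k)
  let ?F' = "\<lambda>x. frechet_derivative F (at x)" and ?G' = "\<lambda>x. frechet_derivative G (at x)"
  have lower: "Ck_on k F N" "Ck_on k G N'"
    using Suc.prems Ck_on_Suc_lower by blast+
  show ?case
  proof (rule Ck_on_SucI[OF \<open>open N\<close>])
    fix x assume x: "x \<in> N"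
    then have Fx: "F x \<in> N'" using Suc.prems by auto
    have dG: "(G has_derivative ?G' (F x)) (at (F x))"
      using Ck_on_Suc_has_derivative Suc.prems(4) Fx by blast
    have dF: "(F has_derivative ?F' x) (at x)"
      using Ck_on_Suc_has_derivative Suc.prems(3) x by blast
    have "(\<lambda>v. ?G' (F x) (?F' x v)) = (\<lambda>v. \<Sum>b\<in>Basis. (?F' x v \<bullet> b) *\<^sub>R ?G' (F x) b)"
      by (rule ext, rule linear_expand_Basis) (use dG has_derivative_linear in blast)
    then show "((\<lambda>x. G (F x)) has_derivative (\<lambda>v. \<Sum>b\<in>Basis. (?F' x v \<bullet> b) *\<^sub>R ?G' (F x) b)) (at x)"
      using has_derivative_compose[OF dF dG] by metis
  next
    fix v
    show "Ck_on k (\<lambda>x. \<Sum>b\<in>Basis. (?F' x v \<bullet> b) *\<^sub>R ?G' (F x) b) N"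
    proof (rule Ck_on_sum[OF \<open>open N\<close> Ck_on_scaleR[OF \<open>open N\<close>]])
      fix b :: 'd
      show "Ck_on k (\<lambda>x. ?F' x v \<bullet> b) N"
        using Suc.prems(1,3) by (auto intro!: Ck_on_inner Ck_on_const)
      show "Ck_on k (\<lambda>x. ?G' (F x) b) N"
        by (rule Suc.IH) (use Suc.prems lower in auto)
    qed
  qed
qed

section \<open>Smooth maps on open sets\<close>

definition Cinf :: "'e::euclidean_space set \<Rightarrow> ('e \<Rightarrow> 'b::real_normed_vector) \<Rightarrow> bool" where
  "Cinf N F \<longleftrightarrow> open N \<and> (\<forall>k. Ck_on k F N)"

lemma Cinf_open: "Cinf N F \<Longrightarrow> open N" by (simp add: Cinf_def)

lemma Cinf_subset: "Cinf N F \<Longrightarrow> open N' \<Longrightarrow> N' \<subseteq> N \<Longrightarrow> Cinf N' F"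
  unfolding Cinf_def using Ck_on_subset by blast

lemma Cinf_cong: "(\<And>x. x \<in> N \<Longrightarrow> F x = G x) \<Longrightarrow> Cinf N F \<longleftrightarrow> Cinf N G"
  unfolding Cinf_def using Ck_on_cong by blast

lemma Cinf_const: "open N \<Longrightarrow> Cinf N (\<lambda>x. c)"
  by (simp add: Cinf_def Ck_on_const)

lemma Cinf_linear:
  fixes f :: "'e::euclidean_space \<Rightarrow> 'b::real_normed_vector"
  shows "linear f \<Longrightarrow> open N \<Longrightarrow> Cinf N f"
  by (simp add: Cinf_def Ck_on_bounded_linear linear_conv_bounded_linear)

lemma Cinf_add: "Cinf N F \<Longrightarrow> Cinf N G \<Longrightarrow> Cinf N (\<lambda>x. F x + G x)"
  by (simp add: Cinf_def Ck_on_add)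

lemma Cinf_scaleR: "Cinf N F \<Longrightarrow> Cinf N G \<Longrightarrow> Cinf N (\<lambda>x. F x *\<^sub>R G x)"
  by (simp add: Cinf_def Ck_on_scaleR)

lemma Cinf_mult:
  fixes F G :: "'e::euclidean_space \<Rightarrow> 'b::real_normed_algebra"
  shows "Cinf N F \<Longrightarrow> Cinf N G \<Longrightarrow> Cinf N (\<lambda>x. F x * G x)"
  by (simp add: Cinf_def Ck_on_mult)

lemma Cinf_sum: "open N \<Longrightarrow> (\<And>i. i \<in> I \<Longrightarrow> Cinf N (F i)) \<Longrightarrow> Cinf N (\<lambda>x. \<Sum>i\<in>I. F i x)"
  by (simp add: Cinf_def Ck_on_sum)

lemma Cinf_inner:
  fixes F G :: "'e::euclidean_space \<Rightarrow> 'd::euclidean_space"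
  shows "Cinf N F \<Longrightarrow> Cinf N G \<Longrightarrow> Cinf N (\<lambda>x. F x \<bullet> G x)"
  by (simp add: Cinf_def Ck_on_inner)

lemma Cinf_compose:
  fixes F :: "'e::euclidean_space \<Rightarrow> 'd::euclidean_space"
  shows "Cinf N F \<Longrightarrow> Cinf N' G \<Longrightarrow> F ` N \<subseteq> N' \<Longrightarrow> Cinf N (\<lambda>x. G (F x))"
  unfolding Cinf_def using Ck_on_compose by blast

lemma Cinf_continuous_on: "Cinf N F \<Longrightarrow> continuous_on N F"
  unfolding Cinf_def by (metis Ck_on.simps(1))

lemma Cinf_has_derivative:
  "Cinf N F \<Longrightarrow> x \<in> N \<Longrightarrow> (F has_derivative frechet_derivative F (at x)) (at x)"
  unfolding Cinf_def using Ck_on_Suc_has_derivative by blast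

lemma Cinf_frechet_derivative: "Cinf N F \<Longrightarrow> Cinf N (\<lambda>x. frechet_derivative F (at x) v)"
  unfolding Cinf_def by (metis Ck_on.simps(2))

lemma Cinf_open_vimage: "Cinf N F \<Longrightarrow> open V \<Longrightarrow> open (N \<inter> F -` V)"
  using Cinf_continuous_on Cinf_open continuous_open_preimage by blast

section \<open>Smooth families of invertible linear maps and the inverse function theorem\<close>

lemma has_derivative_scaleR_zero_continuous:
  fixes f :: "'a::real_normed_vector \<Rightarrow> real" and g :: "'a \<Rightarrow> 'b::real_normed_vector"
  assumes f: "(f has_derivative f') (at z)" "f z = 0" and g: "isCont g z"
  shows "((\<lambda>x. f x *\<^sub>R g x) has_derivative (\<lambda>h. f' h *\<^sub>R g z)) (at z)"
proof -
  obtain K where K: "\<And>h. norm (f' h) \<le> norm h * K"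
    using bounded_linear.bounded[OF has_derivative_bounded_linear[OF f(1)]] by blast
  have lim: "((\<lambda>y. (f y - f z - f' (y - z)) /\<^sub>R norm (y - z)) \<longlongrightarrow> 0) (at z)"
    using f(1) by (simp add: has_derivative_at_within divide_inverse_commute)
  have g0: "((\<lambda>y. g y - g z) \<longlongrightarrow> 0) (at z)"
    using g by (simp add: isCont_def LIM_zero)
  \<comment> \<open>As f z = 0, the error quotient of the product is this term plus f'(y - z) (g y -
    g z) / |y - z|. The first tends to 0 because f is differentiable, the second because f' is
    bounded and g continuous; g need not be differentiable.\<close>
  have "((\<lambda>y. ((f y - f z - f' (y - z)) /\<^sub>R norm (y - z)) *\<^sub>R g y) \<longlongrightarrow> 0 *\<^sub>R g z) (at z)"
    by (intro tendsto_scaleR lim) (use g isCont_def in blast)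
  moreover have "((\<lambda>y. (f' (y - z) /\<^sub>R norm (y - z)) *\<^sub>R (g y - g z)) \<longlongrightarrow> 0) (at z)"
  proof (rule tendsto_0_le[where K = K, OF g0])
    have b: "norm (f' (y - z) /\<^sub>R norm (y - z)) \<le> K" if "y \<noteq> z" for y
      using K[of "y - z"] that by (simp add: field_simps)
    have "norm ((f' (y - z) /\<^sub>R norm (y - z)) *\<^sub>R (g y - g z)) \<le> norm (g y - g z) * K" if "y \<noteq> z" for y
      unfolding norm_scaleR[of "f' (y - z) /\<^sub>R norm (y - z)"] 
      using mult_right_mono[OF b[OF that], of "norm (g y - g z)"] by (simp only: mult.commute real_norm_def norm_ge_zero)
    then show "\<forall>\<^sub>F y in at z. norm ((f' (y - z) /\<^sub>R norm (y - z)) *\<^sub>R (g y - g z)) \<le> norm (g y - g z) * K"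
      by (simp only: eventually_at_filter) (auto intro!: always_eventually)
  qed
  ultimately have "((\<lambda>y. (f y *\<^sub>R g y - f z *\<^sub>R g z - f' (y - z) *\<^sub>R g z) /\<^sub>R norm (y - z)) \<longlongrightarrow> 0) (at z)"
    by (auto dest: tendsto_add simp: f(2) algebra_simps scaleR_diff_left)
  then show ?thesis
    using f by (auto simp: has_derivative_at_within intro!: bounded_linear_scaleR_const
      dest: has_derivative_bounded_linear)
qed

text \<open>The sum over \<open>Basis\<close> stands in for an operator norm: families of linear
  maps are known to be continuous only at fixed vectors, and this controls all directions at
  once.\<close>

lemma linear_diff_bound:
  fixes A B :: "'e::euclidean_space \<Rightarrow> 'b::real_normed_vector"
  assumes "linear A" "linear B"
  shows "norm (A u - B u) \<le> norm u * (\<Sum>b\<in>Basis. norm (A b - B b))"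
proof -
  have *: "A u - B u = (\<Sum>b\<in>Basis. (u \<bullet> b) *\<^sub>R (A b - B b))"
    using linear_expand_Basis[OF assms(1), of u] linear_expand_Basis[OF assms(2), of u]
    by (simp add: sum_subtractf scaleR_diff_right)
  have "norm (A u - B u) \<le> (\<Sum>b\<in>Basis. norm u * norm (A b - B b))"
    unfolding * by (rule sum_norm_le) (auto intro!: mult_right_mono Basis_le_norm)
  then show ?thesis by (simp only: sum_distrib_left)
qed

text \<open>The derivative of A^{-1} w is - A^{-1} (dA) A^{-1} w. If A is of class C^{k+1}, then the
  induction hypothesis makes A^{-1} of class C^k, hence also this expression.\<close>

lemma Ck_on_inverse_family:
  fixes A :: "'d::euclidean_space \<Rightarrow> 'e::euclidean_space \<Rightarrow> 'e"
  assumes N: "open N" and lin: "\<And>z. z \<in> N \<Longrightarrow> linear (A z)" and inj: "\<And>z. z \<in> N \<Longrightarrow> inj (A z)"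
  shows "(\<And>y. Ck_on k (\<lambda>z. A z y) N) \<Longrightarrow> Ck_on k (\<lambda>z. inv (A z) w) N"
proof (induction k arbitrary: w)
  have surj: "surj (A z)" if "z \<in> N" for z
    using lin inj that linear_injective_imp_surjective by blast
  have linB: "linear (inv (A z))" if "z \<in> N" for z
    using that inj_linear_imp_inv_linear lin inj by blast
  have AB: "A z (inv (A z) w) = w" and BA: "inv (A z) (A z w) = w" if "z \<in> N" for z w
    using surj inj that by (auto simp: surj_f_inv_f)
  have cont: "continuous_on N (\<lambda>z. inv (A z) w)" if A0: "\<And>y. continuous_on N (\<lambda>z. A z y)" for w
  proof (rule continuous_at_imp_continuous_on, rule ballI)
    fix z0 assume z0: "z0 \<in> N"
    \<comment> \<open>A z0 stretches every vector by at least c. Where A z is closer to A z0 than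
      c/2, in the sense of \<open>linear_diff_bound\<close>, A z still stretches by at least c/2;
      this is the origin of the factor 2/c.\<close>
    obtain c where c: "c > 0" "\<And>x. norm (A z0 x) \<ge> c * norm x"
      using linear_inj_bounded_below_pos[OF lin inj] z0 by metis
    have tend: "((\<lambda>z. A z y) \<longlongrightarrow> A z0 y) (at z0)" for y
      using A0[of y] z0 N by (simp add: continuous_on_eq_continuous_at isCont_def)
    have "((\<lambda>z. \<Sum>b\<in>Basis. norm (A z b - A z0 b)) \<longlongrightarrow> (\<Sum>b\<in>Basis. norm (A z0 b - A z0 b))) (at z0)"
      by (intro tendsto_intros tend)
    then have "\<forall>\<^sub>F z in at z0. (\<Sum>b\<in>Basis. norm (A z b - A z0 b)) < c/2"
      by (rule order_tendstoD(2)) (use c(1) in simp)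
    moreover have "\<forall>\<^sub>F z in at z0. z \<in> N"
      using N z0 eventually_at_in_open' by blast
    ultimately have bd: "\<forall>\<^sub>F z in at z0. norm (inv (A z) w - inv (A z0) w) \<le>
        norm (A z (inv (A z0) w) - A z0 (inv (A z0) w)) * (2 / c)"
      (is "eventually (\<lambda>z. _ \<le> ?e z) _")
    proof eventually_elim
      case (elim z)
      define u where "u = inv (A z) w - inv (A z0) w"
      have "norm (A z u - A z0 u) \<le> norm u * (\<Sum>b\<in>Basis. norm (A z b - A z0 b))"
        using elim z0 by (intro linear_diff_bound lin) auto
      also have "\<dots> \<le> norm u * (c/2)"
        using elim by (intro mult_left_mono) auto
      finally have "norm (A z u) \<ge> c * norm u - norm u * (c/2)"
        using c(2)[of u] norm_triangle_ineq3[of "A z u" "A z0 u"] by linarith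
      then have "norm u \<le> norm (A z u) * (2/c)"
        using c(1) by (simp add: field_simps)
      moreover have "A z u = A z0 (inv (A z0) w) - A z (inv (A z0) w)"
        using elim z0 AB by (simp add: u_def linear_diff[OF lin])
      ultimately show ?case
        by (simp add: u_def norm_minus_commute)
    qed
    have "((\<lambda>z. norm (A z (inv (A z0) w) - A z0 (inv (A z0) w)) * (2 / c)) \<longlongrightarrow> norm (0::'e) * (2 / c)) (at z0)"
      by (intro tendsto_mult tendsto_norm LIM_zero tend tendsto_const)
    then have lim0: "((\<lambda>z. norm (A z (inv (A z0) w) - A z0 (inv (A z0) w)) * (2 / c)) \<longlongrightarrow> 0) (at z0)"
      by simp
    have "((\<lambda>z. inv (A z) w - inv (A z0) w) \<longlongrightarrow> 0) (at z0)"
      by (rule Lim_null_comparison[OF bd lim0])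
    then show "isCont (\<lambda>z. inv (A z) w) z0"
      unfolding isCont_def by (rule LIM_zero_cancel)
  qed
  {
  case 0
  then show ?case using cont by simp
next
  case (Suc k)
  let ?A' = "\<lambda>z y. frechet_derivative (\<lambda>z. A z y) (at z)"
  have lower: "Ck_on k (\<lambda>z. A z y) N" for y
    using Suc.prems Ck_on_Suc_lower by blast
  have B: "Ck_on k (\<lambda>z. inv (A z) w) N" for w
    using Suc.IH lower by blast
  have B0: "continuous_on N (\<lambda>z. inv (A z) w)" for w
    using B Ck_on_continuous by blast
  have dA: "((\<lambda>z. A z y) has_derivative ?A' z y) (at z)" if "z \<in> N" for z y
    using Ck_on_Suc_has_derivative Suc.prems that by blast
  show ?case
  proof (rule Ck_on_SucI[OF N])
    fix z assume z: "z \<in> N"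
    \<comment> \<open>With this y held fixed, A(x)^{-1} w - y = A(x)^{-1} (- (A x y - A z y)). The
      argument vanishes at x = z, so the product rule at a zero applies, and A(x)^{-1} b has to be
      merely continuous in x.\<close>
    let ?y = "inv (A z) w"
    let ?u' = "\<lambda>h. - (\<Sum>b'\<in>Basis. (?y \<bullet> b') *\<^sub>R ?A' z b' h)"
    have "((\<lambda>x. - (A x ?y - A z ?y)) has_derivative ?u') (at z)"
    proof (rule has_derivative_transform_within_open[OF _ N z])
      show "((\<lambda>x. - ((\<Sum>b'\<in>Basis. (?y \<bullet> b') *\<^sub>R A x b') - A z ?y)) has_derivative ?u') (at z)"
        by (auto intro!: derivative_eq_intros dA z)
      fix x assume "x \<in> N"
      then show "- ((\<Sum>b'\<in>Basis. (?y \<bullet> b') *\<^sub>R A x b') - A z ?y) = - (A x ?y - A z ?y)"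
        using linear_expand_Basis[OF lin, of x ?y] by simp
    qed
    then have "((\<lambda>x. - (A x ?y - A z ?y) \<bullet> b) has_derivative (\<lambda>h. ?u' h \<bullet> b)) (at z)" for b
      by (rule has_derivative_inner_left)
    then have "((\<lambda>x. \<Sum>b\<in>Basis. (- (A x ?y - A z ?y) \<bullet> b) *\<^sub>R inv (A x) b) has_derivative
        (\<lambda>h. \<Sum>b\<in>Basis. (?u' h \<bullet> b) *\<^sub>R inv (A z) b)) (at z)"
      using B0 z N by (intro has_derivative_sum has_derivative_scaleR_zero_continuous)
        (auto simp: continuous_on_eq_continuous_at)
    then have "((\<lambda>x. ?y + (\<Sum>b\<in>Basis. (- (A x ?y - A z ?y) \<bullet> b) *\<^sub>R inv (A x) b)) has_derivative
        (\<lambda>h. \<Sum>b\<in>Basis. (?u' h \<bullet> b) *\<^sub>R inv (A z) b)) (at z)"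
      using has_derivative_add[OF has_derivative_const[of ?y]] by fastforce
    then show "((\<lambda>z. inv (A z) w) has_derivative (\<lambda>h. \<Sum>b\<in>Basis. (?u' h \<bullet> b) *\<^sub>R inv (A z) b)) (at z)"
    proof (rule has_derivative_transform_within_open[OF _ N z])
      fix x assume x: "x \<in> N"
      have "(\<Sum>b\<in>Basis. (- (A x ?y - A z ?y) \<bullet> b) *\<^sub>R inv (A x) b) = inv (A x) (- (A x ?y - A z ?y))"
        using linear_expand_Basis[OF linB[OF x]] by metis
      also have "\<dots> = inv (A x) w - ?y"
        using x z by (simp add: AB BA linear_diff[OF linB])
      finally show "?y + (\<Sum>b\<in>Basis. (- (A x ?y - A z ?y) \<bullet> b) *\<^sub>R inv (A x) b) = inv (A x) w"
        by simp
    qed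
  next
    fix v
    have "Ck_on k (\<lambda>z. ?A' z y v) N" for y using Suc.prems by simp
    then show "Ck_on k (\<lambda>z. \<Sum>b\<in>Basis. (- (\<Sum>b'\<in>Basis. (inv (A z) w \<bullet> b') *\<^sub>R ?A' z b' v) \<bullet> b) *\<^sub>R inv (A z) b) N"
      unfolding inner_minus_left inner_sum_left inner_scaleR_left scaleR_minus_left scaleR_minus_right[symmetric]
      by (intro Ck_on_sum Ck_on_scaleR N Ck_on_neg Ck_on_mult B Ck_on_inner Ck_on_const)
  qed
  }
qed

lemma Cinf_inverse_family:
  fixes A :: "'d::euclidean_space \<Rightarrow> 'e::euclidean_space \<Rightarrow> 'e"
  assumes "open N" "\<And>z. z \<in> N \<Longrightarrow> linear (A z)" "\<And>z. z \<in> N \<Longrightarrow> inj (A z)" "\<And>y. Cinf N (\<lambda>z. A z y)"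
  shows "Cinf N (\<lambda>z. inv (A z) w)"
  using assms Ck_on_inverse_family[of N A] by (simp add: Cinf_def)

text \<open>A z0 stretches every vector by at least some c > 0, and a perturbation of size less than
  c cannot send a nonzero vector to 0.\<close>

lemma inj_linear_open_condition:
  fixes A :: "'d::euclidean_space \<Rightarrow> 'e::euclidean_space \<Rightarrow> 'e"
  assumes N: "open N" "z0 \<in> N" and lin: "\<And>z. z \<in> N \<Longrightarrow> linear (A z)" and inj: "inj (A z0)"
    and cont: "\<And>y. continuous_on N (\<lambda>z. A z y)"
  obtains N' where "open N'" "z0 \<in> N'" "N' \<subseteq> N" "\<And>z. z \<in> N' \<Longrightarrow> inj (A z)"
proof -
  obtain c where c: "c > 0" "\<And>x. norm (A z0 x) \<ge> c * norm x"
    using linear_inj_bounded_below_pos[OF lin inj] N by metis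
  let ?s = "\<lambda>z. \<Sum>b\<in>Basis. norm (A z b - A z0 b)"
  have "continuous_on N ?s"
    by (intro continuous_on_sum continuous_on_norm continuous_on_diff cont continuous_on_const)
  then have "open (N \<inter> ?s -` {..<c})"
    by (rule continuous_open_preimage[OF _ N(1)]) simp
  moreover have "inj (A z)" if z: "z \<in> N \<inter> ?s -` {..<c}" for z
  proof -
    have lz: "linear (A z)" and l0: "linear (A z0)" using lin z N by auto
    have "u = 0" if "A z u = 0" for u
    proof -
      have "norm (A z0 u) \<le> norm u * ?s z"
        using linear_diff_bound[OF lz l0, of u] that by simp
      then have "c * norm u \<le> norm u * ?s z" using c(2)[of u] by linarith
      moreover have "norm u * ?s z < norm u * c" if "u \<noteq> 0"
        using z that by (intro mult_strict_left_mono) auto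
      ultimately show "u = 0" by (metis mult.commute not_less)
    qed
    then show ?thesis using linear_injective_0[OF lz] by blast
  qed
  ultimately show thesis
    using that[of "N \<inter> ?s -` {..<c}"] N c(1) by auto
qed

text \<open>The inverse function theorem gives a local inverse g with derivative \<open>inv\<close>
  of F' at g y. The rest is a bootstrap: if g is C^k, then so is y \<mapsto> F'(g y), hence its
  pointwise inverse by \<open>Ck_on_inverse_family\<close>, and so g is C^{k+1}.\<close>

lemma Cinf_inverse_function:
  fixes F :: "'e::euclidean_space \<Rightarrow> 'e"
  assumes F: "Cinf N F" and z0: "z0 \<in> N" and inj: "inj (frechet_derivative F (at z0))"
  obtains N' V G where "open N'" "N' \<subseteq> N" "z0 \<in> N'" "F z0 \<in> V" "Cinf V G"
    "\<And>z. z \<in> N' \<Longrightarrow> F z \<in> V \<and> G (F z) = z"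
proof -
  let ?F' = "\<lambda>z. frechet_derivative F (at z)"
  have lin: "linear (?F' z)" if "z \<in> N" for z
    using Cinf_has_derivative[OF F that] has_derivative_linear by blast
  \<comment> \<open>\<open>inverse_function_theorem\<close> takes the derivative as a continuous map
    into the bounded linear functions; in finite dimension continuity in each direction is enough
    for that.\<close>
  define f' where "f' z = Blinfun (?F' z)" for z
  have f': "blinfun_apply (f' z) = ?F' z" if "z \<in> N" for z
    using lin[OF that] by (simp add: f'_def bounded_linear_Blinfun_apply linear_conv_bounded_linear)
  have "continuous_on N (\<lambda>z. ?F' z i)" for i
    using Cinf_frechet_derivative[OF F] by (rule Cinf_continuous_on)
  then have contf': "continuous_on N f'"
    by (intro continuous_on_blinfun_componentwise) (simp cong: continuous_on_cong add: f')
  obtain g0 where g0: "linear g0" "g0 \<circ> ?F' z0 = id"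
    using linear_injective_left_inverse[OF lin[OF z0] inj] by blast
  have "Blinfun g0 o\<^sub>L f' z0 = id_blinfun"
    using g0 z0 by (intro blinfun_eqI)
      (simp add: f' bounded_linear_Blinfun_apply linear_conv_bounded_linear pointfree_idE)
  then obtain U' V g g' where U': "open U'" "U' \<subseteq> N" "z0 \<in> U'" "open V" "F z0 \<in> V"
      "homeomorphism U' V F g"
      and g: "\<And>y. y \<in> V \<Longrightarrow> (g has_derivative g' y) (at y)"
        "\<And>y. y \<in> V \<Longrightarrow> g' y = inv (blinfun_apply (f' (g y)))"
        "\<And>y. y \<in> V \<Longrightarrow> bij (blinfun_apply (f' (g y)))"
    using inverse_function_theorem[OF Cinf_open[OF F] _ contf' z0, of F "Blinfun g0"]
      Cinf_has_derivative[OF F] f' by metis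
  have gN: "g y \<in> N" if "y \<in> V" for y
    using U' that by (auto simp: homeomorphism_def)
  have "Ck_on k g V" for k
  proof (induction k)
    case 0
    show ?case using U' by (simp add: homeomorphism_def)
  next
    case (Suc k)
    show ?case
    proof (rule Ck_on_SucI[OF \<open>open V\<close>])
      show "(g has_derivative inv (?F' (g y))) (at y)" if "y \<in> V" for y
        using g(1,2)[OF that] f'[OF gN[OF that]] by simp
      show "Ck_on k (\<lambda>y. inv (?F' (g y)) v) V" for v
      proof (rule Ck_on_inverse_family[OF \<open>open V\<close>])
        show "linear (?F' (g z))" if "z \<in> V" for z using lin gN that by blast
        show "inj (?F' (g z))" if "z \<in> V" for z
          using g(3)[OF that] f'[OF gN[OF that]] by (simp add: bij_is_inj)
        show "Ck_on k (\<lambda>z. ?F' (g z) y) V" for y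
          by (rule Ck_on_compose[OF \<open>open V\<close> Cinf_open[OF F] Suc.IH])
            (use Cinf_frechet_derivative[OF F] gN in \<open>auto simp: Cinf_def\<close>)
      qed
    qed
  qed
  then have "Cinf V g" using \<open>open V\<close> by (simp add: Cinf_def)
  moreover have "F z \<in> V \<and> g (F z) = z" if "z \<in> U'" for z
    using U' that by (auto simp: homeomorphism_def)
  ultimately show thesis using that U' by blast
qed

text \<open>The one-dimensional case of \<open>Cinf_inverse_family\<close>: 1 / f z is the preimage
  of 1 under multiplication by f z.\<close>

lemma Cinf_inverse_real:
  fixes f :: "'d::euclidean_space \<Rightarrow> real"
  assumes "Cinf N f" "\<And>z. z \<in> N \<Longrightarrow> f z \<noteq> 0"
  shows "Cinf N (\<lambda>z. inverse (f z))"
proof -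
  have "Cinf N (\<lambda>z. inv (\<lambda>y. f z * y) 1)"
  proof (rule Cinf_inverse_family)
    show "inj ((*) (f z))" if "z \<in> N" for z using assms(2)[OF that] by (simp add: inj_on_def)
    show "Cinf N (\<lambda>z. f z * y)" for y
      using assms(1) by (intro Cinf_mult Cinf_const) (auto dest: Cinf_open)
  qed (auto simp: Cinf_open[OF assms(1)] linear_times)
  moreover have "inv (\<lambda>y. f z * y) 1 = inverse (f z)" if "z \<in> N" for z
    using assms(2)[OF that] by (intro inv_f_eq) (auto simp: inj_on_def)
  ultimately show ?thesis using Cinf_cong[of N "\<lambda>z. inverse (f z)" "\<lambda>z. inv (\<lambda>y. f z * y) 1"] by simp
qed

subsection \<open>Hadamard's lemma\<close>

text \<open>Each differentiation under the integral brings out a factor t, by the chain rule along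
  the ray from p to z. The weight t^m is there to make the induction close; Hadamard's lemma takes m
  = 0.\<close>

lemma Ck_on_ray_integral:
  fixes F :: "'e::euclidean_space \<Rightarrow> real"
  shows "Ck_on k F (ball p r) \<Longrightarrow>
    Ck_on k (\<lambda>z. integral (cbox 0 1) (\<lambda>t. t ^ m * F (p + t *\<^sub>R (z - p)))) (ball p r)"
proof (induction k arbitrary: F m)
  have ray: "p + t *\<^sub>R (z - p) \<in> ball p r" if "z \<in> ball p r" "t \<in> cbox 0 1" for z and t :: real
  proof -
    have "t * norm (z - p) \<le> 1 * norm (z - p)" using that by (intro mult_right_mono) auto
    then show ?thesis using that by (simp add: dist_norm norm_minus_commute)
  qed
  have contray: "continuous_on (ball p r \<times> cbox 0 1) (\<lambda>(z,t). t ^ m * F (p + t *\<^sub>R (z - p)))"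
    if "continuous_on (ball p r) F" for F :: "'e \<Rightarrow> real" and m
    unfolding case_prod_unfold
    by (intro continuous_intros continuous_on_compose2[OF that]) (auto intro!: ray)
  {
    case 0
    then show ?case using integral_continuous_on_param[OF contray] by simp
  next
    case (Suc k)
    let ?F' = "\<lambda>z. frechet_derivative F (at z)"
    have dF: "(F has_derivative ?F' z) (at z)" if "z \<in> ball p r" for z
      using Ck_on_Suc_has_derivative[OF Suc.prems that] .
    have F': "Ck_on k (\<lambda>z. ?F' z v) (ball p r)" for v
      using Suc.prems by simp
    define f' where "f' z t = Blinfun (\<lambda>v. t ^ Suc m * ?F' (p + t *\<^sub>R (z - p)) v)" for z t
    have f': "blinfun_apply (f' z t) = (\<lambda>v. t ^ Suc m * ?F' (p + t *\<^sub>R (z - p)) v)"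
      if "z \<in> ball p r" "t \<in> cbox 0 1" for z t
      unfolding f'_def using has_derivative_bounded_linear[OF dF[OF ray[OF that]]]
      by (intro bounded_linear_Blinfun_apply bounded_linear_const_mult)
    have contF: "continuous_on (ball p r) F"
      using Suc.prems Ck_on_continuous by blast
    have contf': "continuous_on (ball p r \<times> cbox 0 1) (\<lambda>(z,t). f' z t)"
    proof (rule continuous_on_blinfun_componentwise)
      fix i :: 'e
      show "continuous_on (ball p r \<times> cbox 0 1) (\<lambda>x. blinfun_apply (case x of (z,t) \<Rightarrow> f' z t) i)"
        using contray[OF Ck_on_continuous[OF F'], of "Suc m" i]
        by (rule continuous_on_eq) (auto simp: f')
    qed
    have fd: "((\<lambda>z. t ^ m * F (p + t *\<^sub>R (z - p))) has_derivative blinfun_apply (f' z t)) (at z within ball p r)"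
      if "z \<in> ball p r" "t \<in> cbox 0 1" for z t
    proof -
      have lin: "linear (?F' (p + t *\<^sub>R (z - p)))"
        using dF[OF ray[OF that]] has_derivative_linear by blast
      have "((\<lambda>z. p + t *\<^sub>R (z - p)) has_derivative (\<lambda>v. t *\<^sub>R v)) (at z within ball p r)"
        by (auto intro!: derivative_eq_intros)
      then have "((\<lambda>z. F (p + t *\<^sub>R (z - p))) has_derivative (\<lambda>v. ?F' (p + t *\<^sub>R (z - p)) (t *\<^sub>R v))) (at z within ball p r)"
        using dF[OF ray[OF that]]
        by (rule has_derivative_compose[where f = "\<lambda>z. p + t *\<^sub>R (z - p)" and g = F])
      then have "((\<lambda>z. t ^ m * F (p + t *\<^sub>R (z - p))) has_derivative
          (\<lambda>v. t ^ m * ?F' (p + t *\<^sub>R (z - p)) (t *\<^sub>R v))) (at z within ball p r)"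
        by (rule has_derivative_mult_right)
      then show ?thesis
        by (simp add: f'[OF that] linear_cmul[OF lin] mult.assoc mult.left_commute)
    qed
    have slice: "continuous_on (cbox 0 1) (\<lambda>t. G z t)"
      if "continuous_on (ball p r \<times> cbox 0 1) (\<lambda>(z,t). G z t)" "z \<in> ball p r"
      for G :: "'e \<Rightarrow> real \<Rightarrow> 'x::topological_space" and z
    proof -
      have "continuous_on (cbox 0 1) (\<lambda>t::real. (z,t))"
        by (intro continuous_on_Pair continuous_on_const continuous_on_id)
      from continuous_on_compose2[OF that(1) this] show ?thesis using that(2) by (simp add: image_subset_iff)
    qed
    show ?case
    proof (rule Ck_on_SucI)
      fix z assume z: "z \<in> ball p r"
      have "((\<lambda>z. integral (cbox 0 1) (\<lambda>t. t ^ m * F (p + t *\<^sub>R (z - p)))) has_derivative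
          blinfun_apply (integral (cbox 0 1) (f' z))) (at z within ball p r)"
        using slice[OF contray[OF contF]]
        by (intro leibniz_rule[OF fd _ contf' z] integrable_continuous) auto
      moreover have "blinfun_apply (integral (cbox 0 1) (f' z)) v =
          integral (cbox 0 1) (\<lambda>t. t ^ Suc m * ?F' (p + t *\<^sub>R (z - p)) v)" for v
      proof -
        have "f' z integrable_on cbox 0 1"
          using slice[OF contf' z] by (rule integrable_continuous)
        then show ?thesis
          by (subst blinfun_apply_integral) (auto intro!: integral_cong simp: f'[OF z])
      qed
      ultimately show "((\<lambda>z. integral (cbox 0 1) (\<lambda>t. t ^ m * F (p + t *\<^sub>R (z - p)))) has_derivative
          (\<lambda>v. integral (cbox 0 1) (\<lambda>t. t ^ Suc m * ?F' (p + t *\<^sub>R (z - p)) v))) (at z)"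
        using z at_within_open[of z "ball p r"] by (metis (no_types, lifting) ext open_ball)
    next
      show "Ck_on k (\<lambda>z. integral (cbox 0 1) (\<lambda>t. t ^ Suc m * ?F' (p + t *\<^sub>R (z - p)) v)) (ball p r)" for v
        by (rule Suc.IH) (rule F')
    qed simp
  }
qed

text \<open>Integrate the derivative of F along the segment from p to z. The set B is left free
  because points of a chart image differ by vectors of the model subspace, so that there an
  orthonormal basis of that subspace is the right choice.\<close>

lemma Hadamard:
  fixes F :: "'e::euclidean_space \<Rightarrow> real"
  assumes F: "Cinf (ball p r) F"
  obtains G where "\<And>b. Cinf (ball p r) (G b)" "\<And>b. G b p = frechet_derivative F (at p) b"
    "\<And>z B. z \<in> ball p r \<Longrightarrow> z - p = (\<Sum>b\<in>B. ((z - p) \<bullet> b) *\<^sub>R b) \<Longrightarrow>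
      F z = F p + (\<Sum>b\<in>B. ((z - p) \<bullet> b) * G b z)"
proof -
  let ?F' = "\<lambda>z. frechet_derivative F (at z)"
  define G where "G b z = integral (cbox 0 1) (\<lambda>t::real. ?F' (p + t *\<^sub>R (z - p)) b)" for b z
  have ray: "p + t *\<^sub>R (z - p) \<in> ball p r" if "z \<in> ball p r" "t \<in> cbox 0 1" for z and t :: real
  proof -
    have "t * norm (z - p) \<le> 1 * norm (z - p)" using that by (intro mult_right_mono) auto
    then show ?thesis using that by (simp add: dist_norm norm_minus_commute)
  qed
  have F': "Cinf (ball p r) (\<lambda>z. ?F' z b)" for b
    using Cinf_frechet_derivative[OF F] .
  have "Cinf (ball p r) (G b)" for b
    using Ck_on_ray_integral[of _ "\<lambda>z. ?F' z b" p r 0] F'[of b] by (simp add: Cinf_def G_def[abs_def])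
  moreover have "G b p = ?F' p b" for b by (simp add: G_def)
  moreover have "F z = F p + (\<Sum>b\<in>B. ((z - p) \<bullet> b) * G b z)"
    if z: "z \<in> ball p r" and B: "z - p = (\<Sum>b\<in>B. ((z - p) \<bullet> b) *\<^sub>R b)" for z B
  proof -
    have "((\<lambda>t. ?F' (p + t *\<^sub>R (z - p)) (z - p)) has_integral
        (F (p + 1 *\<^sub>R (z - p)) - F (p + 0 *\<^sub>R (z - p)))) {0..1}"
    proof (rule fundamental_theorem_of_calculus)
      fix t :: real assume t: "t \<in> {0..1}"
      have d: "(F has_derivative ?F' (p + t *\<^sub>R (z - p))) (at (p + t *\<^sub>R (z - p)))"
        using Cinf_has_derivative[OF F] ray[OF z] t by simp
      have "((\<lambda>t. p + t *\<^sub>R (z - p)) has_derivative (\<lambda>s. s *\<^sub>R (z - p))) (at t within {0..1})"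
        by (auto intro!: derivative_eq_intros)
      from this d
      have "((\<lambda>t. F (p + t *\<^sub>R (z - p))) has_derivative (\<lambda>s. ?F' (p + t *\<^sub>R (z - p)) (s *\<^sub>R (z - p)))) (at t within {0..1})"
        by (rule has_derivative_compose[where f = "\<lambda>t. p + t *\<^sub>R (z - p)" and g = F])
      then show "((\<lambda>t. F (p + t *\<^sub>R (z - p))) has_vector_derivative ?F' (p + t *\<^sub>R (z - p)) (z - p)) (at t within {0..1})"
        by (simp add: has_vector_derivative_def linear_cmul[OF has_derivative_linear[OF d]])
    qed simp
    then have "F z - F p = integral {0..1} (\<lambda>t. ?F' (p + t *\<^sub>R (z - p)) (z - p))"
      by (simp add: integral_unique)
    also have "\<dots> = integral {0..1} (\<lambda>t. \<Sum>b\<in>B. ((z - p) \<bullet> b) * ?F' (p + t *\<^sub>R (z - p)) b)"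
    proof (rule integral_cong)
      fix t :: real assume t: "t \<in> {0..1}"
      have lin: "linear (?F' (p + t *\<^sub>R (z - p)))"
        using Cinf_has_derivative[OF F] ray[OF z] t has_derivative_linear by fastforce
      have "?F' (p + t *\<^sub>R (z - p)) (z - p) = ?F' (p + t *\<^sub>R (z - p)) (\<Sum>b\<in>B. ((z - p) \<bullet> b) *\<^sub>R b)"
        using B by simp
      then show "?F' (p + t *\<^sub>R (z - p)) (z - p) = (\<Sum>b\<in>B. ((z - p) \<bullet> b) * ?F' (p + t *\<^sub>R (z - p)) b)"
        by (simp add: linear_sum[OF lin] linear_cmul[OF lin])
    qed
    also have "\<dots> = (\<Sum>b\<in>B. ((z - p) \<bullet> b) * G b z)"
    proof (cases "finite B")
      case True
      have "(\<lambda>t. ?F' (p + t *\<^sub>R (z - p)) b) integrable_on {0..1}" for b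
      proof (rule integrable_continuous_real, rule continuous_on_compose2[OF Cinf_continuous_on[OF F']])
        show "continuous_on {0..1} (\<lambda>t. p + t *\<^sub>R (z - p))"
          by (intro continuous_on_add continuous_on_scaleR continuous_on_const continuous_on_id)
        show "(\<lambda>t. p + t *\<^sub>R (z - p)) ` {0..1} \<subseteq> ball p r"
          using ray[OF z] by (simp add: image_subset_iff)
      qed
      then show ?thesis
        using True by (subst integral_sum) (auto simp: G_def integrable_on_mult_right)
    qed simp
    finally show ?thesis by simp
  qed
  ultimately show thesis using that by blast
qed

subsection \<open>Bump functions\<close>

text \<open>The power m makes the family closed under differentiation: the derivative of the m-th
  function is the (m+2)-nd minus m times the (m+1)-st. One induction then treats all m.\<close>

lemma flat_fun_Ck_on:
  fixes m :: nat
  shows "Ck_on k (\<lambda>t::real. if t > 0 then (1/t) ^ m * exp (- (1/t)) else 0) UNIV"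
proof (induction k arbitrary: m)
  let ?f = "\<lambda>m t::real. if t > 0 then (1/t) ^ m * exp (- (1/t)) else 0"
  have flat: "((\<lambda>t. (1/t) ^ m * exp (- (1/t))) \<longlongrightarrow> (0::real)) (at_right 0)" for m
  proof -
    have "((\<lambda>t::real. (inverse t) ^ m / exp (inverse t)) \<longlongrightarrow> 0) (at_right 0)"
      by (rule filterlim_compose[OF tendsto_power_div_exp_0 filterlim_inverse_at_top_right])
    then show ?thesis
      by (simp add: exp_minus divide_inverse)
  qed
  have deriv: "(?f m has_real_derivative (?f (m + 2) t - real m * ?f (m + 1) t)) (at t)" for m t
  proof -
    consider "t > 0" | "t < 0" | "t = 0" by linarith
    then show ?thesis
    proof cases
      case 1
      have "((\<lambda>t. 1/t) has_real_derivative - ((1/t)\<^sup>2)) (at t)"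
        using 1 by (auto intro!: derivative_eq_intros simp: power2_eq_square)
      note s = this DERIV_power[OF this, of m]
      have "real m * ((1/t) ^ (m - Suc 0) * (1/t)\<^sup>2) = real m * (1/t) ^ (m + 1)"
        by (cases m) (simp_all add: power2_eq_square)
      then have "((\<lambda>t. (1/t) ^ m * exp (- (1/t))) has_real_derivative
          (?f (m + 2) t - real m * ?f (m + 1) t)) (at t)"
        using 1 DERIV_mult[OF s(2) DERIV_fun_exp[OF DERIV_minus[OF s(1)]]]
        by (elim DERIV_cong) (simp add: power_add power2_eq_square algebra_simps)
      then show ?thesis
        by (rule has_field_derivative_transform_within_open[where S = "{0<..}"]) (use 1 in auto)
    next
      case 2
      have "((\<lambda>t. 0) has_real_derivative (?f (m + 2) t - real m * ?f (m + 1) t)) (at t)"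
        using 2 by auto
      then show ?thesis
        by (rule has_field_derivative_transform_within_open[where S = "{..<0}"]) (use 2 in auto)
    next
      case 3
      \<comment> \<open>To the right of 0 the difference quotient of the m-th function is the
        (m+1)-st function, which tends to 0; to the left it is 0.\<close>
      have "((\<lambda>h. (?f m h - ?f m 0) / (h - 0)) \<longlongrightarrow> 0) (at 0)"
      proof (subst filterlim_at_split, intro conjI)
        show "((\<lambda>h. (?f m h - ?f m 0) / (h - 0)) \<longlongrightarrow> 0) (at_left 0)"
          by (rule tendsto_eventually) (auto simp: eventually_at_left_field intro!: exI[of _ "-1"])
        show "((\<lambda>h. (?f m h - ?f m 0) / (h - 0)) \<longlongrightarrow> 0) (at_right 0)"
          using flat[of "Suc m"]
          by (rule Lim_transform_eventually)
            (auto simp: eventually_at_right_field intro!: exI[of _ 1])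
      qed
      then show ?thesis
        using 3 by (simp add: has_field_derivative_iff)
    qed
  qed
  {
    case 0
    show ?case using DERIV_isCont[OF deriv] by (simp add: continuous_at_imp_continuous_on)
  next
    case (Suc k)
    show ?case
    proof (rule Ck_on_SucI)
      show "(?f m has_derivative (\<lambda>v. (?f (m + 2) t + (- real m) * ?f (m + 1) t) * v)) (at t)" for t
        using deriv[of m t] unfolding has_field_derivative_def mult_minus_left add_uminus_conv_diff .
      show "Ck_on k (\<lambda>t. (?f (m + 2) t + (- real m) * ?f (m + 1) t) * v) UNIV" for v
        by (intro Ck_on_mult Ck_on_add Ck_on_const Suc.IH open_UNIV)
    qed simp
  }
qed

text \<open>The quotient u / (u + v), where u is positive exactly on the open ball of radius r and v
  exactly outside the closed ball of radius r/2. These two regions cover the space, so the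
  denominator has no zero.\<close>

lemma bump_function:
  fixes z0 :: "'e::euclidean_space"
  assumes r: "r > 0"
  obtains h :: "'e \<Rightarrow> real" where "Cinf UNIV h" "\<And>z. z \<in> ball z0 (r/2) \<Longrightarrow> h z = 1"
    "\<And>z. z \<notin> ball z0 r \<Longrightarrow> h z = 0"
proof -
  define f where "f t = (if t > 0 then exp (- (1/t)) else 0)" for t :: real
  have f: "Cinf UNIV f"
    using flat_fun_Ck_on[of _ 0] unfolding power_0 mult_1 f_def Cinf_def by simp
  define d where "d z = (z - z0) \<bullet> (z - z0)" for z :: 'e
  have d: "Cinf UNIV d"
  proof -
    have "Cinf UNIV (\<lambda>z::'e. z + (- z0))"
      by (intro Cinf_add Cinf_const Cinf_linear bounded_linear.linear[OF bounded_linear_ident]) auto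
    from Cinf_inner[OF this this] show ?thesis by (simp add: d_def[abs_def])
  qed
  have aff: "Cinf UNIV (\<lambda>z. a * d z + c)" for a c
    by (intro Cinf_add Cinf_mult Cinf_const d) auto
  define u where "u z = f ((-1) * d z + r\<^sup>2)" for z
  define v where "v z = f (1 * d z + (- (r/2)\<^sup>2))" for z
  have u: "Cinf UNIV u" and v: "Cinf UNIV v"
    unfolding u_def v_def by (rule Cinf_compose[OF aff f], simp)+
  have fnn: "f t \<ge> 0" and fpos: "f t > 0 \<longleftrightarrow> t > 0" for t by (auto simp: f_def)
  have "(r/2)\<^sup>2 < r\<^sup>2" using r by (simp add: power_divide)
  then have "d z < r\<^sup>2 \<or> d z > (r/2)\<^sup>2" for z by linarith
  then have "u z > 0 \<or> v z > 0" for z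
    by (auto simp: u_def v_def fpos)
  moreover have "u z \<ge> 0" "v z \<ge> 0" for z by (auto simp: u_def v_def fnn)
  ultimately have pos: "u z + v z > 0" for z
    by (metis add_nonneg_pos add_pos_nonneg)
  have "Cinf UNIV (\<lambda>z. u z * inverse (u z + v z))"
    using pos by (intro Cinf_mult u Cinf_inverse_real Cinf_add v) (auto simp: less_le)
  moreover have dd: "d z = (dist z0 z)\<^sup>2" for z
    by (simp add: d_def dist_norm power2_norm_eq_inner inner_diff_left inner_diff_right inner_commute)
  have "u z * inverse (u z + v z) = 1" if "z \<in> ball z0 (r/2)" for z
  proof -
    have "d z < (r/2)\<^sup>2" unfolding dd using that r by (intro power_strict_mono) auto
    then have "v z = 0" by (simp add: v_def f_def)
    then show ?thesis using pos[of z] by simp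
  qed
  moreover have "u z * inverse (u z + v z) = 0" if "z \<notin> ball z0 r" for z
  proof -
    have "d z \<ge> r\<^sup>2" unfolding dd using that r by (intro power_mono) auto
    then show ?thesis by (simp add: u_def f_def)
  qed
  ultimately show thesis using that by blast
qed

section \<open>Smooth functions on manifolds\<close>

lemma smooth_on_iff_Cinf:
  "smooth_on \<Omega> f \<longleftrightarrow> (\<forall>x\<in>\<Omega>. \<exists>N F. Cinf N F \<and> x \<in> N \<and> (\<forall>y\<in>N \<inter> \<Omega>. F y = f y))"
  unfolding smooth_on_def Cinf_def by metis

lemma smooth_on_subset: "smooth_on \<Omega> f \<Longrightarrow> \<Omega>' \<subseteq> \<Omega> \<Longrightarrow> smooth_on \<Omega>' f"
  unfolding smooth_on_iff_Cinf
proof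
  fix x assume a: "\<forall>x\<in>\<Omega>. \<exists>N F. Cinf N F \<and> x \<in> N \<and> (\<forall>y\<in>N \<inter> \<Omega>. F y = f y)" "\<Omega>' \<subseteq> \<Omega>" "x \<in> \<Omega>'"
  then obtain N F where "Cinf N F" "x \<in> N" "\<forall>y\<in>N \<inter> \<Omega>. F y = f y" by blast
  then show "\<exists>N F. Cinf N F \<and> x \<in> N \<and> (\<forall>y\<in>N \<inter> \<Omega>'. F y = f y)"
    using a(2) by (intro exI[of _ N] exI[of _ F]) auto
qed

lemma smooth_on_cong: "(\<And>x. x \<in> \<Omega> \<Longrightarrow> f x = g x) \<Longrightarrow> smooth_on \<Omega> f \<longleftrightarrow> smooth_on \<Omega> g"
  unfolding smooth_on_iff_Cinf by simp

lemma Cinf_imp_smooth_on: "Cinf N F \<Longrightarrow> smooth_on N F"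
  unfolding smooth_on_iff_Cinf by blast

lemma smooth_on_compose:
  fixes f :: "'d::euclidean_space \<Rightarrow> 'e::euclidean_space"
  assumes "smooth_on \<Omega> f" "smooth_on \<Omega>' h" "f ` \<Omega> \<subseteq> \<Omega>'"
  shows "smooth_on \<Omega> (\<lambda>x. h (f x))"
  unfolding smooth_on_iff_Cinf
proof
  fix x assume x: "x \<in> \<Omega>"
  obtain N F where F: "Cinf N F" "x \<in> N" "\<forall>y\<in>N \<inter> \<Omega>. F y = f y"
    using assms(1) x unfolding smooth_on_iff_Cinf by blast
  obtain N' H where H: "Cinf N' H" "f x \<in> N'" "\<forall>y\<in>N' \<inter> \<Omega>'. H y = h y"
    using assms(2,3) x unfolding smooth_on_iff_Cinf by blast
  have o: "open (N \<inter> F -` N')" using Cinf_open_vimage F(1) Cinf_open[OF H(1)] by blast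
  have "Cinf (N \<inter> F -` N') (\<lambda>x. H (F x))"
    by (rule Cinf_compose[OF Cinf_subset[OF F(1) o] H(1)]) auto
  moreover have "x \<in> N \<inter> F -` N'" using F H x by auto
  moreover have "\<forall>y\<in>(N \<inter> F -` N') \<inter> \<Omega>. H (F y) = h (f y)"
    using F(3) H(3) assms(3) by auto
  ultimately show "\<exists>N G. Cinf N G \<and> x \<in> N \<and> (\<forall>y\<in>N \<inter> \<Omega>. G y = h (f y))"
    by (intro exI[of _ "N \<inter> F -` N'"] exI[of _ "\<lambda>x. H (F x)"]) auto
qed

locale manifold =
  fixes M :: "('a, 'e::euclidean_space) mfd"
  assumes manifold: "smooth_manifold M"
begin

lemma chart_exists:
  assumes "p \<in> carrier M"
  obtains D \<phi> where "(D, \<phi>) \<in> atlas M" "p \<in> D"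
proof -
  have "(\<Union>(D, \<phi>)\<in>atlas M. D) = carrier M"
    using manifold unfolding smooth_manifold_def by (elim conjE)
  then show thesis using assms that by auto
qed

lemma subspace_model: "subspace (model M)"
  using manifold unfolding smooth_manifold_def by (elim conjE)

lemma Hausdorff: "Hausdorff_space (topo M)"
  using manifold unfolding smooth_manifold_def by (elim conjE)

context
  fixes D \<phi> assumes chart: "(D, \<phi>) \<in> atlas M"
begin

lemma chart_props: "openin (topo M) D" "openin (top_of_set (model M)) (\<phi> ` D)"
  "homeomorphic_map (subtopology (topo M) D) (top_of_set (\<phi> ` D)) \<phi>"
proof -
  have "\<forall>(D, \<phi>)\<in>atlas M. openin (topo M) D \<and> openin (top_of_set (model M)) (\<phi> ` D) \<and>
        homeomorphic_map (subtopology (topo M) D) (top_of_set (\<phi> ` D)) \<phi>"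
    using manifold unfolding smooth_manifold_def by (elim conjE)
  then show "openin (topo M) D" "openin (top_of_set (model M)) (\<phi> ` D)"
    "homeomorphic_map (subtopology (topo M) D) (top_of_set (\<phi> ` D)) \<phi>"
    using chart by auto
qed

lemma chart_transition: "(E, \<psi>) \<in> atlas M \<Longrightarrow> smooth_on (\<phi> ` (D \<inter> E)) (\<psi> \<circ> inv_into D \<phi>)"
proof -
  have "\<forall>(D, \<phi>)\<in>atlas M. \<forall>(E, \<psi>)\<in>atlas M. smooth_on (\<phi> ` (D \<inter> E)) (\<psi> \<circ> inv_into D \<phi>)"
    using manifold unfolding smooth_manifold_def by (elim conjE)
  then show "(E, \<psi>) \<in> atlas M \<Longrightarrow> smooth_on (\<phi> ` (D \<inter> E)) (\<psi> \<circ> inv_into D \<phi>)" using chart by auto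
qed

lemma chart_subset: "D \<subseteq> carrier M"
  using chart_props(1) openin_subset by blast

lemma chart_topspace: "topspace (subtopology (topo M) D) = D"
  using chart_subset by (simp add: topspace_subtopology Int_absorb1)

lemma chart_inj: "inj_on \<phi> D"
  using homeomorphic_imp_injective_map[OF chart_props(3)] chart_topspace by simp

lemma chart_inv: "q \<in> D \<Longrightarrow> inv_into D \<phi> (\<phi> q) = q"
  using chart_inj by simp

lemma chart_model: "q \<in> D \<Longrightarrow> \<phi> q \<in> model M"
  using chart_props(2) openin_imp_subset by blast

lemma chart_preimage_open:
  assumes "open N" shows "openin (topo M) {q \<in> D. \<phi> q \<in> N}"
proof -
  have c: "continuous_map (subtopology (topo M) D) (top_of_set (\<phi> ` D)) \<phi>"
    using chart_props(3) homeomorphic_imp_continuous_map by blast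
  have "openin (top_of_set (\<phi> ` D)) (\<phi> ` D \<inter> N)" using assms by blast
  from openin_continuous_map_preimage[OF c this]
  have "openin (subtopology (topo M) D) {q \<in> D. \<phi> q \<in> \<phi> ` D \<inter> N}"
    unfolding chart_topspace .
  then have "openin (topo M) {q \<in> D. \<phi> q \<in> \<phi> ` D \<inter> N}"
    using openin_trans_full chart_props(1) by blast
  moreover have "{q \<in> D. \<phi> q \<in> \<phi> ` D \<inter> N} = {q \<in> D. \<phi> q \<in> N}" by auto
  ultimately show ?thesis by simp
qed

lemma chart_image_open:
  assumes "openin (topo M) U"
  obtains N where "open N" "\<And>q. q \<in> D \<Longrightarrow> \<phi> q \<in> N \<Longrightarrow> q \<in> U" "\<phi> ` (U \<inter> D) = model M \<inter> N"
proof -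
  have "openin (subtopology (topo M) D) (D \<inter> U)"
    using assms openin_subtopology_Int2 by blast
  then have "openin (top_of_set (\<phi> ` D)) (\<phi> ` (D \<inter> U))"
    using homeomorphic_imp_open_map[OF chart_props(3)] open_map_def by blast
  then have "openin (top_of_set (model M)) (\<phi> ` (D \<inter> U))"
    using chart_props(2) openin_trans by blast
  then obtain N where N: "open N" "\<phi> ` (D \<inter> U) = model M \<inter> N"
    using openin_open by metis
  have "q \<in> U" if "q \<in> D" "\<phi> q \<in> N" for q
  proof -
    have "\<phi> q \<in> \<phi> ` (D \<inter> U)" using N(2) that chart_model by blast
    then show ?thesis using that chart_inj by (metis Int_iff image_iff inj_onD)
  qed
  then show thesis using that N by (simp add: Int_commute)
qed

end

text \<open>A single chart decides smoothness, since the transition maps are smooth. The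
  representative F lives on an open set of the whole Euclidean type and agrees with f on the trace
  of the chart image, where derivatives in model directions are determined.\<close>

lemma smooth_near_chart:
  assumes chart: "(D, \<phi>) \<in> atlas M" and p: "p \<in> D"
  shows "smooth_near M p f \<longleftrightarrow>
    (\<exists>N F. Cinf N F \<and> \<phi> p \<in> N \<and> (\<forall>q\<in>D. \<phi> q \<in> N \<longrightarrow> f q = F (\<phi> q)))" (is "_ \<longleftrightarrow> ?R")
proof
  assume "smooth_near M p f"
  then obtain U where U: "openin (topo M) U" "p \<in> U" "smooth_fun M U f"
    unfolding smooth_near_def by blast
  then have "smooth_on (\<phi> ` (U \<inter> D)) (f \<circ> inv_into D \<phi>)"
    unfolding smooth_fun_def using chart by auto
  then obtain N F where F: "Cinf N F" "\<phi> p \<in> N" "\<forall>y\<in>N \<inter> \<phi> ` (U \<inter> D). F y = (f \<circ> inv_into D \<phi>) y"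
    unfolding smooth_on_iff_Cinf using U p by blast
  obtain N' where N': "open N'" "\<And>q. q \<in> D \<Longrightarrow> \<phi> q \<in> N' \<Longrightarrow> q \<in> U" "\<phi> ` (U \<inter> D) = model M \<inter> N'"
    using chart_image_open[OF chart U(1)] by blast
  have "Cinf (N \<inter> N') F" using F(1) N'(1) Cinf_open by (intro Cinf_subset[OF F(1)]) auto
  moreover have "\<phi> p \<in> N \<inter> N'" using F(2) N'(3) U p by blast
  moreover have "f q = F (\<phi> q)" if "q \<in> D" "\<phi> q \<in> N \<inter> N'" for q
    using that N'(2) F(3) chart_inv[OF chart] by simp
  ultimately show ?R by blast
next
  assume ?R
  then obtain N F where F: "Cinf N F" "\<phi> p \<in> N" "\<And>q. q \<in> D \<Longrightarrow> \<phi> q \<in> N \<Longrightarrow> f q = F (\<phi> q)"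
    by blast
  let ?U = "{q \<in> D. \<phi> q \<in> N}"
  have "smooth_on (\<psi> ` (?U \<inter> E)) (f \<circ> inv_into E \<psi>)" if E: "(E, \<psi>) \<in> atlas M" for E \<psi>
  proof -
    have "smooth_on (\<psi> ` (E \<inter> D)) (\<phi> \<circ> inv_into E \<psi>)"
      using chart_transition[OF E chart] .
    then have s: "smooth_on (\<psi> ` (?U \<inter> E)) (\<phi> \<circ> inv_into E \<psi>)"
      by (rule smooth_on_subset) auto
    have inj: "inj_on \<psi> E" using chart_inj[OF E] .
    have "smooth_on (\<psi> ` (?U \<inter> E)) (\<lambda>x. F ((\<phi> \<circ> inv_into E \<psi>) x))"
      by (rule smooth_on_compose[OF s Cinf_imp_smooth_on[OF F(1)]]) (use inj in auto)
    then show ?thesis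
      by (rule smooth_on_cong[THEN iffD1, rotated]) (use inj F(3) in auto)
  qed
  then have "smooth_fun M ?U f" unfolding smooth_fun_def by auto
  then show "smooth_near M p f"
    unfolding smooth_near_def using chart_preimage_open[OF chart Cinf_open[OF F(1)]] p F(2) by blast
qed

lemma smooth_fun_iff_near:
  assumes U: "openin (topo M) U"
  shows "smooth_fun M U f \<longleftrightarrow> (\<forall>p\<in>U. smooth_near M p f)"
proof
  assume "smooth_fun M U f"
  then show "\<forall>p\<in>U. smooth_near M p f" using U unfolding smooth_near_def by blast
next
  assume sn: "\<forall>p\<in>U. smooth_near M p f"
  have "smooth_on (\<phi> ` (U \<inter> D)) (f \<circ> inv_into D \<phi>)" if c: "(D, \<phi>) \<in> atlas M" for D \<phi>
    unfolding smooth_on_iff_Cinf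
  proof
    fix x assume "x \<in> \<phi> ` (U \<inter> D)"
    then obtain p where p: "p \<in> U" "p \<in> D" "x = \<phi> p" by auto
    then obtain N F where "Cinf N F" "\<phi> p \<in> N" "\<forall>q\<in>D. \<phi> q \<in> N \<longrightarrow> f q = F (\<phi> q)"
      using sn smooth_near_chart[OF c p(2)] by blast
    then show "\<exists>N F. Cinf N F \<and> x \<in> N \<and> (\<forall>y\<in>N \<inter> \<phi> ` (U \<inter> D). F y = (f \<circ> inv_into D \<phi>) y)"
      using p chart_inv[OF c] by (intro exI[of _ N] exI[of _ F]) auto
  qed
  then show "smooth_fun M U f" unfolding smooth_fun_def by auto
qed

section \<open>Germs of smooth functions\<close>

lemma ev_nhdsin:
  "p \<in> carrier M \<Longrightarrow> eventually P (nhdsin (topo M) p) \<longleftrightarrow>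
    (\<exists>U. openin (topo M) U \<and> p \<in> U \<and> (\<forall>q\<in>U. P q))"
  by (simp add: eventually_nhdsin)

lemma ev_nhdsinI: "openin (topo M) U \<Longrightarrow> p \<in> U \<Longrightarrow> (\<And>q. q \<in> U \<Longrightarrow> P q) \<Longrightarrow> eventually P (nhdsin (topo M) p)"
  by (metis eventually_nhdsin)

lemma ev_here: "p \<in> carrier M \<Longrightarrow> eventually P (nhdsin (topo M) p) \<Longrightarrow> P p"
  by (metis ev_nhdsin)

lemma ev_ev:
  "p \<in> carrier M \<Longrightarrow> eventually P (nhdsin (topo M) p) \<Longrightarrow>
    \<forall>\<^sub>F q in nhdsin (topo M) p. eventually P (nhdsin (topo M) q)"
  by (metis ev_nhdsin ev_nhdsinI)

lemma ev_carrier: "p \<in> carrier M \<Longrightarrow> \<forall>\<^sub>F q in nhdsin (topo M) p. q \<in> carrier M"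
  using ev_nhdsinI[of "carrier M"] by simp

lemma smooth_near_carrier: "smooth_near M p f \<Longrightarrow> p \<in> carrier M"
  unfolding smooth_near_def using openin_subset by blast

lemma smooth_near_ev:
  assumes "smooth_near M p f" shows "\<forall>\<^sub>F q in nhdsin (topo M) p. smooth_near M q f"
proof -
  obtain U where U: "openin (topo M) U" "p \<in> U" "smooth_fun M U f"
    using assms unfolding smooth_near_def by blast
  then show ?thesis by (intro ev_nhdsinI[of U]) (auto simp: smooth_near_def)
qed

lemma smooth_near_cong:
  assumes "smooth_near M p f" "\<forall>\<^sub>F q in nhdsin (topo M) p. f q = h q"
  shows "smooth_near M p h"
proof -
  have p: "p \<in> carrier M" using assms(1) by (rule smooth_near_carrier)
  then obtain D \<phi> where c: "(D, \<phi>) \<in> atlas M" "p \<in> D" by (rule chart_exists)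
  obtain N F where F: "Cinf N F" "\<phi> p \<in> N" "\<forall>q\<in>D. \<phi> q \<in> N \<longrightarrow> f q = F (\<phi> q)"
    using assms(1) smooth_near_chart[OF c] by blast
  obtain U where U: "openin (topo M) U" "p \<in> U" "\<forall>q\<in>U. f q = h q"
    using assms(2) p ev_nhdsin by blast
  obtain N' where N': "open N'" "\<And>q. q \<in> D \<Longrightarrow> \<phi> q \<in> N' \<Longrightarrow> q \<in> U" "\<phi> ` (U \<inter> D) = model M \<inter> N'"
    using chart_image_open[OF c(1) U(1)] by blast
  have "Cinf (N \<inter> N') F" using F(1) N'(1) Cinf_open by (intro Cinf_subset[OF F(1)]) auto
  moreover have "\<phi> p \<in> N \<inter> N'" using F(2) N'(3) U c(2) by blast
  moreover have "h q = F (\<phi> q)" if "q \<in> D" "\<phi> q \<in> N \<inter> N'" for q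
    using that N'(2) F(3) U(3) by fastforce
  ultimately show ?thesis using smooth_near_chart[OF c] by blast
qed

lemma smooth_near_cong_iff:
  assumes "\<forall>\<^sub>F q in nhdsin (topo M) p. f q = h q"
  shows "smooth_near M p f \<longleftrightarrow> smooth_near M p h"
  using smooth_near_cong[OF _ assms] smooth_near_cong[of p h f] assms
  by (auto simp: eq_commute)

lemma smooth_near_chart_pair:
  assumes c: "(D, \<phi>) \<in> atlas M" "q \<in> D" and f: "smooth_near M q f" and h: "smooth_near M q h"
  obtains N F H where "Cinf N F" "Cinf N H" "\<phi> q \<in> N"
    "\<And>r. r \<in> D \<Longrightarrow> \<phi> r \<in> N \<Longrightarrow> f r = F (\<phi> r)" "\<And>r. r \<in> D \<Longrightarrow> \<phi> r \<in> N \<Longrightarrow> h r = H (\<phi> r)"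
proof -
  obtain N F where F: "Cinf N F" "\<phi> q \<in> N" "\<forall>r\<in>D. \<phi> r \<in> N \<longrightarrow> f r = F (\<phi> r)"
    using f smooth_near_chart[OF c] by blast
  obtain N' H where H: "Cinf N' H" "\<phi> q \<in> N'" "\<forall>r\<in>D. \<phi> r \<in> N' \<longrightarrow> h r = H (\<phi> r)"
    using h smooth_near_chart[OF c] by blast
  have o: "open (N \<inter> N')" using F(1) H(1) Cinf_open by blast
  show thesis
    by (rule that[OF Cinf_subset[OF F(1) o] Cinf_subset[OF H(1) o]]) (use F H in auto)
qed

lemma smooth_near_combine:
  assumes f: "smooth_near M p f" and h: "smooth_near M p h"
    and op: "\<And>N F H. Cinf N F \<Longrightarrow> Cinf N H \<Longrightarrow> Cinf N (\<lambda>z::'e. op2 (F z) (H z))"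
  shows "smooth_near M p (\<lambda>q. op2 (f q) (h q))"
proof -
  obtain D \<phi> where c: "(D, \<phi>) \<in> atlas M" "p \<in> D" using chart_exists[OF smooth_near_carrier[OF f]] .
  obtain N F H where "Cinf N F" "Cinf N H" "\<phi> p \<in> N"
    "\<And>r. r \<in> D \<Longrightarrow> \<phi> r \<in> N \<Longrightarrow> f r = F (\<phi> r)" "\<And>r. r \<in> D \<Longrightarrow> \<phi> r \<in> N \<Longrightarrow> h r = H (\<phi> r)"
    by (rule smooth_near_chart_pair[OF c f h]) blast
  then show ?thesis unfolding smooth_near_chart[OF c]
    by (intro exI[of _ N] exI[of _ "\<lambda>z. op2 (F z) (H z)"]) (simp add: op)
qed

lemma smooth_near_const: "p \<in> carrier M \<Longrightarrow> smooth_near M p (\<lambda>q. c)"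
  by (metis Cinf_const UNIV_I chart_exists open_UNIV smooth_near_chart)

lemma smooth_near_add: "smooth_near M p f \<Longrightarrow> smooth_near M p h \<Longrightarrow> smooth_near M p (\<lambda>q. f q + h q)"
  by (rule smooth_near_combine) (auto intro: Cinf_add)

lemma smooth_near_mult: "smooth_near M p f \<Longrightarrow> smooth_near M p h \<Longrightarrow> smooth_near M p (\<lambda>q. f q * h q)"
  by (rule smooth_near_combine) (auto intro: Cinf_mult)

lemma smooth_near_lincomb:
  "smooth_near M p f \<Longrightarrow> smooth_near M p h \<Longrightarrow> smooth_near M p (\<lambda>q. c * f q + d * h q)"
  by (intro smooth_near_add smooth_near_mult smooth_near_const) (auto dest: smooth_near_carrier)

lemma smooth_near_diff: "smooth_near M p f \<Longrightarrow> smooth_near M p h \<Longrightarrow> smooth_near M p (\<lambda>q. f q - h q)"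
  using smooth_near_lincomb[of p f h 1 "-1"] by simp

lemma smooth_near_sum:
  "p \<in> carrier M \<Longrightarrow> (\<And>i. i \<in> I \<Longrightarrow> smooth_near M p (f i)) \<Longrightarrow> smooth_near M p (\<lambda>q. \<Sum>i\<in>I. f i q)"
  by (induction I rule: infinite_finite_induct) (auto intro: smooth_near_add smooth_near_const)

section \<open>Tangent vectors\<close>

lemma tangent_lincomb:
  "v \<in> tangent M p \<Longrightarrow> smooth_near M p f \<Longrightarrow> smooth_near M p h \<Longrightarrow>
    v (\<lambda>q. c * f q + d * h q) = c * v f + d * v h"
  unfolding tangent_def by blast

lemma tangent_mult:
  "v \<in> tangent M p \<Longrightarrow> smooth_near M p f \<Longrightarrow> smooth_near M p h \<Longrightarrow>
    v (\<lambda>q. f q * h q) = f p * v h + h p * v f"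
  unfolding tangent_def by blast

lemma tangent_nonsmooth: "v \<in> tangent M p \<Longrightarrow> \<not> smooth_near M p f \<Longrightarrow> v f = 0"
  unfolding tangent_def by blast

lemma tangent_add:
  "v \<in> tangent M p \<Longrightarrow> smooth_near M p f \<Longrightarrow> smooth_near M p h \<Longrightarrow> v (\<lambda>q. f q + h q) = v f + v h"
  using tangent_lincomb[of v p f h 1 1] by simp

lemma tangent_diff:
  "v \<in> tangent M p \<Longrightarrow> smooth_near M p f \<Longrightarrow> smooth_near M p h \<Longrightarrow> v (\<lambda>q. f q - h q) = v f - v h"
  using tangent_lincomb[of v p f h 1 "-1"] by simp

lemma tangent_minus: "v \<in> tangent M p \<Longrightarrow> smooth_near M p f \<Longrightarrow> v (\<lambda>q. - f q) = - v f"
  using tangent_lincomb[of v p f f "-1" 0] by simp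

lemma tangent_const: "p \<in> carrier M \<Longrightarrow> v \<in> tangent M p \<Longrightarrow> v (\<lambda>q. c) = 0"
  using tangent_mult[of v p "\<lambda>q. 1" "\<lambda>q. 1"] tangent_lincomb[of v p "\<lambda>q. 1" "\<lambda>q. 1" c 0]
    smooth_near_const[of p 1] by simp

lemma tangent_sum:
  assumes "p \<in> carrier M" "v \<in> tangent M p"
  shows "(\<And>i. i \<in> I \<Longrightarrow> smooth_near M p (f i)) \<Longrightarrow> v (\<lambda>q. \<Sum>i\<in>I. f i q) = (\<Sum>i\<in>I. v (f i))"
proof (induction I rule: infinite_finite_induct)
  case (insert i I)
  then show ?case
    using tangent_add[OF assms(2), of "f i" "\<lambda>q. \<Sum>i\<in>I. f i q"] smooth_near_sum[OF assms(1), of I f]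
    by simp
qed (use tangent_const[OF assms] in simp_all)

text \<open>The Leibniz rule is applied with the indicator function of a neighbourhood.\<close>

lemma tangent_cong:
  assumes p: "p \<in> carrier M" and v: "v \<in> tangent M p" and eq: "\<forall>\<^sub>F q in nhdsin (topo M) p. f q = h q"
  shows "v f = v h"
proof (cases "smooth_near M p f")
  case False
  then show ?thesis using smooth_near_cong_iff[OF eq] v tangent_nonsmooth by metis
next
  case True
  then have h: "smooth_near M p h" using smooth_near_cong_iff[OF eq] by blast
  obtain U where U: "openin (topo M) U" "p \<in> U" "\<forall>q\<in>U. f q = h q"
    using eq p ev_nhdsin by blast
  define u :: "'a \<Rightarrow> real" where "u q = of_bool (q \<in> U)" for q
  have u: "smooth_near M p u"
    by (rule smooth_near_cong[OF smooth_near_const[OF p, of 1]], rule ev_nhdsinI[OF U(1,2)])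
      (simp add: u_def)
  have "(\<lambda>q. u q * (f q - h q)) = (\<lambda>q. 0)"
    using U(3) by (auto simp: u_def)
  then have "v (\<lambda>q. u q * (f q - h q)) = 0"
    using tangent_const[OF p v, of 0] by simp
  then have "v (\<lambda>q. f q - h q) = 0"
    using tangent_mult[OF v u smooth_near_diff[OF True h]] U by (simp add: u_def)
  then show ?thesis using tangent_diff[OF v True h] by simp
qed

lemma tangent_comb:
  assumes "v \<in> tangent M p" "w \<in> tangent M p"
  shows "(\<lambda>f. c * v f + d * w f) \<in> tangent M p"
proof -
  have "c * v (\<lambda>q. a * f q + b * h q) + d * w (\<lambda>q. a * f q + b * h q) =
      a * (c * v f + d * w f) + b * (c * v h + d * w h) \<and>
     c * v (\<lambda>q. f q * h q) + d * w (\<lambda>q. f q * h q) =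
      f p * (c * v h + d * w h) + h p * (c * v f + d * w f)"
    if "smooth_near M p f" "smooth_near M p h" for f h a b
    using tangent_lincomb[OF assms(1) that] tangent_lincomb[OF assms(2) that]
      tangent_mult[OF assms(1) that] tangent_mult[OF assms(2) that] by (simp add: algebra_simps)
  then show ?thesis
    using tangent_nonsmooth[OF assms(1)] tangent_nonsmooth[OF assms(2)] unfolding tangent_def by simp
qed

lemma tangent_zero: "p \<in> carrier M \<Longrightarrow> (\<lambda>f. 0) \<in> tangent M p"
  unfolding tangent_def by simp

lemma tangent_sum_comb:
  "p \<in> carrier M \<Longrightarrow> (\<And>i. i \<in> I \<Longrightarrow> v i \<in> tangent M p) \<Longrightarrow> (\<lambda>f. \<Sum>i\<in>I. c i * v i f) \<in> tangent M p"
proof (induction I rule: infinite_finite_induct)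
  case (insert i I)
  then show ?case using tangent_comb[of "v i" p "\<lambda>f. \<Sum>i\<in>I. c i * v i f" "c i" 1] by simp
qed (simp_all add: tangent_zero)

lemma cotangent_lincomb:
  "a \<in> cotangent M p \<Longrightarrow> v \<in> tangent M p \<Longrightarrow> w \<in> tangent M p \<Longrightarrow>
    a (\<lambda>f. c * v f + d * w f) = c * a v + d * a w"
  unfolding cotangent_def dual_def linear_over_def by blast

lemma cotangent_off: "a \<in> cotangent M p \<Longrightarrow> v \<notin> tangent M p \<Longrightarrow> a v = 0"
  unfolding cotangent_def dual_def by blast

lemma cotangent_zero_arg: "p \<in> carrier M \<Longrightarrow> a \<in> cotangent M p \<Longrightarrow> a (\<lambda>f. 0) = 0"
  using cotangent_lincomb[of a p "\<lambda>f. 0" "\<lambda>f. 0" 0 0] by (simp add: tangent_zero)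

lemma cotangent_sum:
  assumes "p \<in> carrier M" "a \<in> cotangent M p"
  shows "(\<And>i. i \<in> I \<Longrightarrow> v i \<in> tangent M p) \<Longrightarrow> a (\<lambda>f. \<Sum>i\<in>I. c i * v i f) = (\<Sum>i\<in>I. c i * a (v i))"
proof (induction I rule: infinite_finite_induct)
  case (insert i I)
  then show ?case
    using cotangent_lincomb[OF assms(2), of "v i" "\<lambda>f. \<Sum>i\<in>I. c i * v i f" "c i" 1] tangent_sum_comb[OF assms(1), of I v c]
    by simp
qed (simp_all add: cotangent_zero_arg[OF assms])

lemma cotangent_comb:
  "a \<in> cotangent M p \<Longrightarrow> b \<in> cotangent M p \<Longrightarrow> (\<lambda>v. c * a v + d * b v) \<in> cotangent M p"
  unfolding cotangent_def dual_def linear_over_def by (auto simp: algebra_simps)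

lemma cotangent_zero: "(\<lambda>v. 0) \<in> cotangent M p"
  unfolding cotangent_def dual_def linear_over_def by auto

lemma cotangent_sum_comb:
  "(\<And>i. i \<in> I \<Longrightarrow> a i \<in> cotangent M p) \<Longrightarrow> (\<lambda>v. \<Sum>i\<in>I. c i * a i v) \<in> cotangent M p"
proof (induction I rule: infinite_finite_induct)
  case (insert i I)
  then show ?case using cotangent_comb[of "a i" p "\<lambda>v. \<Sum>i\<in>I. c i * a i v" "c i" 1] by simp
qed (simp_all add: cotangent_zero)

lemma differential_cotangent: "differential M f p \<in> cotangent M p"
  unfolding cotangent_def dual_def linear_over_def differential_def by (auto intro: tangent_comb)

lemma differential_apply: "v \<in> tangent M p \<Longrightarrow> differential M f p v = v f"
  by (simp add: differential_def)


section \<open>Coordinate frames\<close>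

definition model_basis :: "'e set" where
  "model_basis = (SOME B. B \<subseteq> model M \<and> finite B \<and> (\<forall>b\<in>B. \<forall>c\<in>B. b \<bullet> c = of_bool (b = c)) \<and>
     span B = model M)"

lemma model_basis: "model_basis \<subseteq> model M" "finite model_basis"
    "\<And>b c. b \<in> model_basis \<Longrightarrow> c \<in> model_basis \<Longrightarrow> b \<bullet> c = of_bool (b = c)" "span model_basis = model M"
proof -
  obtain B where B: "B \<subseteq> model M" "pairwise orthogonal B" "\<And>x. x \<in> B \<Longrightarrow> norm x = 1"
      "independent B" "span B = model M"
    using orthonormal_basis_subspace[OF subspace_model] by metis
  have "b \<bullet> c = of_bool (b = c)" if "b \<in> B" "c \<in> B" for b c
    using B(2,3) that by (auto simp: pairwise_def orthogonal_def norm_eq_1)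
  then have "\<exists>B. B \<subseteq> model M \<and> finite B \<and> (\<forall>b\<in>B. \<forall>c\<in>B. b \<bullet> c = of_bool (b = c)) \<and> span B = model M"
    using B(1,5) independent_imp_finite[OF B(4)] by (intro exI[of _ B]) simp
  from someI_ex[OF this, folded model_basis_def]
  show "model_basis \<subseteq> model M" "finite model_basis"
    "\<And>b c. b \<in> model_basis \<Longrightarrow> c \<in> model_basis \<Longrightarrow> b \<bullet> c = of_bool (b = c)" "span model_basis = model M"
    by blast+
qed

definition model_proj :: "'e \<Rightarrow> 'e" where
  "model_proj z = (\<Sum>b\<in>model_basis. (z \<bullet> b) *\<^sub>R b)"

lemma linear_model_proj: "linear model_proj"
  unfolding model_proj_def
  by (rule linearI) (simp_all add: inner_add_left scaleR_add_left sum.distrib scaleR_sum_right)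

lemma model_proj_in: "model_proj z \<in> model M"
  unfolding model_proj_def using model_basis(1)
  by (intro subspace_sum[OF subspace_model] subspace_scale[OF subspace_model]) auto

lemma model_proj_id:
  assumes "z \<in> model M" shows "model_proj z = z"
proof -
  have "z \<in> span model_basis" using assms model_basis(4) by simp
  then show ?thesis
  proof (induction rule: span_induct_alt)
    case base
    then show ?case by (simp add: linear_0[OF linear_model_proj])
  next
    case (step c x y)
    have "model_proj x = (\<Sum>b\<in>model_basis. if b = x then b else 0)"
      unfolding model_proj_def using model_basis(3)[OF step(1)]
      by (intro sum.cong) (auto simp: of_bool_def)
    also have "\<dots> = x" using step(1) model_basis(2) by simp
    finally show ?case
      using step by (simp add: linear_add[OF linear_model_proj] linear_cmul[OF linear_model_proj])
  qed
qed

text \<open>The image of a chart is open only in the model subspace. Precomposing with the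
  projection gives a function on an open set of the ambient space, where a Frechet derivative is
  meaningful.\<close>

definition coord_deriv :: "'a set \<Rightarrow> ('a \<Rightarrow> 'e) \<Rightarrow> 'e \<Rightarrow> 'a \<Rightarrow> 'a tvec" where
  "coord_deriv D \<phi> b q = (\<lambda>f. if smooth_near M q f
     then frechet_derivative (\<lambda>z. f (inv_into D \<phi> (model_proj z))) (at (\<phi> q)) b else 0)"

text \<open>Every smooth representative F of f computes the same value: the chain rule gives the
  derivative of F applied to \<open>model_proj v\<close>, and the projection fixes the basis
  vectors.\<close>

lemma coord_deriv_eq:
  assumes c: "(D, \<phi>) \<in> atlas M" and q: "q \<in> D" and b: "b \<in> model_basis"
    and F: "Cinf N F" "\<phi> q \<in> N" "\<And>r. r \<in> D \<Longrightarrow> \<phi> r \<in> N \<Longrightarrow> f r = F (\<phi> r)"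
  shows "coord_deriv D \<phi> b q f = frechet_derivative F (at (\<phi> q)) b"
proof -
  have sn: "smooth_near M q f"
    using smooth_near_chart[OF c q] F by blast
  obtain N' where N': "open N'" "\<phi> ` (D \<inter> D) = model M \<inter> N'"
    using chart_image_open[OF c chart_props(1)[OF c]] by metis
  let ?V = "model_proj -` (N \<inter> N')"
  have Vo: "open ?V"
    using linear_continuous_on[of model_proj UNIV] linear_model_proj N' Cinf_open[OF F(1)]
    by (intro open_vimage) (auto simp: linear_conv_bounded_linear)
  have Pq: "model_proj (\<phi> q) = \<phi> q" using model_proj_id chart_model[OF c q] by simp
  have qV: "\<phi> q \<in> ?V" using Pq F(2) N'(2) q by auto
  have "(F has_derivative frechet_derivative F (at (\<phi> q))) (at (model_proj (\<phi> q)))"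
    using Cinf_has_derivative[OF F(1,2)] Pq by simp
  moreover have "(model_proj has_derivative model_proj) (at (\<phi> q))"
    using linear_model_proj by (simp add: bounded_linear_imp_has_derivative linear_conv_bounded_linear)
  ultimately have "((\<lambda>z. F (model_proj z)) has_derivative (\<lambda>v. frechet_derivative F (at (\<phi> q)) (model_proj v))) (at (\<phi> q))"
    using has_derivative_compose[of model_proj model_proj "\<phi> q" UNIV F] by simp
  then have "((\<lambda>z. f (inv_into D \<phi> (model_proj z))) has_derivative
      (\<lambda>v. frechet_derivative F (at (\<phi> q)) (model_proj v))) (at (\<phi> q))"
  proof (rule has_derivative_transform_within_open[OF _ Vo qV])
    fix z assume z: "z \<in> ?V"
    then obtain r where "r \<in> D" "model_proj z = \<phi> r"
      using N'(2) model_proj_in by blast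
    then show "F (model_proj z) = f (inv_into D \<phi> (model_proj z))"
      using F(3)[of r] z chart_inv[OF c] by simp
  qed
  then have "frechet_derivative (\<lambda>z. f (inv_into D \<phi> (model_proj z))) (at (\<phi> q)) =
      (\<lambda>v. frechet_derivative F (at (\<phi> q)) (model_proj v))"
    by (metis frechet_derivative_at)
  then show ?thesis
    using sn model_proj_id b model_basis(1) by (auto simp: coord_deriv_def)
qed

lemma coord_deriv_tangent:
  assumes c: "(D, \<phi>) \<in> atlas M" "q \<in> D" and b: "b \<in> model_basis"
  shows "coord_deriv D \<phi> b q \<in> tangent M q"
proof -
  have "coord_deriv D \<phi> b q (\<lambda>q. k * f q + l * h q) = k * coord_deriv D \<phi> b q f + l * coord_deriv D \<phi> b q h \<and>
      coord_deriv D \<phi> b q (\<lambda>q. f q * h q) = f q * coord_deriv D \<phi> b q h + h q * coord_deriv D \<phi> b q f"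
    if f: "smooth_near M q f" and h: "smooth_near M q h" for f h k l
  proof -
    obtain N F H where F: "Cinf N F" "\<And>r. r \<in> D \<Longrightarrow> \<phi> r \<in> N \<Longrightarrow> f r = F (\<phi> r)"
      and H: "Cinf N H" "\<And>r. r \<in> D \<Longrightarrow> \<phi> r \<in> N \<Longrightarrow> h r = H (\<phi> r)" and N: "\<phi> q \<in> N"
      by (rule smooth_near_chart_pair[OF c f h]) blast
    note o = Cinf_open[OF F(1)]
    have dF: "(F has_derivative frechet_derivative F (at (\<phi> q))) (at (\<phi> q))"
      and dH: "(H has_derivative frechet_derivative H (at (\<phi> q))) (at (\<phi> q))"
      using Cinf_has_derivative F(1) H(1) N by blast+
    have "coord_deriv D \<phi> b q (\<lambda>q. k * f q + l * h q) =
        frechet_derivative (\<lambda>z. k * F z + l * H z) (at (\<phi> q)) b"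
      using F(2) H(2) by (intro coord_deriv_eq[OF c b _ N] Cinf_add Cinf_mult Cinf_const F H o) auto
    moreover have "((\<lambda>z. k * F z + l * H z) has_derivative
        (\<lambda>v. k * frechet_derivative F (at (\<phi> q)) v + l * frechet_derivative H (at (\<phi> q)) v)) (at (\<phi> q))"
      by (intro has_derivative_add has_derivative_mult_right dF dH)
    moreover have "coord_deriv D \<phi> b q (\<lambda>q. f q * h q) = frechet_derivative (\<lambda>z. F z * H z) (at (\<phi> q)) b"
      using F(2) H(2) by (intro coord_deriv_eq[OF c b _ N] Cinf_mult F H o) auto
    moreover have "((\<lambda>z. F z * H z) has_derivative
        (\<lambda>v. F (\<phi> q) * frechet_derivative H (at (\<phi> q)) v + frechet_derivative F (at (\<phi> q)) v * H (\<phi> q))) (at (\<phi> q))"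
      by (intro has_derivative_mult dF dH)
    ultimately show ?thesis
      using coord_deriv_eq[OF c b F(1) N F(2)] coord_deriv_eq[OF c b H(1) N H(2)] F(2)[OF c(2) N] H(2)[OF c(2) N]
      by (simp add: frechet_derivative_at[symmetric] mult.commute)
  qed
  then show ?thesis unfolding tangent_def by (auto simp: coord_deriv_def)
qed

lemma coord_deriv_smooth:
  assumes c: "(D, \<phi>) \<in> atlas M" "q \<in> D" and b: "b \<in> model_basis" and f: "smooth_near M q f"
  shows "smooth_near M q (\<lambda>r. coord_deriv D \<phi> b r f)"
proof -
  obtain N F where F: "Cinf N F" "\<phi> q \<in> N" "\<forall>r\<in>D. \<phi> r \<in> N \<longrightarrow> f r = F (\<phi> r)"
    using f smooth_near_chart[OF c] by blast
  have "coord_deriv D \<phi> b r f = frechet_derivative F (at (\<phi> r)) b" if "r \<in> D" "\<phi> r \<in> N" for r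
    using coord_deriv_eq[OF c(1) that(1) b F(1) that(2)] F(3) by blast
  then show ?thesis unfolding smooth_near_chart[OF c]
    using Cinf_frechet_derivative[OF F(1), of b] F(2)
    by (intro exI[of _ N] exI[of _ "\<lambda>z. frechet_derivative F (at z) b"]) blast
qed

lemma smooth_near_coord:
  assumes c: "(D, \<phi>) \<in> atlas M" "q \<in> D"
  shows "smooth_near M q (\<lambda>r. \<phi> r \<bullet> b)"
proof -
  have "Cinf UNIV (\<lambda>z::'e. z \<bullet> b)" by (rule Cinf_linear) (auto intro!: linearI simp: inner_add_left)
  then show ?thesis unfolding smooth_near_chart[OF c]
    by (intro exI[of _ UNIV] exI[of _ "\<lambda>z. z \<bullet> b"]) auto
qed

lemma coord_deriv_coord:
  assumes c: "(D, \<phi>) \<in> atlas M" "q \<in> D" and b: "b \<in> model_basis" "b' \<in> model_basis"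
  shows "coord_deriv D \<phi> b q (\<lambda>r. \<phi> r \<bullet> b') = of_bool (b = b')"
proof -
  have "Cinf UNIV (\<lambda>z::'e. z \<bullet> b')" by (rule Cinf_linear) (auto intro!: linearI simp: inner_add_left)
  then have "coord_deriv D \<phi> b q (\<lambda>r. \<phi> r \<bullet> b') = frechet_derivative (\<lambda>z. z \<bullet> b') (at (\<phi> q)) b"
    by (rule coord_deriv_eq[OF c b(1)]) auto
  also have "((\<lambda>z. z \<bullet> b') has_derivative (\<lambda>v. v \<bullet> b')) (at (\<phi> q))"
    by (auto intro!: derivative_eq_intros)
  then have "frechet_derivative (\<lambda>z. z \<bullet> b') (at (\<phi> q)) b = b \<bullet> b'"
    by (simp add: frechet_derivative_at[symmetric])
  finally show ?thesis using model_basis(3)[OF b] by simp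
qed

text \<open>Hadamard's lemma writes f near q as a constant plus the sum of (x_b - x_b(q)) G_b. By
  the Leibniz rule a derivation retains only v(x_b) G_b(q), and G_b(q) is the b-th partial
  derivative of f.\<close>

lemma tangent_expand:
  assumes c: "(D, \<phi>) \<in> atlas M" "q \<in> D" and v: "v \<in> tangent M q"
  shows "v f = (\<Sum>b\<in>model_basis. v (\<lambda>r. \<phi> r \<bullet> b) * coord_deriv D \<phi> b q f)"
proof (cases "smooth_near M q f")
  case False
  then show ?thesis using tangent_nonsmooth[OF v] by (simp add: coord_deriv_def)
next
  case True
  have q: "q \<in> carrier M" using c chart_subset by blast
  obtain N F where F: "Cinf N F" "\<phi> q \<in> N" "\<forall>r\<in>D. \<phi> r \<in> N \<longrightarrow> f r = F (\<phi> r)"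
    using True smooth_near_chart[OF c] by blast
  obtain e where e: "e > 0" "ball (\<phi> q) e \<subseteq> N"
    using openE[OF Cinf_open[OF F(1)] F(2)] by blast
  obtain G where G: "\<And>b. Cinf (ball (\<phi> q) e) (G b)" "\<And>b. G b (\<phi> q) = frechet_derivative F (at (\<phi> q)) b"
    "\<And>z B. z \<in> ball (\<phi> q) e \<Longrightarrow> z - \<phi> q = (\<Sum>b\<in>B. ((z - \<phi> q) \<bullet> b) *\<^sub>R b) \<Longrightarrow>
      F z = F (\<phi> q) + (\<Sum>b\<in>B. ((z - \<phi> q) \<bullet> b) * G b z)"
    by (rule Hadamard[OF Cinf_subset[OF F(1) open_ball e(2)]]) (rule that)
  let ?x = "\<lambda>b r. \<phi> r \<bullet> b - \<phi> q \<bullet> b"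
  have Gs: "smooth_near M q (\<lambda>r. G b (\<phi> r))" for b
    unfolding smooth_near_chart[OF c] using G(1) e(1)
    by (intro exI[of _ "ball (\<phi> q) e"] exI[of _ "G b"]) auto
  have xs: "smooth_near M q (?x b)" for b
    by (intro smooth_near_diff smooth_near_coord[OF c] smooth_near_const q)
  have fs: "smooth_near M q (\<lambda>r. \<Sum>b\<in>model_basis. ?x b r * G b (\<phi> r))"
    by (intro smooth_near_sum smooth_near_mult xs Gs q)
  have "\<forall>\<^sub>F r in nhdsin (topo M) q. f r = f q + (\<Sum>b\<in>model_basis. ?x b r * G b (\<phi> r))"
  proof (rule ev_nhdsinI[OF chart_preimage_open[OF c(1) open_ball]])
    show "q \<in> {r \<in> D. \<phi> r \<in> ball (\<phi> q) e}" using c(2) e(1) by simp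
    fix r assume r: "r \<in> {r \<in> D. \<phi> r \<in> ball (\<phi> q) e}"
    have "\<phi> r - \<phi> q \<in> model M"
      using r c chart_model subspace_diff[OF subspace_model] by blast
    then have "F (\<phi> r) = F (\<phi> q) + (\<Sum>b\<in>model_basis. ((\<phi> r - \<phi> q) \<bullet> b) * G b (\<phi> r))"
      using r model_proj_id[of "\<phi> r - \<phi> q"] by (intro G(3)) (auto simp: model_proj_def)
    then show "f r = f q + (\<Sum>b\<in>model_basis. ?x b r * G b (\<phi> r))"
      using F(2,3) e(2) r c(2) by (auto simp: inner_diff_left)
  qed
  then have "v f = v (\<lambda>r. f q + (\<Sum>b\<in>model_basis. ?x b r * G b (\<phi> r)))"
    by (rule tangent_cong[OF q v])
  also have "\<dots> = (\<Sum>b\<in>model_basis. v (\<lambda>r. ?x b r * G b (\<phi> r)))"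
    using tangent_add[OF v smooth_near_const[OF q, of "f q"] fs] tangent_const[OF q v]
      tangent_sum[OF q v, of model_basis "\<lambda>b r. ?x b r * G b (\<phi> r)"] smooth_near_mult[OF xs Gs] by simp
  also have "\<dots> = (\<Sum>b\<in>model_basis. v (\<lambda>r. \<phi> r \<bullet> b) * coord_deriv D \<phi> b q f)"
  proof (rule sum.cong[OF refl])
    fix b assume b: "b \<in> model_basis"
    have "v (?x b) = v (\<lambda>r. \<phi> r \<bullet> b)"
      using tangent_diff[OF v smooth_near_coord[OF c] smooth_near_const[OF q]] tangent_const[OF q v] by simp
    then show "v (\<lambda>r. ?x b r * G b (\<phi> r)) = v (\<lambda>r. \<phi> r \<bullet> b) * coord_deriv D \<phi> b q f"
      using tangent_mult[OF v xs Gs, of b b] G(2)[of b] coord_deriv_eq[OF c b F(1,2)] F(3) by simp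
  qed
  finally show ?thesis .
qed

section \<open>Germs of vector fields and 1-forms\<close>

definition vf_at :: "'a \<Rightarrow> ('a \<Rightarrow> 'a tvec) \<Rightarrow> bool" where
  "vf_at q X \<longleftrightarrow> X q \<in> tangent M q \<and> (\<forall>f. smooth_near M q f \<longrightarrow> smooth_near M q (\<lambda>r. X r f))"

definition vf_near :: "'a \<Rightarrow> ('a \<Rightarrow> 'a tvec) \<Rightarrow> bool" where
  "vf_near p X \<longleftrightarrow> p \<in> carrier M \<and> (\<forall>\<^sub>F q in nhdsin (topo M) p. vf_at q X)"

text \<open>Test fields are taken from \<open>vf_near\<close> because \<open>vf_at\<close> demands
  tangency at the single point q, whereas smoothness of r \<mapsto> \<open>\<alpha> r (X r)\<close>
  near q concerns X at the points around it.\<close>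

definition form_at :: "'a \<Rightarrow> ('a \<Rightarrow> 'a covec) \<Rightarrow> bool" where
  "form_at q \<alpha> \<longleftrightarrow> \<alpha> q \<in> cotangent M q \<and> (\<forall>X. vf_near q X \<longrightarrow> smooth_near M q (\<lambda>r. \<alpha> r (X r)))"

definition form_near :: "'a \<Rightarrow> ('a \<Rightarrow> 'a covec) \<Rightarrow> bool" where
  "form_near p \<alpha> \<longleftrightarrow> p \<in> carrier M \<and> (\<forall>\<^sub>F q in nhdsin (topo M) p. form_at q \<alpha>)"

text \<open>\<open>vector_fields\<close> tests with functions on all open subsets of U. A germ at q
  is smooth on some neighbourhood, and intersecting this with U gives such a subset; so the
  condition splits into conditions at the single points.\<close>

lemma vector_fields_iff:
  assumes U: "openin (topo M) U"
  shows "X \<in> vector_fields M U \<longleftrightarrow> (\<forall>q\<in>U. vf_at q X)"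
proof
  assume X: "X \<in> vector_fields M U"
  show "\<forall>q\<in>U. vf_at q X"
    unfolding vf_at_def
  proof (intro ballI conjI allI impI)
    fix q f assume q: "q \<in> U" and "smooth_near M q f"
    then obtain W where W: "openin (topo M) W" "q \<in> W" "smooth_fun M W f"
      unfolding smooth_near_def by blast
    have o: "openin (topo M) (U \<inter> W)" using U W(1) by blast
    have "smooth_fun M (U \<inter> W) f"
      using W smooth_fun_iff_near[OF W(1)] smooth_fun_iff_near[OF o] by blast
    then have "smooth_fun M (U \<inter> W) (\<lambda>p. X p f)"
      using X o unfolding vector_fields_def by blast
    then show "smooth_near M q (\<lambda>r. X r f)"
      using smooth_fun_iff_near[OF o] q W(2) by blast
  qed (use X in \<open>auto simp: vector_fields_def\<close>)
next
  assume "\<forall>q\<in>U. vf_at q X"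
  then show "X \<in> vector_fields M U"
    unfolding vector_fields_def vf_at_def by (auto simp: smooth_fun_iff_near subset_eq)
qed

lemma vf_nearI:
  assumes "X \<in> vector_fields M U" "openin (topo M) U" "p \<in> U" shows "vf_near p X"
  unfolding vf_near_def
proof
  show "p \<in> carrier M" using assms(2,3) openin_subset by blast
  show "\<forall>\<^sub>F q in nhdsin (topo M) p. vf_at q X"
    by (rule ev_nhdsinI[OF assms(2,3)]) (use assms vector_fields_iff in blast)
qed

lemma vf_nearE:
  assumes "vf_near p X"
  obtains U where "openin (topo M) U" "p \<in> U" "X \<in> vector_fields M U"
  using assms unfolding vf_near_def by (metis ev_nhdsin vector_fields_iff)

lemma one_forms_iff:
  assumes U: "openin (topo M) U"
  shows "\<alpha> \<in> one_forms M U \<longleftrightarrow> (\<forall>q\<in>U. form_at q \<alpha>)"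
proof
  assume a: "\<alpha> \<in> one_forms M U"
  show "\<forall>q\<in>U. form_at q \<alpha>"
    unfolding form_at_def
  proof (intro ballI conjI allI impI)
    fix q X assume q: "q \<in> U" and "vf_near q X"
    then obtain W where W: "openin (topo M) W" "q \<in> W" "X \<in> vector_fields M W"
      by (rule_tac vf_nearE)
    have o: "openin (topo M) (U \<inter> W)" using U W(1) by blast
    have "X \<in> vector_fields M (U \<inter> W)"
      using W vector_fields_iff[OF W(1)] vector_fields_iff[OF o] by blast
    then have "smooth_fun M (U \<inter> W) (\<lambda>p. \<alpha> p (X p))"
      using a o unfolding one_forms_def by blast
    then show "smooth_near M q (\<lambda>r. \<alpha> r (X r))"
      using smooth_fun_iff_near[OF o] q W(2) by blast
  qed (use a in \<open>auto simp: one_forms_def\<close>)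
next
  assume "\<forall>q\<in>U. form_at q \<alpha>"
  then show "\<alpha> \<in> one_forms M U"
    unfolding one_forms_def form_at_def by (auto simp: smooth_fun_iff_near subset_eq intro: vf_nearI)
qed

lemma form_nearI:
  assumes "\<alpha> \<in> one_forms M U" "openin (topo M) U" "p \<in> U" shows "form_near p \<alpha>"
  unfolding form_near_def
proof
  show "p \<in> carrier M" using assms(2,3) openin_subset by blast
  show "\<forall>\<^sub>F q in nhdsin (topo M) p. form_at q \<alpha>"
    by (rule ev_nhdsinI[OF assms(2,3)]) (use assms one_forms_iff in blast)
qed

lemma form_nearE:
  assumes "form_near p \<alpha>"
  obtains U where "openin (topo M) U" "p \<in> U" "\<alpha> \<in> one_forms M U"
  using assms unfolding form_near_def by (metis ev_nhdsin one_forms_iff)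

lemma vf_near_at: "vf_near p X \<Longrightarrow> vf_at p X"
  unfolding vf_near_def using ev_here by blast

lemma vf_near_tangent: "vf_near p X \<Longrightarrow> X p \<in> tangent M p"
  using vf_near_at vf_at_def by blast

lemma vf_near_smooth: "vf_near p X \<Longrightarrow> smooth_near M p f \<Longrightarrow> smooth_near M p (\<lambda>q. X q f)"
  using vf_near_at vf_at_def by blast

lemma vf_near_carrier: "vf_near p X \<Longrightarrow> p \<in> carrier M"
  unfolding vf_near_def by blast

lemma vf_near_ev: "vf_near p X \<Longrightarrow> \<forall>\<^sub>F q in nhdsin (topo M) p. vf_near q X"
  unfolding vf_near_def using ev_ev[of p "\<lambda>q. vf_at q X"] ev_carrier[of p] by (auto elim: eventually_elim2)

lemma form_near_at: "form_near p \<alpha> \<Longrightarrow> form_at p \<alpha>"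
  unfolding form_near_def using ev_here by blast

lemma form_near_cotangent: "form_near p \<alpha> \<Longrightarrow> \<alpha> p \<in> cotangent M p"
  using form_near_at form_at_def by blast

lemma form_near_smooth: "form_near p \<alpha> \<Longrightarrow> vf_near p X \<Longrightarrow> smooth_near M p (\<lambda>q. \<alpha> q (X q))"
  using form_near_at form_at_def by blast

lemma form_near_carrier: "form_near p \<alpha> \<Longrightarrow> p \<in> carrier M"
  unfolding form_near_def by blast

lemma form_near_ev: "form_near p \<alpha> \<Longrightarrow> \<forall>\<^sub>F q in nhdsin (topo M) p. form_near q \<alpha>"
  unfolding form_near_def using ev_ev[of p "\<lambda>q. form_at q \<alpha>"] ev_carrier[of p] by (auto elim: eventually_elim2)

lemma vf_nearI_ev:
  assumes "p \<in> carrier M" "\<forall>\<^sub>F q in nhdsin (topo M) p. X q \<in> tangent M q"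
    "\<forall>\<^sub>F q in nhdsin (topo M) p. \<forall>f. smooth_near M q f \<longrightarrow> smooth_near M q (\<lambda>r. X r f)"
  shows "vf_near p X"
  unfolding vf_near_def vf_at_def using assms by (auto elim: eventually_elim2)

lemma form_nearI_ev:
  assumes "p \<in> carrier M" "\<forall>\<^sub>F q in nhdsin (topo M) p. \<alpha> q \<in> cotangent M q"
    "\<forall>\<^sub>F q in nhdsin (topo M) p. \<forall>X. vf_near q X \<longrightarrow> smooth_near M q (\<lambda>r. \<alpha> r (X r))"
  shows "form_near p \<alpha>"
  unfolding form_near_def form_at_def using assms by (auto elim: eventually_elim2)

lemma vf_near_cong:
  assumes X: "vf_near p X" and eq: "\<forall>\<^sub>F q in nhdsin (topo M) p. X q = Y q"
  shows "vf_near p Y"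
proof -
  have p: "p \<in> carrier M" using X vf_near_carrier by blast
  have "\<forall>\<^sub>F q in nhdsin (topo M) p. vf_at q Y"
    using X[unfolded vf_near_def, THEN conjunct2] ev_ev[OF p eq] ev_carrier[OF p]
  proof eventually_elim
    case (elim q)
    then have "X q = Y q" using ev_here by blast
    moreover have "smooth_near M q (\<lambda>r. Y r f)" if "smooth_near M q f" for f
      by (rule smooth_near_cong[of q "\<lambda>r. X r f"]) (use elim that in \<open>auto simp: vf_at_def elim: eventually_mono\<close>)
    ultimately show ?case using elim(1) by (auto simp: vf_at_def)
  qed
  then show ?thesis using p by (simp add: vf_near_def)
qed

lemma form_near_cong:
  assumes X: "form_near p \<alpha>" and eq: "\<forall>\<^sub>F q in nhdsin (topo M) p. \<alpha> q = \<beta> q"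
  shows "form_near p \<beta>"
proof -
  have p: "p \<in> carrier M" using X form_near_carrier by blast
  have "\<forall>\<^sub>F q in nhdsin (topo M) p. form_at q \<beta>"
    using X[unfolded form_near_def, THEN conjunct2] ev_ev[OF p eq] ev_carrier[OF p]
  proof eventually_elim
    case (elim q)
    then have "\<alpha> q = \<beta> q" using ev_here by blast
    moreover have "smooth_near M q (\<lambda>r. \<beta> r (Z r))" if "vf_near q Z" for Z
      by (rule smooth_near_cong[of q "\<lambda>r. \<alpha> r (Z r)"]) (use elim that in \<open>auto simp: form_at_def elim: eventually_mono\<close>)
    ultimately show ?case using elim(1) by (auto simp: form_at_def)
  qed
  then show ?thesis using p by (simp add: form_near_def)
qed

lemma vf_near_comb:
  assumes "vf_near p X" "vf_near p Y" "smooth_near M p h" "smooth_near M p k"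
  shows "vf_near p (\<lambda>r f. h r * X r f + k r * Y r f)"
proof (rule vf_nearI_ev)
  show p: "p \<in> carrier M" using assms vf_near_carrier by blast
  show "\<forall>\<^sub>F q in nhdsin (topo M) p. (\<lambda>f. h q * X q f + k q * Y q f) \<in> tangent M q"
    using vf_near_ev[OF assms(1)] vf_near_ev[OF assms(2)]
    by eventually_elim (rule tangent_comb[OF vf_near_tangent vf_near_tangent])
  show "\<forall>\<^sub>F q in nhdsin (topo M) p. \<forall>f. smooth_near M q f \<longrightarrow> smooth_near M q (\<lambda>r. h r * X r f + k r * Y r f)"
    using vf_near_ev[OF assms(1)] vf_near_ev[OF assms(2)] smooth_near_ev[OF assms(3)] smooth_near_ev[OF assms(4)]
  proof (eventually_elim, intro allI impI)
    fix q f assume "vf_near q X" "vf_near q Y" "smooth_near M q h" "smooth_near M q k" "smooth_near M q f"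
    note a = this
    show "smooth_near M q (\<lambda>r. h r * X r f + k r * Y r f)"
      by (rule smooth_near_add[OF smooth_near_mult[OF a(3) vf_near_smooth[OF a(1,5)]]
            smooth_near_mult[OF a(4) vf_near_smooth[OF a(2,5)]]])
  qed
qed

lemma form_near_comb:
  assumes "form_near p \<alpha>" "form_near p \<beta>" "smooth_near M p h" "smooth_near M p k"
  shows "form_near p (\<lambda>r v. h r * \<alpha> r v + k r * \<beta> r v)"
proof (rule form_nearI_ev)
  show p: "p \<in> carrier M" using assms form_near_carrier by blast
  show "\<forall>\<^sub>F q in nhdsin (topo M) p. (\<lambda>v. h q * \<alpha> q v + k q * \<beta> q v) \<in> cotangent M q"
    using form_near_ev[OF assms(1)] form_near_ev[OF assms(2)]
    by eventually_elim (rule cotangent_comb[OF form_near_cotangent form_near_cotangent])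
  show "\<forall>\<^sub>F q in nhdsin (topo M) p. \<forall>X. vf_near q X \<longrightarrow> smooth_near M q (\<lambda>r. h r * \<alpha> r (X r) + k r * \<beta> r (X r))"
    using form_near_ev[OF assms(1)] form_near_ev[OF assms(2)] smooth_near_ev[OF assms(3)] smooth_near_ev[OF assms(4)]
  proof (eventually_elim, intro allI impI)
    fix q X assume "form_near q \<alpha>" "form_near q \<beta>" "smooth_near M q h" "smooth_near M q k" "vf_near q X"
    note a = this
    show "smooth_near M q (\<lambda>r. h r * \<alpha> r (X r) + k r * \<beta> r (X r))"
      by (rule smooth_near_add[OF smooth_near_mult[OF a(3) form_near_smooth[OF a(1,5)]]
            smooth_near_mult[OF a(4) form_near_smooth[OF a(2,5)]]])
  qed
qed

lemma vf_near_zero: "p \<in> carrier M \<Longrightarrow> vf_near p (\<lambda>r f. 0)"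
  by (rule vf_nearI_ev) (auto intro: eventually_mono[OF ev_carrier] simp: tangent_zero smooth_near_const)

lemma form_near_zero: "p \<in> carrier M \<Longrightarrow> form_near p (\<lambda>r v. 0)"
  by (rule form_nearI_ev) (auto intro: eventually_mono[OF ev_carrier] simp: cotangent_zero smooth_near_const)

lemma vf_near_sum:
  "p \<in> carrier M \<Longrightarrow> (\<And>i. i \<in> I \<Longrightarrow> vf_near p (X i)) \<Longrightarrow> (\<And>i. i \<in> I \<Longrightarrow> smooth_near M p (h i)) \<Longrightarrow>
    vf_near p (\<lambda>r f. \<Sum>i\<in>I. h i r * X i r f)"
proof (induction I rule: infinite_finite_induct)
  case (insert i I)
  then show ?case
    using vf_near_comb[of p "X i" "\<lambda>r f. \<Sum>i\<in>I. h i r * X i r f" "h i" "\<lambda>r. 1"]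
    by (simp add: smooth_near_const)
qed (simp_all add: vf_near_zero)

lemma form_near_sum:
  "p \<in> carrier M \<Longrightarrow> (\<And>i. i \<in> I \<Longrightarrow> form_near p (\<alpha> i)) \<Longrightarrow> (\<And>i. i \<in> I \<Longrightarrow> smooth_near M p (h i)) \<Longrightarrow>
    form_near p (\<lambda>r v. \<Sum>i\<in>I. h i r * \<alpha> i r v)"
proof (induction I rule: infinite_finite_induct)
  case (insert i I)
  then show ?case
    using form_near_comb[of p "\<alpha> i" "\<lambda>r v. \<Sum>i\<in>I. h i r * \<alpha> i r v" "h i" "\<lambda>r. 1"]
    by (simp add: smooth_near_const)
qed (simp_all add: form_near_zero)

lemma form_near_differential:
  assumes "smooth_near M p f" shows "form_near p (differential M f)"
proof (rule form_nearI_ev)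
  show p: "p \<in> carrier M" using assms smooth_near_carrier by blast
  show "\<forall>\<^sub>F q in nhdsin (topo M) p. differential M f q \<in> cotangent M q"
    by (simp add: differential_cotangent)
  show "\<forall>\<^sub>F q in nhdsin (topo M) p. \<forall>X. vf_near q X \<longrightarrow> smooth_near M q (\<lambda>r. differential M f r (X r))"
    using smooth_near_ev[OF assms]
  proof (eventually_elim, intro allI impI)
    fix q X assume f: "smooth_near M q f" and X: "vf_near q X"
    show "smooth_near M q (\<lambda>r. differential M f r (X r))"
      by (rule smooth_near_cong[OF vf_near_smooth[OF X f]], use vf_near_ev[OF X] in eventually_elim)
        (simp add: differential_apply vf_near_tangent)
  qed
qed

text \<open>All that later arguments take from a chart. The indices form an orthonormal set in the
  model type so that \<open>smooth_linear_solve\<close> can realise matrices indexed by B as linear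
  maps of that type.\<close>

definition coord_frame :: "'a set \<Rightarrow> 'e set \<Rightarrow> ('e \<Rightarrow> 'a \<Rightarrow> 'a tvec) \<Rightarrow> ('e \<Rightarrow> 'a \<Rightarrow> real) \<Rightarrow> bool" where
  "coord_frame U B E x \<longleftrightarrow> openin (topo M) U \<and> finite B \<and> (\<forall>b\<in>B. \<forall>c\<in>B. b \<bullet> c = of_bool (b = c)) \<and>
     (\<forall>q\<in>U. \<forall>b\<in>B. vf_near q (E b) \<and> smooth_near M q (x b)) \<and>
     (\<forall>q\<in>U. \<forall>b\<in>B. \<forall>c\<in>B. E b q (x c) = of_bool (b = c)) \<and>
     (\<forall>q\<in>U. \<forall>v\<in>tangent M q. \<forall>f. v f = (\<Sum>b\<in>B. v (x b) * E b q f))"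

lemma chart_coord_frame:
  assumes c: "(D, \<phi>) \<in> atlas M"
  shows "coord_frame D model_basis (coord_deriv D \<phi>) (\<lambda>b q. \<phi> q \<bullet> b)"
proof -
  have "vf_near q (coord_deriv D \<phi> b)" if "q \<in> D" "b \<in> model_basis" for q b
  proof (rule vf_nearI[OF _ chart_props(1)[OF c] that(1)])
    show "coord_deriv D \<phi> b \<in> vector_fields M D"
      unfolding vector_fields_iff[OF chart_props(1)[OF c]] vf_at_def
      using coord_deriv_tangent[OF c _ that(2)] coord_deriv_smooth[OF c _ that(2)] by blast
  qed
  then show ?thesis
    unfolding coord_frame_def using chart_props(1)[OF c] model_basis(2,3) smooth_near_coord[OF c]
      coord_deriv_coord[OF c] tangent_expand[OF c] by blast
qed

lemma coord_frame_exists: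
  assumes "p \<in> carrier M"
  obtains U B E x where "coord_frame U B E x" "p \<in> U"
  by (metis assms chart_exists chart_coord_frame)


lemma coord_frameD:
  assumes "coord_frame U B E x" "q \<in> U"
  shows "finite B" "q \<in> carrier M" "\<And>b c. b \<in> B \<Longrightarrow> c \<in> B \<Longrightarrow> b \<bullet> c = of_bool (b = c)"
    "\<And>b. b \<in> B \<Longrightarrow> vf_near q (E b)" "\<And>b. b \<in> B \<Longrightarrow> smooth_near M q (x b)"
    "\<And>b c. b \<in> B \<Longrightarrow> c \<in> B \<Longrightarrow> E b q (x c) = of_bool (b = c)"
    "\<And>v f. v \<in> tangent M q \<Longrightarrow> v f = (\<Sum>b\<in>B. v (x b) * E b q f)"
    "\<And>b. b \<in> B \<Longrightarrow> E b q \<in> tangent M q"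
    "\<forall>\<^sub>F r in nhdsin (topo M) q. r \<in> U"
proof -
  show fr: "finite B" "\<And>b c. b \<in> B \<Longrightarrow> c \<in> B \<Longrightarrow> b \<bullet> c = of_bool (b = c)"
    "\<And>b. b \<in> B \<Longrightarrow> vf_near q (E b)" "\<And>b. b \<in> B \<Longrightarrow> smooth_near M q (x b)"
    "\<And>b c. b \<in> B \<Longrightarrow> c \<in> B \<Longrightarrow> E b q (x c) = of_bool (b = c)"
    "\<And>v f. v \<in> tangent M q \<Longrightarrow> v f = (\<Sum>b\<in>B. v (x b) * E b q f)"
    using assms unfolding coord_frame_def by blast+
  show "q \<in> carrier M" using assms openin_subset unfolding coord_frame_def by blast
  show "\<And>b. b \<in> B \<Longrightarrow> E b q \<in> tangent M q" using fr(3) vf_near_tangent by blast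
  show "\<forall>\<^sub>F r in nhdsin (topo M) q. r \<in> U"
    using assms unfolding coord_frame_def by (intro ev_nhdsinI[of U]) auto
qed

lemma cotangent_expand:
  assumes f: "coord_frame U B E x" "q \<in> U" and a: "a \<in> cotangent M q" and v: "v \<in> tangent M q"
  shows "a v = (\<Sum>b\<in>B. v (x b) * a (E b q))"
proof -
  have "v = (\<lambda>h. \<Sum>b\<in>B. v (x b) * E b q h)" by (rule ext) (rule coord_frameD(7)[OF f v])
  then have "a v = a (\<lambda>h. \<Sum>b\<in>B. v (x b) * E b q h)" by simp
  then show ?thesis
    using cotangent_sum[OF coord_frameD(2)[OF f] a, of B "\<lambda>b. E b q" "\<lambda>b. v (x b)"] coord_frameD(8)[OF f] by simp
qed

lemma cotangent_expand_differential:
  assumes f: "coord_frame U B E x" "q \<in> U" and a: "a \<in> cotangent M q"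
  shows "a = (\<lambda>v. \<Sum>b\<in>B. a (E b q) * differential M (x b) q v)"
proof
  fix v
  show "a v = (\<Sum>b\<in>B. a (E b q) * differential M (x b) q v)"
  proof (cases "v \<in> tangent M q")
    case True
    then show ?thesis using cotangent_expand[OF f a] by (simp add: differential_def mult.commute)
  next
    case False
    then show ?thesis using cotangent_off[OF a] by (simp add: differential_def)
  qed
qed

text \<open>The extension has constant coefficients with respect to the differentials of the
  coordinates. Through it, identities at a point can be tested on germs of 1-forms.\<close>

lemma cotangent_extend:
  assumes p: "p \<in> carrier M" and a: "a \<in> cotangent M p"
  obtains \<alpha> where "form_near p \<alpha>" "\<alpha> p = a"
proof -
  obtain U B E x where f: "coord_frame U B E x" "p \<in> U" using coord_frame_exists[OF p] .
  have "form_near p (\<lambda>r v. \<Sum>b\<in>B. a (E b p) * differential M (x b) r v)"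
    by (rule form_near_sum[OF p form_near_differential[OF coord_frameD(5)[OF f]]])
      (auto intro: smooth_near_const[OF p])
  then show thesis by (rule that) (rule cotangent_expand_differential[OF f a, symmetric])
qed

lemma tangent_eqI:
  assumes "v \<in> tangent M p" "w \<in> tangent M p" "\<And>a. a \<in> cotangent M p \<Longrightarrow> a v = a w"
  shows "v = w"
proof
  fix f
  show "v f = w f"
    using assms(3)[OF differential_cotangent, of f] assms(1,2) by (simp add: differential_apply)
qed

lemma cotangent_eqI:
  assumes "a \<in> cotangent M p" "b \<in> cotangent M p" "\<And>v. v \<in> tangent M p \<Longrightarrow> a v = b v"
  shows "a = b"
proof
  show "a v = b v" for v
    using assms(3) cotangent_off[OF assms(1)] cotangent_off[OF assms(2)] by (cases "v \<in> tangent M p") auto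
qed

lemma tangent_extend:
  assumes p: "p \<in> carrier M" and v: "v \<in> tangent M p"
  obtains X where "vf_near p X" "X p = v"
proof -
  obtain U B E x where f: "coord_frame U B E x" "p \<in> U" using coord_frame_exists[OF p] .
  have "vf_near p (\<lambda>r f. \<Sum>b\<in>B. v (x b) * E b r f)"
    by (rule vf_near_sum[OF p coord_frameD(4)[OF f]]) (auto intro: smooth_near_const[OF p])
  moreover have "(\<lambda>f. \<Sum>b\<in>B. v (x b) * E b p f) = v"
    by (rule ext) (rule coord_frameD(7)[OF f v, symmetric])
  ultimately show thesis by (rule that)
qed

section \<open>Linear systems with smooth coefficients\<close>

lemma smooth_near_chart_family:
  assumes c: "(D, \<phi>) \<in> atlas M" "p \<in> D" and fin: "finite I" and f: "\<And>i. i \<in> I \<Longrightarrow> smooth_near M p (f i)"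
  obtains N F where "open N" "\<phi> p \<in> N" "\<And>i. i \<in> I \<Longrightarrow> Cinf N (F i)"
    "\<And>i r. i \<in> I \<Longrightarrow> r \<in> D \<Longrightarrow> \<phi> r \<in> N \<Longrightarrow> f i r = F i (\<phi> r)"
proof -
  have "\<forall>i\<in>I. \<exists>NF. Cinf (fst NF) (snd NF) \<and> \<phi> p \<in> fst NF \<and> (\<forall>r\<in>D. \<phi> r \<in> fst NF \<longrightarrow> f i r = snd NF (\<phi> r))"
  proof
    fix i assume "i \<in> I"
    then obtain N F where "Cinf N F" "\<phi> p \<in> N" "\<forall>r\<in>D. \<phi> r \<in> N \<longrightarrow> f i r = F (\<phi> r)"
      using f smooth_near_chart[OF c] by blast
    then show "\<exists>NF. Cinf (fst NF) (snd NF) \<and> \<phi> p \<in> fst NF \<and> (\<forall>r\<in>D. \<phi> r \<in> fst NF \<longrightarrow> f i r = snd NF (\<phi> r))"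
      by (intro exI[of _ "(N, F)"]) simp
  qed
  from bchoice[OF this] obtain G where G: "\<And>i. i \<in> I \<Longrightarrow> Cinf (fst (G i)) (snd (G i))"
    "\<And>i. i \<in> I \<Longrightarrow> \<phi> p \<in> fst (G i)"
    "\<And>i r. i \<in> I \<Longrightarrow> r \<in> D \<Longrightarrow> \<phi> r \<in> fst (G i) \<Longrightarrow> f i r = snd (G i) (\<phi> r)" by blast
  have o: "open (\<Inter>i\<in>I. fst (G i))" using fin G(1) Cinf_open by (intro open_INT) blast+
  show thesis
  proof (rule that[of "\<Inter>i\<in>I. fst (G i)" "\<lambda>i. snd (G i)"])
    show "Cinf (\<Inter>i\<in>I. fst (G i)) (snd (G i))" if "i \<in> I" for i
      using that by (intro Cinf_subset[OF G(1) o]) auto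
  qed (use o G(2,3) in auto)
qed

text \<open>A system that is invertible at p is invertible nearby, and inversion is smooth. It
  serves twice: to raise an index with the metric, and to express a field on the leaf through fields
  of the form #\<alpha>.\<close>

lemma smooth_linear_solve:
  fixes B :: "'e set"
  assumes p: "p \<in> carrier M" and fin: "finite B" and on: "\<And>b c. b \<in> B \<Longrightarrow> c \<in> B \<Longrightarrow> b \<bullet> c = of_bool (b = c)"
    and a: "\<And>b c. b \<in> B \<Longrightarrow> c \<in> B \<Longrightarrow> smooth_near M p (a b c)" and r: "\<And>b. b \<in> B \<Longrightarrow> smooth_near M p (r b)"
    and inj: "\<And>y. (\<And>b. b \<in> B \<Longrightarrow> (\<Sum>c\<in>B. a b c p * y c) = 0) \<Longrightarrow> (\<And>c. c \<in> B \<Longrightarrow> y c = 0)"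
  obtains k where "\<And>c. c \<in> B \<Longrightarrow> smooth_near M p (k c)"
    "\<forall>\<^sub>F q in nhdsin (topo M) p. \<forall>b\<in>B. (\<Sum>c\<in>B. a b c q * k c q) = r b q"
proof -
  obtain D \<phi> where c: "(D, \<phi>) \<in> atlas M" "p \<in> D" using chart_exists[OF p] .
  obtain N F where N: "open N" "\<phi> p \<in> N" and F: "\<And>i. i \<in> B \<times> B \<Longrightarrow> Cinf N (F i)"
    "\<And>i r. i \<in> B \<times> B \<Longrightarrow> r \<in> D \<Longrightarrow> \<phi> r \<in> N \<Longrightarrow> a (fst i) (snd i) r = F i (\<phi> r)"
    by (rule smooth_near_chart_family[OF c, of "B \<times> B" "\<lambda>i. a (fst i) (snd i)"]) (use fin a in auto)
  \<comment> \<open>The matrix acts on the span of B, and the second summand is the identity on the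
    orthogonal complement. So A z is an endomorphism of the whole type, injective as soon as the
    matrix is.\<close>
  define A where "A z y = (\<Sum>b\<in>B. (\<Sum>c\<in>B. F (b, c) z * (y \<bullet> c)) *\<^sub>R b) + (y - (\<Sum>b\<in>B. (y \<bullet> b) *\<^sub>R b))" for z y
  have linA: "linear (A z)" for z
    unfolding A_def
    by (rule linearI) (simp_all add: inner_add_left algebra_simps sum.distrib scaleR_sum_right sum_distrib_left
      sum_distrib_right scaleR_sum_left)
  have CA: "Cinf N (\<lambda>z. A z y)" for y
    unfolding A_def using F(1)
    by (intro Cinf_add Cinf_sum Cinf_scaleR Cinf_mult Cinf_const N) auto
  have proj: "(\<Sum>b\<in>B. h b *\<^sub>R b) \<bullet> c = h c" if "c \<in> B" for h c
  proof -
    have "(\<Sum>b\<in>B. h b *\<^sub>R b) \<bullet> c = (\<Sum>b\<in>B. if b = c then h b else 0)"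
      unfolding inner_sum_left using that by (intro sum.cong) (auto simp: on)
    then show ?thesis using that fin by simp
  qed
  have Ab: "A z y \<bullet> b = (\<Sum>c\<in>B. F (b, c) z * (y \<bullet> c))" if "b \<in> B" for z y b
    using proj[OF that] by (simp add: A_def inner_add_left inner_diff_left)
  have "y = 0" if y: "A (\<phi> p) y = 0" for y
  proof -
    have "(\<Sum>c\<in>B. a b c p * (y \<bullet> c)) = 0" if "b \<in> B" for b
      using Ab[OF that, of "\<phi> p" y] y F(2)[of "(b, _)" p] c(2) N that by simp
    then have y0: "y \<bullet> c = 0" if "c \<in> B" for c using inj[of "\<lambda>c. y \<bullet> c"] that by blast
    then have "A (\<phi> p) y = y" by (simp add: A_def)
    then show ?thesis using y by simp
  qed
  then have injA: "inj (A (\<phi> p))" using linear_injective_0[OF linA] by blast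
  obtain N' where N': "open N'" "\<phi> p \<in> N'" "N' \<subseteq> N" "\<And>z. z \<in> N' \<Longrightarrow> inj (A z)"
    using inj_linear_open_condition[OF N linA injA Cinf_continuous_on[OF CA]] by blast
  have Cinv: "Cinf N' (\<lambda>z. inv (A z) w)" for w
    by (rule Cinf_inverse_family[OF N'(1) linA N'(4) Cinf_subset[OF CA N'(1,3)]])
  have CI: "smooth_near M p (\<lambda>q. inv (A (\<phi> q)) w \<bullet> c)" for w c
    unfolding smooth_near_chart[OF \<open>(D, \<phi>) \<in> atlas M\<close> \<open>p \<in> D\<close>]
    using N' Cinf_inner[OF Cinv Cinf_const[OF N'(1)]]
    by (intro exI[of _ N'] exI[of _ "\<lambda>z. inv (A z) w \<bullet> c"]) auto
  \<comment> \<open>The inverse is applied to each basis vector and then combined with the entries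
    of the right-hand side, so r need not be represented in the chart.\<close>
  define k where "k c q = (\<Sum>b\<in>B. r b q * (inv (A (\<phi> q)) b \<bullet> c))" for c q
  show thesis
  proof (rule that[of k])
    show "smooth_near M p (k c)" for c
      unfolding k_def by (intro smooth_near_sum[OF p] smooth_near_mult CI r)
    show "\<forall>\<^sub>F q in nhdsin (topo M) p. \<forall>b\<in>B. (\<Sum>c\<in>B. a b c q * k c q) = r b q"
    proof (rule ev_nhdsinI[OF chart_preimage_open[OF c(1) N'(1)]])
      show "p \<in> {q \<in> D. \<phi> q \<in> N'}" using c N' by simp
    next
      fix q assume q: "q \<in> {q \<in> D. \<phi> q \<in> N'}"
      show "\<forall>b\<in>B. (\<Sum>c\<in>B. a b c q * k c q) = r b q"
      proof
      fix b assume b: "b \<in> B"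
      let ?y = "\<Sum>b\<in>B. r b q *\<^sub>R inv (A (\<phi> q)) b"
      have "surj (A (\<phi> q))"
        using linear_injective_imp_surjective[OF linA] N'(4) q by blast
      then have "A (\<phi> q) ?y = (\<Sum>b\<in>B. r b q *\<^sub>R b)"
        by (simp add: linear_sum[OF linA] linear_cmul[OF linA] surj_f_inv_f)
      then have "(\<Sum>c\<in>B. F (b, c) (\<phi> q) * (?y \<bullet> c)) = r b q"
        using Ab[OF b, of "\<phi> q" ?y] proj[OF b, of "\<lambda>b. r b q"] by simp
      moreover have "?y \<bullet> c = k c q" for c by (simp add: k_def inner_sum_left)
      moreover have "F (b, c) (\<phi> q) = a b c q" if "c \<in> B" for c
        using F(2)[of "(b, c)" q] that b q N' by auto
      ultimately show "(\<Sum>c\<in>B. a b c q * k c q) = r b q" by simp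
      qed
    qed
  qed
qed

section \<open>Lie brackets and Lie derivatives\<close>

text \<open>Applied to f h, a composite of two fields leaves, besides the Leibniz terms, the cross
  terms \<open>W q h * Z q f\<close> and \<open>W q f * Z q h\<close>. Their sum is symmetric in the
  two fields and drops out of the commutator.\<close>

lemma lie_bracket_vf_near:
  assumes X: "vf_near p X" and Y: "vf_near p Y"
  shows "vf_near p (lie_bracket M X Y)"
proof -
  have tan: "lie_bracket M X Y q \<in> tangent M q" if X: "vf_near q X" and Y: "vf_near q Y" for q X Y
  proof -
    have q: "q \<in> carrier M" using X vf_near_carrier by blast
    have lin: "Z q (\<lambda>r. W r (\<lambda>s. c * f s + d * h s)) = c * Z q (\<lambda>r. W r f) + d * Z q (\<lambda>r. W r h)"
      and leib: "Z q (\<lambda>r. W r (\<lambda>s. f s * h s)) =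
        f q * Z q (\<lambda>r. W r h) + W q h * Z q f + (h q * Z q (\<lambda>r. W r f) + W q f * Z q h)"
      if f: "smooth_near M q f" and h: "smooth_near M q h" and Z: "vf_near q Z" and W: "vf_near q W" for f h c d Z W
    proof -
      note t = vf_near_tangent[OF Z]
      note Wf = vf_near_smooth[OF W f] and Wh = vf_near_smooth[OF W h]
      have "\<forall>\<^sub>F r in nhdsin (topo M) q. W r (\<lambda>s. c * f s + d * h s) = c * W r f + d * W r h"
        using vf_near_ev[OF W] smooth_near_ev[OF f] smooth_near_ev[OF h]
        by eventually_elim (rule tangent_lincomb[OF vf_near_tangent])
      from tangent_cong[OF q t this]
      show "Z q (\<lambda>r. W r (\<lambda>s. c * f s + d * h s)) = c * Z q (\<lambda>r. W r f) + d * Z q (\<lambda>r. W r h)"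
        using tangent_lincomb[OF t Wf Wh] by simp
      have "\<forall>\<^sub>F r in nhdsin (topo M) q. W r (\<lambda>s. f s * h s) = f r * W r h + h r * W r f"
        using vf_near_ev[OF W] smooth_near_ev[OF f] smooth_near_ev[OF h]
        by eventually_elim (rule tangent_mult[OF vf_near_tangent])
      from tangent_cong[OF q t this]
      show "Z q (\<lambda>r. W r (\<lambda>s. f s * h s)) =
        f q * Z q (\<lambda>r. W r h) + W q h * Z q f + (h q * Z q (\<lambda>r. W r f) + W q f * Z q h)"
        using tangent_add[OF t smooth_near_mult[OF f Wh] smooth_near_mult[OF h Wf]]
          tangent_mult[OF t f Wh] tangent_mult[OF t h Wf] by simp
    qed
    have "lie_bracket M X Y q (\<lambda>s. c * f s + d * h s) = c * lie_bracket M X Y q f + d * lie_bracket M X Y q h \<and>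
       lie_bracket M X Y q (\<lambda>s. f s * h s) = f q * lie_bracket M X Y q h + h q * lie_bracket M X Y q f"
      if f: "smooth_near M q f" and h: "smooth_near M q h" for f h c d
      using f h smooth_near_lincomb[OF f h] smooth_near_mult[OF f h]
      by (simp add: lie_bracket_def lin[OF f h X Y] lin[OF f h Y X] leib[OF f h X Y] leib[OF f h Y X] algebra_simps)
    then show ?thesis unfolding tangent_def by (auto simp: lie_bracket_def)
  qed
  show ?thesis
  proof (rule vf_nearI_ev)
    show p: "p \<in> carrier M" using X vf_near_carrier by blast
    show "\<forall>\<^sub>F q in nhdsin (topo M) p. lie_bracket M X Y q \<in> tangent M q"
      using vf_near_ev[OF X] vf_near_ev[OF Y] by eventually_elim (rule tan)
    show "\<forall>\<^sub>F q in nhdsin (topo M) p. \<forall>f. smooth_near M q f \<longrightarrow> smooth_near M q (\<lambda>r. lie_bracket M X Y r f)"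
      using vf_near_ev[OF X] vf_near_ev[OF Y]
    proof (eventually_elim, intro allI impI)
      fix q f assume X: "vf_near q X" and Y: "vf_near q Y" and f: "smooth_near M q f"
      have s: "smooth_near M q (\<lambda>r. X r (\<lambda>s. Y s f) - Y r (\<lambda>s. X s f))"
        by (intro smooth_near_diff vf_near_smooth[OF X] vf_near_smooth[OF Y] f)
      show "smooth_near M q (\<lambda>r. lie_bracket M X Y r f)"
        by (rule smooth_near_cong[OF s], use smooth_near_ev[OF f] in eventually_elim) (simp add: lie_bracket_def)
    qed
  qed
qed

lemma lie_bracket_cong:
  assumes X: "vf_near p X" and Y: "vf_near p Y"
    and eX: "\<forall>\<^sub>F q in nhdsin (topo M) p. X q = X' q" and eY: "\<forall>\<^sub>F q in nhdsin (topo M) p. Y q = Y' q"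
  shows "lie_bracket M X Y p = lie_bracket M X' Y' p"
proof
  fix f
  have p: "p \<in> carrier M" using X vf_near_carrier by blast
  have "X p (\<lambda>q. Y q f) = X p (\<lambda>q. Y' q f)"
    by (rule tangent_cong[OF p vf_near_tangent[OF X]], use eY in eventually_elim) simp
  moreover have "Y p (\<lambda>q. X q f) = Y p (\<lambda>q. X' q f)"
    by (rule tangent_cong[OF p vf_near_tangent[OF Y]], use eX in eventually_elim) simp
  ultimately show "lie_bracket M X Y p f = lie_bracket M X' Y' p f"
    using ev_here[OF p eX] ev_here[OF p eY] by (simp add: lie_bracket_def)
qed

lemma lie_bracket_antisym: "lie_bracket M X Y p = (\<lambda>f. - lie_bracket M Y X p f)"
  by (auto simp: lie_bracket_def)

lemma lie_bracket_comb:
  assumes X: "vf_near p X" and Y: "vf_near p Y" and Z: "vf_near p Z" and h: "smooth_near M p h" and k: "smooth_near M p k"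
  shows "lie_bracket M X (\<lambda>q f. h q * Y q f + k q * Z q f) p =
    (\<lambda>f. (h p * lie_bracket M X Y p f + k p * lie_bracket M X Z p f) + (X p h * Y p f + X p k * Z p f))"
proof
  fix f
  note t = vf_near_tangent[OF X]
  show "lie_bracket M X (\<lambda>q f. h q * Y q f + k q * Z q f) p f =
    (h p * lie_bracket M X Y p f + k p * lie_bracket M X Z p f) + (X p h * Y p f + X p k * Z p f)"
  proof (cases "smooth_near M p f")
    case True
    note Yf = vf_near_smooth[OF Y True] and Zf = vf_near_smooth[OF Z True]
    have "X p (\<lambda>q. h q * Y q f + k q * Z q f) = (h p * X p (\<lambda>q. Y q f) + Y p f * X p h) + (k p * X p (\<lambda>q. Z q f) + Z p f * X p k)"
      using tangent_add[OF t smooth_near_mult[OF h Yf] smooth_near_mult[OF k Zf]]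
        tangent_mult[OF t h Yf] tangent_mult[OF t k Zf] by simp
    then show ?thesis using True by (simp add: lie_bracket_def algebra_simps)
  next
    case False
    then show ?thesis
      using tangent_nonsmooth[OF vf_near_tangent[OF Y] False] tangent_nonsmooth[OF vf_near_tangent[OF Z] False]
      by (simp add: lie_bracket_def)
  qed
qed

text \<open>The tensoriality principle, by which \<open>lie_deriv\<close> and
  \<open>contra_conn\<close> are shown to denote. Near p a field is a combination of frame fields
  with coefficients X(x_b), so R X depends on X only through X p. Uniqueness holds because every
  tangent vector at p is the value of a field.\<close>

lemma tensorial_covector:
  assumes p: "p \<in> carrier M"
    and cong: "\<And>X Y. vf_near p X \<Longrightarrow> vf_near p Y \<Longrightarrow> \<forall>\<^sub>F q in nhdsin (topo M) p. X q = Y q \<Longrightarrow> R X = R Y"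
    and comb: "\<And>X Y h k. vf_near p X \<Longrightarrow> vf_near p Y \<Longrightarrow> smooth_near M p h \<Longrightarrow> smooth_near M p k \<Longrightarrow>
      R (\<lambda>q f. h q * X q f + k q * Y q f) = h p * R X + k p * R Y"
  shows "\<exists>!\<delta>. \<delta> \<in> cotangent M p \<and> (\<forall>X. vf_near p X \<longrightarrow> \<delta> (X p) = R X)"
proof -
  obtain U B E x where f: "coord_frame U B E x" "p \<in> U" using coord_frame_exists[OF p] .
  define \<delta> where "\<delta> v = (if v \<in> tangent M p then \<Sum>b\<in>B. v (x b) * R (E b) else 0)" for v
  have "\<delta> \<in> cotangent M p"
    unfolding cotangent_def dual_def linear_over_def \<delta>_def
    by (auto simp: tangent_comb sum.distrib sum_distrib_left algebra_simps)
  moreover have "\<delta> (X p) = R X" if X: "vf_near p X" for X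
  proof -
    have sx: "smooth_near M p (\<lambda>q. X q (x b))" if "b \<in> B" for b
      using vf_near_smooth[OF X coord_frameD(5)[OF f that]] .
    have sum: "R (\<lambda>q f. \<Sum>b\<in>I. X q (x b) * E b q f) = (\<Sum>b\<in>I. X p (x b) * R (E b)) \<and>
        vf_near p (\<lambda>q f. \<Sum>b\<in>I. X q (x b) * E b q f)" if "finite I" "I \<subseteq> B" for I
      using that
    proof (induction I)
      case empty
      show ?case
        using comb[OF vf_near_zero[OF p] vf_near_zero[OF p] smooth_near_const[OF p, of 0] smooth_near_const[OF p, of 0]]
        by (simp add: vf_near_zero[OF p])
    next
      case (insert b I)
      let ?Y = "\<lambda>q f. \<Sum>b\<in>I. X q (x b) * E b q f"
      have b: "b \<in> B" and Y: "vf_near p ?Y" using insert by auto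
      note a = coord_frameD(4)[OF f b] Y sx[OF b] smooth_near_const[OF p, of 1]
      show ?case using insert comb[OF a] vf_near_comb[OF a] by simp
    qed
    have ev: "\<forall>\<^sub>F q in nhdsin (topo M) p. X q = (\<lambda>f. \<Sum>b\<in>B. X q (x b) * E b q f)"
      using vf_near_ev[OF X] coord_frameD(9)[OF f]
    proof eventually_elim
      case (elim q)
      show ?case by (rule ext) (rule coord_frameD(7)[OF f(1) elim(2) vf_near_tangent[OF elim(1)]])
    qed
    have "R X = R (\<lambda>q f. \<Sum>b\<in>B. X q (x b) * E b q f)"
      by (rule cong[OF X _ ev]) (use sum coord_frameD(1)[OF f] in blast)
    then show ?thesis
      using sum[of B] coord_frameD(1)[OF f] vf_near_tangent[OF X] by (simp add: \<delta>_def)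
  qed
  moreover have "\<delta>1 = \<delta>2" if "\<delta>1 \<in> cotangent M p \<and> (\<forall>X. vf_near p X \<longrightarrow> \<delta>1 (X p) = R X)"
    "\<delta>2 \<in> cotangent M p \<and> (\<forall>X. vf_near p X \<longrightarrow> \<delta>2 (X p) = R X)" for \<delta>1 \<delta>2
    by (rule cotangent_eqI[of _ p]) (use that tangent_extend[OF p] in metis)+
  ultimately show ?thesis by blast
qed

lemma form_comb_apply:
  assumes "form_near p \<beta>" "vf_near p X" "vf_near p Y"
  shows "\<forall>\<^sub>F q in nhdsin (topo M) p. \<beta> q (\<lambda>f. h q * X q f + k q * Y q f) = h q * \<beta> q (X q) + k q * \<beta> q (Y q)"
  using form_near_ev[OF assms(1)] vf_near_ev[OF assms(2)] vf_near_ev[OF assms(3)]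
  by eventually_elim (rule cotangent_lincomb[OF form_near_cotangent vf_near_tangent vf_near_tangent])

text \<open>When Z is multiplied by h, both X(\<beta>(Z)) and \<beta>([X, Z]) acquire the term (X h)
  \<beta>(Z). It cancels in the difference, which is therefore tensorial in Z.\<close>

lemma lie_deriv_props:
  assumes X: "vf_near p X" and \<beta>: "form_near p \<beta>"
  shows "lie_deriv M X \<beta> p \<in> cotangent M p"
    and "vf_near p Z \<Longrightarrow> lie_deriv M X \<beta> p (Z p) = X p (\<lambda>q. \<beta> q (Z q)) - \<beta> p (lie_bracket M X Z p)"
proof -
  have p: "p \<in> carrier M" using X vf_near_carrier by blast
  note t = vf_near_tangent[OF X]
  let ?R = "\<lambda>Z. X p (\<lambda>q. \<beta> q (Z q)) - \<beta> p (lie_bracket M X Z p)"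
  have "\<exists>!\<delta>. \<delta> \<in> cotangent M p \<and> (\<forall>Z. vf_near p Z \<longrightarrow> \<delta> (Z p) = ?R Z)"
  proof (rule tensorial_covector[OF p])
    fix Y Z assume Y: "vf_near p Y" and Z: "vf_near p Z" and e: "\<forall>\<^sub>F q in nhdsin (topo M) p. Y q = Z q"
    have "X p (\<lambda>q. \<beta> q (Y q)) = X p (\<lambda>q. \<beta> q (Z q))"
      by (rule tangent_cong[OF p t], use e in eventually_elim) simp
    then show "?R Y = ?R Z" using lie_bracket_cong[OF X Y _ e, of X] by simp
  next
    fix Y Z h k assume Y: "vf_near p Y" and Z: "vf_near p Z" and h: "smooth_near M p h" and k: "smooth_near M p k"
    note bY = form_near_smooth[OF \<beta> Y] and bZ = form_near_smooth[OF \<beta> Z]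
    have "X p (\<lambda>q. \<beta> q (\<lambda>f. h q * Y q f + k q * Z q f)) = X p (\<lambda>q. h q * \<beta> q (Y q) + k q * \<beta> q (Z q))"
      by (rule tangent_cong[OF p t form_comb_apply[OF \<beta> Y Z]])
    also have "\<dots> = (h p * X p (\<lambda>q. \<beta> q (Y q)) + \<beta> p (Y p) * X p h) + (k p * X p (\<lambda>q. \<beta> q (Z q)) + \<beta> p (Z p) * X p k)"
      using tangent_add[OF t smooth_near_mult[OF h bY] smooth_near_mult[OF k bZ]]
        tangent_mult[OF t h bY] tangent_mult[OF t k bZ] by simp
    finally have 1: "X p (\<lambda>q. \<beta> q (\<lambda>f. h q * Y q f + k q * Z q f)) = \<dots>" .
    note c = form_near_cotangent[OF \<beta>] 
    note tb = vf_near_tangent[OF lie_bracket_vf_near[OF X Y]] vf_near_tangent[OF lie_bracket_vf_near[OF X Z]]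
    note tt = vf_near_tangent[OF Y] vf_near_tangent[OF Z]
    have "\<beta> p (lie_bracket M X (\<lambda>q f. h q * Y q f + k q * Z q f) p) =
      (h p * \<beta> p (lie_bracket M X Y p) + k p * \<beta> p (lie_bracket M X Z p)) + (X p h * \<beta> p (Y p) + X p k * \<beta> p (Z p))"
      using cotangent_lincomb[OF c tangent_comb[OF tb, of "h p" "k p"] tangent_comb[OF tt, of "X p h" "X p k"], of 1 1]
        cotangent_lincomb[OF c tb] cotangent_lincomb[OF c tt]
      by (simp add: lie_bracket_comb[OF X Y Z h k])
    then show "?R (\<lambda>q f. h q * Y q f + k q * Z q f) = h p * ?R Y + k p * ?R Z"
      using 1 by (simp add: algebra_simps)
  qed
  moreover have "(\<forall>Z. vf_near p Z \<longrightarrow> P Z) \<longleftrightarrow>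
      (\<forall>W Z. openin (topo M) W \<and> p \<in> W \<and> Z \<in> vector_fields M W \<longrightarrow> P Z)" for P
    by (meson vf_nearE vf_nearI)
  ultimately have "\<exists>!\<delta>. \<delta> \<in> cotangent M p \<and>
     (\<forall>W Z. openin (topo M) W \<and> p \<in> W \<and> Z \<in> vector_fields M W \<longrightarrow> \<delta> (Z p) = ?R Z)"
    by simp
  from theI'[OF this, folded lie_deriv_def]
  have L: "lie_deriv M X \<beta> p \<in> cotangent M p \<and> (\<forall>W Z. openin (topo M) W \<and> p \<in> W \<and> Z \<in> vector_fields M W \<longrightarrow>
     lie_deriv M X \<beta> p (Z p) = ?R Z)" .
  then show "lie_deriv M X \<beta> p \<in> cotangent M p" by blast
  show "lie_deriv M X \<beta> p (Z p) = ?R Z" if "vf_near p Z"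
    using L vf_nearE[OF that] by metis
qed

lemma form_near_lie_deriv:
  assumes X: "vf_near p X" and \<beta>: "form_near p \<beta>"
  shows "form_near p (lie_deriv M X \<beta>)"
proof (rule form_nearI_ev)
  show p: "p \<in> carrier M" using X vf_near_carrier by blast
  show "\<forall>\<^sub>F q in nhdsin (topo M) p. lie_deriv M X \<beta> q \<in> cotangent M q"
    using vf_near_ev[OF X] form_near_ev[OF \<beta>] by eventually_elim (rule lie_deriv_props(1))
  show "\<forall>\<^sub>F q in nhdsin (topo M) p. \<forall>Z. vf_near q Z \<longrightarrow> smooth_near M q (\<lambda>r. lie_deriv M X \<beta> r (Z r))"
    using vf_near_ev[OF X] form_near_ev[OF \<beta>]
  proof (eventually_elim, intro allI impI)
    fix q Z assume X: "vf_near q X" and \<beta>: "form_near q \<beta>" and Z: "vf_near q Z"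
    have s: "smooth_near M q (\<lambda>r. X r (\<lambda>s. \<beta> s (Z s)) - \<beta> r (lie_bracket M X Z r))"
      by (rule smooth_near_diff[OF vf_near_smooth[OF X form_near_smooth[OF \<beta> Z]]
            form_near_smooth[OF \<beta> lie_bracket_vf_near[OF X Z]]])
    show "smooth_near M q (\<lambda>r. lie_deriv M X \<beta> r (Z r))"
      by (rule smooth_near_cong[OF s], use vf_near_ev[OF X] form_near_ev[OF \<beta>] vf_near_ev[OF Z] in eventually_elim)
        (simp add: lie_deriv_props(2))
  qed
qed

section \<open>Globalisation of germs\<close>

text \<open>The bump function of the chart image is extended by 0. Its support lies in K, which is
  compact and hence closed in M by the Hausdorff property; so the extension is smooth also at the
  boundary of the chart domain.\<close>

lemma manifold_bump:
  assumes p: "p \<in> carrier M" and U: "openin (topo M) U" "p \<in> U"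
  obtains h K where "\<And>q. q \<in> carrier M \<Longrightarrow> smooth_near M q h" "\<forall>\<^sub>F q in nhdsin (topo M) p. h q = 1"
    "closedin (topo M) K" "K \<subseteq> U" "\<And>q. q \<notin> K \<Longrightarrow> h q = 0"
proof -
  obtain D \<phi> where c: "(D, \<phi>) \<in> atlas M" "p \<in> D" using chart_exists[OF p] .
  obtain N where N: "open N" "\<And>q. q \<in> D \<Longrightarrow> \<phi> q \<in> N \<Longrightarrow> q \<in> U" "\<phi> ` (U \<inter> D) = model M \<inter> N"
    using chart_image_open[OF c(1) U(1)] by blast
  have "\<phi> p \<in> N" using N(3) U c by blast
  then obtain e where e: "e > 0" "cball (\<phi> p) e \<subseteq> N"
    using N(1) open_contains_cball by blast
  obtain h0 :: "'e \<Rightarrow> real" where h0: "Cinf UNIV h0" "\<And>z. z \<in> ball (\<phi> p) (e/2) \<Longrightarrow> h0 z = 1"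
    "\<And>z. z \<notin> ball (\<phi> p) e \<Longrightarrow> h0 z = 0"
    using bump_function[OF e(1), of "\<phi> p"] by blast
  define K where "K = {q \<in> D. \<phi> q \<in> cball (\<phi> p) e}"
  define h where "h q = (if q \<in> D then h0 (\<phi> q) else 0)" for q
  have KU: "K \<subseteq> U" using e(2) N(2) by (auto simp: K_def)
  have sub: "\<phi> ` K \<subseteq> \<phi> ` D" by (auto simp: K_def)
  \<comment> \<open>The closed ball was chosen inside N, so its trace on the model lies entirely in
    the chart image, and compactness transfers to K.\<close>
  have "compact (model M \<inter> cball (\<phi> p) e)"
    using closed_subspace[OF subspace_model] by (intro closed_Int_compact) auto
  moreover have img: "\<phi> ` K = model M \<inter> cball (\<phi> p) e"
  proof
    show "\<phi> ` K \<subseteq> model M \<inter> cball (\<phi> p) e" using chart_model[OF c(1)] by (auto simp: K_def)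
    show "model M \<inter> cball (\<phi> p) e \<subseteq> \<phi> ` K"
    proof
      fix z assume z: "z \<in> model M \<inter> cball (\<phi> p) e"
      then have "z \<in> \<phi> ` (U \<inter> D)" using e(2) N(3) by blast
      then show "z \<in> \<phi> ` K" using z by (auto simp: K_def)
    qed
  qed
  ultimately have "compactin (top_of_set (\<phi> ` D)) (\<phi> ` K)"
    using sub by (simp add: compactin_subtopology)
  moreover have "homeomorphic_map (subtopology (topo M) D) (top_of_set (\<phi> ` D)) \<phi>"
    using chart_props(3)[OF c(1)] .
  ultimately have "compactin (subtopology (topo M) D) K"
    using homeomorphic_map_compactness_eq[of "subtopology (topo M) D" "top_of_set (\<phi> ` D)" \<phi> K]
      chart_subset[OF c(1)] by (auto simp: K_def)
  then have "compactin (topo M) K" by (simp add: compactin_subtopology)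
  then have Kc: "closedin (topo M) K"
    using compactin_imp_closedin[OF Hausdorff] by blast
  have h0K: "h q = 0" if "q \<notin> K" for q
    using that h0(3)[of "\<phi> q"] by (auto simp: h_def K_def)
  have "smooth_near M q h" if q: "q \<in> carrier M" for q
  proof (cases "q \<in> D")
    case True
    then show ?thesis unfolding smooth_near_chart[OF c(1) True]
      using h0(1) by (intro exI[of _ UNIV] exI[of _ h0]) (auto simp: h_def)
  next
    case False
    then have "q \<in> carrier M - K" using q by (auto simp: K_def)
    moreover have "openin (topo M) (carrier M - K)" using Kc by blast
    ultimately show ?thesis
      by (intro smooth_near_cong[OF smooth_near_const[OF q, of 0]] ev_nhdsinI[of "carrier M - K"]) (auto simp: h0K)
  qed
  moreover have "\<forall>\<^sub>F q in nhdsin (topo M) p. h q = 1"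
    by (rule ev_nhdsinI[OF chart_preimage_open[OF c(1) open_ball[of "\<phi> p" "e/2"]]]) (use c e h0(2) in \<open>auto simp: h_def\<close>)
  ultimately show thesis using that Kc KU h0K by blast
qed

text \<open>\<open>contra_compatible\<close> quantifies over forms on all of M. Multiplying by a
  bump function replaces a germ by such a form without changing it near p.\<close>

lemma form_globalize:
  assumes \<alpha>: "form_near p \<alpha>"
  obtains \<alpha>' where "\<alpha>' \<in> one_forms M (carrier M)" "\<forall>\<^sub>F q in nhdsin (topo M) p. \<alpha> q = \<alpha>' q"
proof -
  have p: "p \<in> carrier M" using form_near_carrier[OF \<alpha>] .
  obtain U where U: "openin (topo M) U" "p \<in> U" "\<alpha> \<in> one_forms M U" using form_nearE[OF \<alpha>] .
  obtain h K where h: "\<And>q. q \<in> carrier M \<Longrightarrow> smooth_near M q h" "\<forall>\<^sub>F q in nhdsin (topo M) p. h q = 1"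
    "closedin (topo M) K" "K \<subseteq> U" "\<And>q. q \<notin> K \<Longrightarrow> h q = 0"
    using manifold_bump[OF p U(1,2)] by blast
  define \<alpha>' where "\<alpha>' q v = h q * \<alpha> q v" for q v
  have "form_near q \<alpha>'" if q: "q \<in> carrier M" for q
  proof (cases "q \<in> U")
    case True
    then show ?thesis
      using form_near_comb[OF form_nearI[OF U(3,1) True] form_near_zero[OF q] h(1)[OF q] smooth_near_const[OF q, of 0]]
      by (simp add: \<alpha>'_def[abs_def])
  next
    case False
    then have "q \<in> carrier M - K" "openin (topo M) (carrier M - K)" using q h(3,4) by blast+
    then show ?thesis
      by (intro form_near_cong[OF form_near_zero[OF q]] ev_nhdsinI[of "carrier M - K"]) (auto simp: \<alpha>'_def h(5))
  qed
  then have "\<alpha>' \<in> one_forms M (carrier M)"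
    by (simp add: one_forms_iff form_near_at)
  moreover have "\<forall>\<^sub>F q in nhdsin (topo M) p. \<alpha> q = \<alpha>' q"
    using h(2) by eventually_elim (rule ext, simp add: \<alpha>'_def)
  ultimately show thesis by (rule that)
qed

end

section \<open>The contravariant connection\<close>

locale metric_bivector = manifold M for M :: "('a, 'e::euclidean_space) mfd" +
  fixes g :: "'a \<Rightarrow> 'a tvec \<Rightarrow> 'a tvec \<Rightarrow> real"
    and \<pi> :: "'a \<Rightarrow> 'a covec \<Rightarrow> 'a covec \<Rightarrow> real"
  assumes metric: "pseudo_riemannian M g" and bivector: "bivector_field M \<pi>"
begin

lemma pi_comb_right:
  assumes "p \<in> carrier M" "a \<in> cotangent M p" "b \<in> cotangent M p" "c \<in> cotangent M p"
  shows "\<pi> p a (\<lambda>v. k * b v + l * c v) = k * \<pi> p a b + l * \<pi> p a c"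
  using bivector assms unfolding bivector_field_def bilinear_over_def linear_over_def by blast

lemma pi_antisym:
  assumes "p \<in> carrier M" "a \<in> cotangent M p" "b \<in> cotangent M p"
  shows "\<pi> p a b = - \<pi> p b a"
  using bivector assms unfolding bivector_field_def by blast

lemma pi_comb_left:
  assumes "p \<in> carrier M" "a \<in> cotangent M p" "b \<in> cotangent M p" "c \<in> cotangent M p"
  shows "\<pi> p (\<lambda>v. k * b v + l * c v) a = k * \<pi> p b a + l * \<pi> p c a"
  using bivector assms unfolding bivector_field_def bilinear_over_def linear_over_def by blast

lemma pi_sum_right:
  assumes p: "p \<in> carrier M" and a: "a \<in> cotangent M p"
  shows "(\<And>i. i \<in> I \<Longrightarrow> b i \<in> cotangent M p) \<Longrightarrow> \<pi> p a (\<lambda>v. \<Sum>i\<in>I. k i * b i v) = (\<Sum>i\<in>I. k i * \<pi> p a (b i))"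
proof -
  have z: "\<pi> p a (\<lambda>v. 0) = 0"
    using pi_comb_right[OF p a cotangent_zero cotangent_zero, of 0 0] by simp
  show "(\<And>i. i \<in> I \<Longrightarrow> b i \<in> cotangent M p) \<Longrightarrow> \<pi> p a (\<lambda>v. \<Sum>i\<in>I. k i * b i v) = (\<Sum>i\<in>I. k i * \<pi> p a (b i))"
  proof (induction I rule: infinite_finite_induct)
    case (insert i I)
    then show ?case
      using pi_comb_right[OF p a, of "b i" "\<lambda>v. \<Sum>i\<in>I. k i * b i v" "k i" 1] cotangent_sum_comb[of I b p k]
      by simp
  qed (simp_all add: z)
qed

lemma pi_smooth:
  assumes "form_near p \<alpha>" "form_near p \<beta>" shows "smooth_near M p (\<lambda>q. \<pi> q (\<alpha> q) (\<beta> q))"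
proof -
  obtain U V where U: "openin (topo M) U" "p \<in> U" "\<alpha> \<in> one_forms M U"
    and V: "openin (topo M) V" "p \<in> V" "\<beta> \<in> one_forms M V"
    using assms form_nearE by metis
  have o: "openin (topo M) (U \<inter> V)" using U V by blast
  have "\<alpha> \<in> one_forms M (U \<inter> V)" "\<beta> \<in> one_forms M (U \<inter> V)"
    using U(3) V(3) unfolding one_forms_iff[OF U(1)] one_forms_iff[OF V(1)] one_forms_iff[OF o] by auto
  then have "smooth_fun M (U \<inter> V) (\<lambda>q. \<pi> q (\<alpha> q) (\<beta> q))"
    using bivector o unfolding bivector_field_def by blast
  then show ?thesis using o U(2) V(2) unfolding smooth_near_def by blast
qed

text \<open>Reflexivity of the tangent space: the functional \<pi>(a, -) on covectors is evaluation
  at the vector whose components are its values on the coordinate differentials. Covectors separate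
  vectors, which gives uniqueness.\<close>

lemma sharp_biv_props:
  assumes p: "p \<in> carrier M" and a: "a \<in> cotangent M p"
  shows "sharp_biv M \<pi> p a \<in> tangent M p" "b \<in> cotangent M p \<Longrightarrow> b (sharp_biv M \<pi> p a) = \<pi> p a b"
proof -
  obtain U B E x where f: "coord_frame U B E x" "p \<in> U" using coord_frame_exists[OF p] .
  define v where "v = (\<lambda>f. \<Sum>b\<in>B. \<pi> p a (differential M (x b) p) * E b p f)"
  have v: "v \<in> tangent M p"
    unfolding v_def by (rule tangent_sum_comb[OF p coord_frameD(8)[OF f]])
  moreover have "b v = \<pi> p a b" if b: "b \<in> cotangent M p" for b
  proof -
    have "b v = (\<Sum>c\<in>B. \<pi> p a (differential M (x c) p) * b (E c p))"
      unfolding v_def by (rule cotangent_sum[OF p b coord_frameD(8)[OF f]])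
    also have "\<dots> = \<pi> p a (\<lambda>v. \<Sum>c\<in>B. b (E c p) * differential M (x c) p v)"
      by (simp add: pi_sum_right[OF p a] differential_cotangent mult.commute)
    finally show ?thesis by (simp flip: cotangent_expand_differential[OF f b])
  qed
  ultimately have "\<exists>!v. v \<in> tangent M p \<and> (\<forall>b\<in>cotangent M p. b v = \<pi> p a b)"
  proof (intro ex1I[of _ v])
    fix w assume "w \<in> tangent M p \<and> (\<forall>b\<in>cotangent M p. b w = \<pi> p a b)"
    then show "w = v" using \<open>\<And>b. b \<in> cotangent M p \<Longrightarrow> b v = \<pi> p a b\<close> v
      by (intro tangent_eqI[of w p v]) simp_all
  qed simp
  from theI'[OF this, folded sharp_biv_def]
  show "sharp_biv M \<pi> p a \<in> tangent M p" "b \<in> cotangent M p \<Longrightarrow> b (sharp_biv M \<pi> p a) = \<pi> p a b" by auto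
qed

lemma sharp_biv_comb:
  assumes "p \<in> carrier M" "a \<in> cotangent M p" "b \<in> cotangent M p"
  shows "sharp_biv M \<pi> p (\<lambda>v. k * a v + l * b v) = (\<lambda>f. k * sharp_biv M \<pi> p a f + l * sharp_biv M \<pi> p b f)"
  by (rule tangent_eqI[of _ p])
    (use assms in \<open>simp_all add: sharp_biv_props cotangent_comb tangent_comb cotangent_lincomb pi_comb_left\<close>)

abbreviation "sp \<equiv> sharp_form M \<pi>"
abbreviation "br \<equiv> form_bracket M \<pi>"
abbreviation "ct \<equiv> cometric M g"
abbreviation "conn \<equiv> contra_conn M g \<pi>"

lemma sp_tangent: "form_near p \<alpha> \<Longrightarrow> sp \<alpha> p \<in> tangent M p"
  by (simp add: sharp_form_def sharp_biv_props form_near_carrier form_near_cotangent)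

lemma sp_apply: "form_near p \<alpha> \<Longrightarrow> b \<in> cotangent M p \<Longrightarrow> b (sp \<alpha> p) = \<pi> p (\<alpha> p) b"
  by (simp add: sharp_form_def sharp_biv_props form_near_carrier form_near_cotangent)

lemma sp_vf_near:
  assumes \<alpha>: "form_near p \<alpha>" shows "vf_near p (sp \<alpha>)"
proof (rule vf_nearI_ev)
  show "p \<in> carrier M" using form_near_carrier[OF \<alpha>] .
  show "\<forall>\<^sub>F q in nhdsin (topo M) p. sp \<alpha> q \<in> tangent M q"
    using form_near_ev[OF \<alpha>] by eventually_elim (rule sp_tangent)
  show "\<forall>\<^sub>F q in nhdsin (topo M) p. \<forall>f. smooth_near M q f \<longrightarrow> smooth_near M q (\<lambda>r. sp \<alpha> r f)"
    using form_near_ev[OF \<alpha>]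
  proof (eventually_elim, intro allI impI)
    fix q f assume \<alpha>: "form_near q \<alpha>" and f: "smooth_near M q f"
    show "smooth_near M q (\<lambda>r. sp \<alpha> r f)"
    proof (rule smooth_near_cong[OF pi_smooth[OF \<alpha> form_near_differential[OF f]]], use form_near_ev[OF \<alpha>] in eventually_elim)
      fix r assume "form_near r \<alpha>"
      then show "\<pi> r (\<alpha> r) (differential M f r) = sp \<alpha> r f"
        using sp_apply[of r \<alpha> "differential M f r"] sp_tangent[of r \<alpha>]
        by (simp add: differential_cotangent differential_apply)
    qed
  qed
qed

lemma sp_cong_ev: "\<forall>\<^sub>F q in nhdsin (topo M) p. \<alpha> q = \<beta> q \<Longrightarrow> \<forall>\<^sub>F q in nhdsin (topo M) p. sp \<alpha> q = sp \<beta> q"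
  by (auto simp: sharp_form_def elim: eventually_mono)

lemma sp_comb:
  assumes "form_near p \<alpha>" "form_near p \<beta>"
  shows "sp (\<lambda>q v. h q * \<alpha> q v + k q * \<beta> q v) p = (\<lambda>f. h p * sp \<alpha> p f + k p * sp \<beta> p f)"
  using assms sharp_biv_comb by (simp add: sharp_form_def form_near_cotangent form_near_carrier)

lemma sp_comb_ev:
  assumes "form_near p \<alpha>" "form_near p \<beta>"
  shows "\<forall>\<^sub>F q in nhdsin (topo M) p. sp (\<lambda>q v. h q * \<alpha> q v + k q * \<beta> q v) q = (\<lambda>f. h q * sp \<alpha> q f + k q * sp \<beta> q f)"
  using form_near_ev[OF assms(1)] form_near_ev[OF assms(2)] by eventually_elim (rule sp_comb)

subsection \<open>The metric\<close>

lemma g_comb_left: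
  "p \<in> carrier M \<Longrightarrow> u \<in> tangent M p \<Longrightarrow> v \<in> tangent M p \<Longrightarrow> w \<in> tangent M p \<Longrightarrow>
    g p (\<lambda>f. k * v f + l * w f) u = k * g p v u + l * g p w u"
  using metric unfolding pseudo_riemannian_def bilinear_over_def linear_over_def by blast

lemma g_comb_right:
  "p \<in> carrier M \<Longrightarrow> u \<in> tangent M p \<Longrightarrow> v \<in> tangent M p \<Longrightarrow> w \<in> tangent M p \<Longrightarrow>
    g p u (\<lambda>f. k * v f + l * w f) = k * g p u v + l * g p u w"
  using metric unfolding pseudo_riemannian_def bilinear_over_def linear_over_def by blast

lemma g_sym: "p \<in> carrier M \<Longrightarrow> u \<in> tangent M p \<Longrightarrow> v \<in> tangent M p \<Longrightarrow> g p u v = g p v u"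
  using metric unfolding pseudo_riemannian_def by blast

lemma g_nondegenerate:
  "p \<in> carrier M \<Longrightarrow> u \<in> tangent M p \<Longrightarrow> (\<And>v. v \<in> tangent M p \<Longrightarrow> g p u v = 0) \<Longrightarrow> u = (\<lambda>f. 0)"
  using metric unfolding pseudo_riemannian_def nondegenerate_over_def by blast

lemma g_smooth:
  assumes "vf_near p X" "vf_near p Y" shows "smooth_near M p (\<lambda>q. g q (X q) (Y q))"
proof -
  obtain U V where U: "openin (topo M) U" "p \<in> U" "X \<in> vector_fields M U"
    and V: "openin (topo M) V" "p \<in> V" "Y \<in> vector_fields M V"
    using assms vf_nearE by metis
  have o: "openin (topo M) (U \<inter> V)" using U V by blast
  have "X \<in> vector_fields M (U \<inter> V)" "Y \<in> vector_fields M (U \<inter> V)"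
    using U(3) V(3) unfolding vector_fields_iff[OF U(1)] vector_fields_iff[OF V(1)] vector_fields_iff[OF o] by auto
  then have "smooth_fun M (U \<inter> V) (\<lambda>q. g q (X q) (Y q))"
    using metric o unfolding pseudo_riemannian_def by blast
  then show ?thesis using o U(2) V(2) unfolding smooth_near_def by blast
qed

section \<open>Lowering and raising indices\<close>

definition flat :: "'a \<Rightarrow> 'a tvec \<Rightarrow> 'a covec" where
  "flat q v = (\<lambda>w. if w \<in> tangent M q then g q v w else 0)"

lemma flat_cotangent: "q \<in> carrier M \<Longrightarrow> v \<in> tangent M q \<Longrightarrow> flat q v \<in> cotangent M q"
  unfolding cotangent_def dual_def linear_over_def flat_def by (auto simp: g_comb_right tangent_comb)

lemma flat_apply: "w \<in> tangent M q \<Longrightarrow> flat q v w = g q v w"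
  by (simp add: flat_def)

lemma flat_comb:
  assumes "q \<in> carrier M" "v \<in> tangent M q" "w \<in> tangent M q"
  shows "flat q (\<lambda>f. k * v f + l * w f) = (\<lambda>u. k * flat q v u + l * flat q w u)"
  using assms by (auto simp: flat_def g_comb_left)

lemma flat_form_near:
  assumes X: "vf_near p X" shows "form_near p (\<lambda>q. flat q (X q))"
proof (rule form_nearI_ev)
  show "p \<in> carrier M" using vf_near_carrier[OF X] .
  show "\<forall>\<^sub>F q in nhdsin (topo M) p. flat q (X q) \<in> cotangent M q"
    using vf_near_ev[OF X] by eventually_elim (rule flat_cotangent[OF vf_near_carrier vf_near_tangent])
  show "\<forall>\<^sub>F q in nhdsin (topo M) p. \<forall>Y. vf_near q Y \<longrightarrow> smooth_near M q (\<lambda>r. flat r (X r) (Y r))"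
    using vf_near_ev[OF X]
  proof (eventually_elim, intro allI impI)
    fix q Y assume X: "vf_near q X" and Y: "vf_near q Y"
    show "smooth_near M q (\<lambda>r. flat r (X r) (Y r))"
      by (rule smooth_near_cong[OF g_smooth[OF X Y]], use vf_near_ev[OF Y] in eventually_elim)
        (simp add: flat_apply vf_near_tangent)
  qed
qed

lemma flat_inj:
  assumes "q \<in> carrier M" "v \<in> tangent M q" "w \<in> tangent M q" "\<And>u. u \<in> tangent M q \<Longrightarrow> g q v u = g q w u"
  shows "v = w"
proof -
  have "(\<lambda>f. 1 * v f + (-1) * w f) = (\<lambda>f. 0)"
  proof (rule g_nondegenerate[OF assms(1) tangent_comb[OF assms(2,3)]])
    fix u assume u: "u \<in> tangent M q"
    show "g q (\<lambda>f. 1 * v f + (-1) * w f) u = 0"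
      using g_comb_left[OF assms(1) u assms(2,3), of 1 "-1"] assms(4)[OF u] by simp
  qed
  then show ?thesis by (auto simp: fun_eq_iff)
qed

text \<open>The smooth inverse of \<open>flat\<close>. The components of X in a frame solve a linear
  system whose matrix is the Gram matrix of the frame, so \<open>smooth_linear_solve\<close> makes
  them smooth.\<close>

lemma raise_form:
  assumes \<alpha>: "form_near p \<alpha>"
  obtains X where "vf_near p X" "\<forall>\<^sub>F q in nhdsin (topo M) p. flat q (X q) = \<alpha> q"
proof -
  have p: "p \<in> carrier M" using form_near_carrier[OF \<alpha>] .
  obtain U B E x where f: "coord_frame U B E x" "p \<in> U" using coord_frame_exists[OF p] .
  note fr = coord_frameD[OF f]
  obtain k where k: "\<And>c. c \<in> B \<Longrightarrow> smooth_near M p (k c)"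
    "\<forall>\<^sub>F q in nhdsin (topo M) p. \<forall>b\<in>B. (\<Sum>c\<in>B. g q (E b q) (E c q) * k c q) = \<alpha> q (E b q)"
  proof (rule smooth_linear_solve[OF p fr(1) fr(3), of "\<lambda>b c q. g q (E b q) (E c q)" "\<lambda>b q. \<alpha> q (E b q)"])
    show "smooth_near M p (\<lambda>q. g q (E b q) (E c q))" if "b \<in> B" "c \<in> B" for b c
      by (intro g_smooth fr(4) that)
    show "smooth_near M p (\<lambda>q. \<alpha> q (E b q))" if "b \<in> B" for b
      by (intro form_near_smooth[OF \<alpha>] fr(4) that)
    \<comment> \<open>A null vector y of the Gram matrix is the component vector of some v
      orthogonal to the frame, hence to all tangent vectors. Nondegeneracy gives v = 0, and applying
      v to the coordinates recovers y.\<close>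
    fix y c assume y: "\<And>b. b \<in> B \<Longrightarrow> (\<Sum>c\<in>B. g p (E b p) (E c p) * y c) = 0" and c: "c \<in> B"
    define v where "v = (\<lambda>f. \<Sum>c\<in>B. y c * E c p f)"
    have v: "v \<in> tangent M p" unfolding v_def by (rule tangent_sum_comb[OF p fr(8)])
    have "flat p (E b p) v = (\<Sum>c\<in>B. y c * flat p (E b p) (E c p))" if "b \<in> B" for b
      unfolding v_def using that by (intro cotangent_sum[OF p flat_cotangent[OF p fr(8)] fr(8)])
    then have gv: "g p v (E b p) = 0" if "b \<in> B" for b
      using y[OF that] that fr(8) v g_sym[OF p v fr(8)] by (simp add: flat_apply mult.commute)
    have "flat p v w = 0" if "w \<in> tangent M p" for w
      using cotangent_expand[OF f flat_cotangent[OF p v] that] gv fr(8) by (simp add: flat_apply)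
    then have "v = (\<lambda>f. 0)"
      using g_nondegenerate[OF p v] by (metis flat_apply)
    then have "v (x c) = 0" by simp
    moreover have "v (x c) = (\<Sum>b\<in>B. if b = c then y b else 0)"
      unfolding v_def using c fr(6) by (intro sum.cong) auto
    ultimately show "y c = 0" using c fr(1) by simp
  qed (assumption | rule that)+
  define X where "X q = (\<lambda>f. \<Sum>c\<in>B. k c q * E c q f)" for q
  have X: "vf_near p X"
    unfolding X_def by (rule vf_near_sum[OF p fr(4) k(1)])
  have "\<forall>\<^sub>F q in nhdsin (topo M) p. flat q (X q) = \<alpha> q"
    using fr(9) k(2) form_near_ev[OF \<alpha>] vf_near_ev[OF X]
  proof eventually_elim
    case (elim q)
    have q: "q \<in> carrier M" using form_near_carrier elim(3) by blast
    note fq = coord_frameD[OF f(1) elim(1)]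
    have Xt: "X q \<in> tangent M q" using vf_near_tangent elim(4) by blast
    have b: "flat q (X q) (E b q) = \<alpha> q (E b q)" if "b \<in> B" for b
    proof -
      have "flat q (X q) (E b q) = flat q (E b q) (X q)"
        using that Xt fq(8) g_sym[OF q] by (simp add: flat_apply)
      also have "\<dots> = (\<Sum>c\<in>B. k c q * flat q (E b q) (E c q))"
        unfolding X_def using that by (intro cotangent_sum[OF q flat_cotangent[OF q fq(8)] fq(8)])
      finally show ?thesis using elim(2) that fq(8) by (simp add: flat_apply mult.commute)
    qed
    show ?case
    proof (rule cotangent_eqI[OF flat_cotangent[OF q Xt] form_near_cotangent[OF elim(3)]])
      fix v assume v: "v \<in> tangent M q"
      show "flat q (X q) v = \<alpha> q v"
        using cotangent_expand[OF f(1) elim(1) flat_cotangent[OF q Xt] v]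
          cotangent_expand[OF f(1) elim(1) form_near_cotangent[OF elim(3)] v] b by simp
    qed
  qed
  with X show thesis by (rule that)
qed

lemma sharp_metric_flat:
  assumes "q \<in> carrier M" "v \<in> tangent M q"
  shows "sharp_metric M g q (flat q v) = v"
  unfolding sharp_metric_def
  by (rule the_equality) (use assms flat_inj[OF assms(1)] in \<open>auto simp: flat_apply\<close>)

lemma cotangent_flat:
  assumes p: "p \<in> carrier M" and a: "a \<in> cotangent M p"
  obtains v where "v \<in> tangent M p" "a = flat p v"
proof -
  obtain \<alpha> where \<alpha>: "form_near p \<alpha>" "\<alpha> p = a" using cotangent_extend[OF p a] .
  obtain X where "vf_near p X" "\<forall>\<^sub>F q in nhdsin (topo M) p. flat q (X q) = \<alpha> q"
    using raise_form[OF \<alpha>(1)] .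
  then show thesis using that[of "X p"] ev_here[OF p] \<alpha>(2) vf_near_tangent by force
qed

text \<open>Once one argument is written as \<open>flat p v\<close>, the cometric is evaluation at
  v. Its bilinearity, symmetry and smoothness, and the construction of the connection, all reduce to
  this.\<close>

lemma ct_flat:
  assumes p: "p \<in> carrier M" and v: "v \<in> tangent M p" and b: "b \<in> cotangent M p"
  shows "ct p (flat p v) b = b v" "ct p b (flat p v) = b v"
proof -
  obtain w where w: "w \<in> tangent M p" "b = flat p w" using cotangent_flat[OF p b] .
  show "ct p (flat p v) b = b v" "ct p b (flat p v) = b v"
    using w v g_sym[OF p v w(1)] by (simp_all add: cometric_def sharp_metric_flat[OF p] flat_apply)
qed

lemma ct_sym: "p \<in> carrier M \<Longrightarrow> a \<in> cotangent M p \<Longrightarrow> b \<in> cotangent M p \<Longrightarrow> ct p a b = ct p b a"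
  using ct_flat cotangent_flat by metis

lemma ct_comb_left:
  assumes p: "p \<in> carrier M" and "a \<in> cotangent M p" "b \<in> cotangent M p" "c \<in> cotangent M p"
  shows "ct p (\<lambda>v. k * a v + l * b v) c = k * ct p a c + l * ct p b c"
proof -
  obtain w where w: "w \<in> tangent M p" "c = flat p w" using cotangent_flat[OF p assms(4)] .
  show ?thesis using assms w by (simp add: ct_flat cotangent_comb)
qed

lemma ct_comb_right:
  assumes p: "p \<in> carrier M" and "a \<in> cotangent M p" "b \<in> cotangent M p" "c \<in> cotangent M p"
  shows "ct p c (\<lambda>v. k * a v + l * b v) = k * ct p c a + l * ct p c b"
proof -
  obtain w where w: "w \<in> tangent M p" "c = flat p w" using cotangent_flat[OF p assms(4)] .
  show ?thesis using assms w by (simp add: ct_flat cotangent_comb)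
qed

lemma ct_eqI:
  assumes p: "p \<in> carrier M" and a: "a \<in> cotangent M p" "b \<in> cotangent M p"
    and eq: "\<And>\<gamma>. form_near p \<gamma> \<Longrightarrow> ct p a (\<gamma> p) = ct p b (\<gamma> p)"
  shows "a = b"
proof (rule cotangent_eqI[OF a])
  fix v assume v: "v \<in> tangent M p"
  obtain \<gamma> where "form_near p \<gamma>" "\<gamma> p = flat p v" using cotangent_extend[OF p flat_cotangent[OF p v]] .
  then show "a v = b v" using eq[of \<gamma>] ct_flat(2)[OF p v] a by simp
qed

lemma ct_smooth:
  assumes \<alpha>: "form_near p \<alpha>" and \<beta>: "form_near p \<beta>"
  shows "smooth_near M p (\<lambda>q. ct q (\<alpha> q) (\<beta> q))"
proof -
  obtain X where X: "vf_near p X" "\<forall>\<^sub>F q in nhdsin (topo M) p. flat q (X q) = \<alpha> q"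
    using raise_form[OF \<alpha>] .
  show ?thesis
  proof (rule smooth_near_cong[OF form_near_smooth[OF \<beta> X(1)]], use X(2) vf_near_ev[OF X(1)] form_near_ev[OF \<beta>] in eventually_elim)
    case (elim q)
    show ?case using ct_flat(1)[OF vf_near_carrier[OF elim(2)] vf_near_tangent[OF elim(2)] form_near_cotangent[OF elim(3)]] elim(1) by simp
  qed
qed

lemma ct_comb_ev:
  assumes "form_near p \<alpha>" "form_near p \<beta>" "form_near p \<gamma>"
  shows "\<forall>\<^sub>F q in nhdsin (topo M) p. ct q (\<lambda>v. h q * \<alpha> q v + k q * \<beta> q v) (\<gamma> q) = h q * ct q (\<alpha> q) (\<gamma> q) + k q * ct q (\<beta> q) (\<gamma> q)"
  using form_near_ev[OF assms(1)] form_near_ev[OF assms(2)] form_near_ev[OF assms(3)]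
  by eventually_elim (rule ct_comb_left[OF form_near_carrier form_near_cotangent form_near_cotangent form_near_cotangent])

lemma tangent_deriv_comb:
  assumes v: "v \<in> tangent M p" and s: "smooth_near M p h" "smooth_near M p k" "smooth_near M p F" "smooth_near M p G"
    and e: "\<forall>\<^sub>F q in nhdsin (topo M) p. H q = h q * F q + k q * G q"
  shows "v H = (h p * v F + k p * v G) + (v h * F p + v k * G p)"
  using tangent_cong[OF smooth_near_carrier[OF s(1)] v e] tangent_add[OF v smooth_near_mult[OF s(1,3)] smooth_near_mult[OF s(2,4)]]
    tangent_mult[OF v s(1,3)] tangent_mult[OF v s(2,4)] by (simp add: algebra_simps)

subsection \<open>The bracket of 1-forms\<close>

lemma br_cotangent:
  assumes "form_near p \<alpha>" "form_near p \<beta>" shows "br \<alpha> \<beta> p \<in> cotangent M p"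
proof -
  have "(\<lambda>v. 1 * (1 * lie_deriv M (sp \<alpha>) \<beta> p v + (-1) * lie_deriv M (sp \<beta>) \<alpha> p v)
      + (-1) * differential M (\<lambda>q. \<pi> q (\<alpha> q) (\<beta> q)) p v) \<in> cotangent M p"
    by (intro cotangent_comb differential_cotangent lie_deriv_props(1) sp_vf_near assms)
  then show ?thesis by (simp add: form_bracket_def[abs_def])
qed

lemma br_apply:
  assumes \<alpha>: "form_near p \<alpha>" and \<beta>: "form_near p \<beta>" and Z: "vf_near p Z"
  shows "br \<alpha> \<beta> p (Z p) = sp \<alpha> p (\<lambda>q. \<beta> q (Z q)) - \<beta> p (lie_bracket M (sp \<alpha>) Z p)
    - sp \<beta> p (\<lambda>q. \<alpha> q (Z q)) + \<alpha> p (lie_bracket M (sp \<beta>) Z p) - Z p (\<lambda>q. \<pi> q (\<alpha> q) (\<beta> q))"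
  using lie_deriv_props(2)[OF sp_vf_near[OF \<alpha>] \<beta> Z] lie_deriv_props(2)[OF sp_vf_near[OF \<beta>] \<alpha> Z]
  by (simp add: form_bracket_def differential_apply vf_near_tangent[OF Z])

lemma br_form_near:
  assumes \<alpha>: "form_near p \<alpha>" and \<beta>: "form_near p \<beta>" shows "form_near p (br \<alpha> \<beta>)"
proof -
  have p: "p \<in> carrier M" using form_near_carrier[OF \<alpha>] .
  note s = smooth_near_const[OF p, of 1] smooth_near_const[OF p, of "-1"]
  have "form_near p (\<lambda>q v. 1 * (1 * lie_deriv M (sp \<alpha>) \<beta> q v + (-1) * lie_deriv M (sp \<beta>) \<alpha> q v)
      + (-1) * differential M (\<lambda>q. \<pi> q (\<alpha> q) (\<beta> q)) q v)"
    by (rule form_near_comb[OF form_near_comb[OF form_near_lie_deriv[OF sp_vf_near[OF \<alpha>] \<beta>]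
            form_near_lie_deriv[OF sp_vf_near[OF \<beta>] \<alpha>] s]
          form_near_differential[OF pi_smooth[OF \<alpha> \<beta>]] s])
  then show ?thesis by (simp add: form_bracket_def[abs_def])
qed

lemma br_cong:
  assumes f: "form_near p \<alpha>" "form_near p \<beta>"
    and e: "\<forall>\<^sub>F q in nhdsin (topo M) p. \<alpha> q = \<alpha>' q" "\<forall>\<^sub>F q in nhdsin (topo M) p. \<beta> q = \<beta>' q"
  shows "br \<alpha> \<beta> p = br \<alpha>' \<beta>' p"
proof -
  have p: "p \<in> carrier M" using form_near_carrier[OF f(1)] .
  note f' = form_near_cong[OF f(1) e(1)] form_near_cong[OF f(2) e(2)]
  note h = ev_here[OF p e(1)] ev_here[OF p e(2)]
  show ?thesis
  proof (rule cotangent_eqI[OF br_cotangent[OF f] br_cotangent[OF f']])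
    fix v assume v: "v \<in> tangent M p"
    then obtain Z where Z: "vf_near p Z" "Z p = v" using tangent_extend[OF p] by blast
    have w: "w (\<lambda>q. \<alpha> q (Z q)) = w (\<lambda>q. \<alpha>' q (Z q))" "w (\<lambda>q. \<beta> q (Z q)) = w (\<lambda>q. \<beta>' q (Z q))"
      "w (\<lambda>q. \<pi> q (\<alpha> q) (\<beta> q)) = w (\<lambda>q. \<pi> q (\<alpha>' q) (\<beta>' q))" if "w \<in> tangent M p" for w
      by (rule tangent_cong[OF p that], use e in eventually_elim, simp)+
    have "sp \<alpha> p = sp \<alpha>' p" "sp \<beta> p = sp \<beta>' p" using h by (simp_all add: sharp_form_def)
    moreover have "lie_bracket M (sp \<alpha>) Z p = lie_bracket M (sp \<alpha>') Z p"
      "lie_bracket M (sp \<beta>) Z p = lie_bracket M (sp \<beta>') Z p"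
      by (rule lie_bracket_cong[OF sp_vf_near[OF f(1)] Z(1) sp_cong_ev[OF e(1)]], simp)
        (rule lie_bracket_cong[OF sp_vf_near[OF f(2)] Z(1) sp_cong_ev[OF e(2)]], simp)
    ultimately show "br \<alpha> \<beta> p v = br \<alpha>' \<beta>' p v"
      using br_apply[OF f Z(1)] br_apply[OF f' Z(1)] Z(2) h w(1)[OF sp_tangent[OF f(2)]]
        w(2)[OF sp_tangent[OF f(1)]] w(3)[OF v]
      by simp
  qed
qed

lemma br_antisym:
  assumes f: "form_near p \<alpha>" "form_near p \<beta>"
  shows "br \<alpha> \<beta> p v = - br \<beta> \<alpha> p v"
proof (cases "v \<in> tangent M p")
  case True
  have p: "p \<in> carrier M" using form_near_carrier[OF f(1)] .
  have "v (\<lambda>q. \<pi> q (\<alpha> q) (\<beta> q)) = v (\<lambda>q. - \<pi> q (\<beta> q) (\<alpha> q))"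
    by (rule tangent_cong[OF p True], use form_near_ev[OF f(1)] form_near_ev[OF f(2)] in eventually_elim)
      (rule pi_antisym[OF form_near_carrier form_near_cotangent form_near_cotangent])
  also have "\<dots> = - v (\<lambda>q. \<pi> q (\<beta> q) (\<alpha> q))"
    by (rule tangent_minus[OF True pi_smooth[OF f(2,1)]])
  finally show ?thesis by (simp add: form_bracket_def differential_apply True)
next
  case False
  then show ?thesis using cotangent_off[OF br_cotangent] f by simp
qed

text \<open>In [\<alpha>, h \<beta>] the terms with dh cancel: the Lie bracket of h #\<beta> with Z
  contributes \<open>v h * \<pi> p (\<alpha> p) (\<beta> p)\<close>, and the differential of h
  \<pi>(\<alpha>, \<beta>) contributes the same with opposite sign. What survives is (#\<alpha> h)
  \<beta>. The factors \<open>1 *\<close> keep the right-hand side a nested combination, to which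
  \<open>cotangent_comb\<close> and \<open>ct_comb_left\<close> apply literally.\<close>

lemma br_comb_right:
  assumes f: "form_near p \<alpha>" "form_near p \<beta>" "form_near p \<gamma>" and s: "smooth_near M p h" "smooth_near M p k"
  shows "br \<alpha> (\<lambda>q v. h q * \<beta> q v + k q * \<gamma> q v) p =
    (\<lambda>v. 1 * (h p * br \<alpha> \<beta> p v + k p * br \<alpha> \<gamma> p v) + 1 * (sp \<alpha> p h * \<beta> p v + sp \<alpha> p k * \<gamma> p v))"
proof (rule cotangent_eqI)
  have p: "p \<in> carrier M" using form_near_carrier[OF f(1)] .
  note fc = form_near_comb[OF f(2,3) s]
  let ?\<delta> = "\<lambda>q v. h q * \<beta> q v + k q * \<gamma> q v"
  show "br \<alpha> ?\<delta> p \<in> cotangent M p" by (rule br_cotangent[OF f(1) fc])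
  show "(\<lambda>v. 1 * (h p * br \<alpha> \<beta> p v + k p * br \<alpha> \<gamma> p v) + 1 * (sp \<alpha> p h * \<beta> p v + sp \<alpha> p k * \<gamma> p v)) \<in> cotangent M p"
    by (intro cotangent_comb br_cotangent form_near_cotangent f)
  fix v assume v: "v \<in> tangent M p"
  then obtain Z where Z: "vf_near p Z" "Z p = v" using tangent_extend[OF p] by blast
  have 1: "sp \<alpha> p (\<lambda>q. ?\<delta> q (Z q)) = (h p * sp \<alpha> p (\<lambda>q. \<beta> q (Z q)) + k p * sp \<alpha> p (\<lambda>q. \<gamma> q (Z q)))
      + (sp \<alpha> p h * \<beta> p v + sp \<alpha> p k * \<gamma> p v)"
    using tangent_deriv_comb[OF sp_tangent[OF f(1)] s form_near_smooth[OF f(2) Z(1)] form_near_smooth[OF f(3) Z(1)]] Z(2)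
    by simp
  have "\<forall>\<^sub>F q in nhdsin (topo M) p. \<pi> q (\<alpha> q) (?\<delta> q) = h q * \<pi> q (\<alpha> q) (\<beta> q) + k q * \<pi> q (\<alpha> q) (\<gamma> q)"
    using form_near_ev[OF f(1)] form_near_ev[OF f(2)] form_near_ev[OF f(3)]
    by eventually_elim (rule pi_comb_right[OF form_near_carrier form_near_cotangent form_near_cotangent form_near_cotangent])
  from tangent_deriv_comb[OF v s pi_smooth[OF f(1,2)] pi_smooth[OF f(1,3)] this]
  have 2: "v (\<lambda>q. \<pi> q (\<alpha> q) (?\<delta> q)) = (h p * v (\<lambda>q. \<pi> q (\<alpha> q) (\<beta> q)) + k p * v (\<lambda>q. \<pi> q (\<alpha> q) (\<gamma> q)))
      + (v h * \<pi> p (\<alpha> p) (\<beta> p) + v k * \<pi> p (\<alpha> p) (\<gamma> p))" .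
  note sv = sp_vf_near[OF f(2)] sp_vf_near[OF f(3)]
  note ts = vf_near_tangent[OF sv(1)] vf_near_tangent[OF sv(2)]
  note tb = vf_near_tangent[OF lie_bracket_vf_near[OF Z(1) sv(1)]] vf_near_tangent[OF lie_bracket_vf_near[OF Z(1) sv(2)]]
  note ca = form_near_cotangent[OF f(1)]
  have "lie_bracket M (sp ?\<delta>) Z p = lie_bracket M (\<lambda>q f. h q * sp \<beta> q f + k q * sp \<gamma> q f) Z p"
    by (rule lie_bracket_cong[OF sp_vf_near[OF fc] Z(1) sp_comb_ev[OF f(2,3)]]) simp
  also have "\<dots> = (\<lambda>f. (- 1) * ((h p * lie_bracket M Z (sp \<beta>) p f + k p * lie_bracket M Z (sp \<gamma>) p f))
      + (-1) * (v h * sp \<beta> p f + v k * sp \<gamma> p f))"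
    using lie_bracket_comb[OF Z(1) sv s] Z(2)
    by (subst lie_bracket_antisym) (simp add: algebra_simps)
  finally have "\<alpha> p (lie_bracket M (sp ?\<delta>) Z p) = (-1) * (h p * \<alpha> p (lie_bracket M Z (sp \<beta>) p) + k p * \<alpha> p (lie_bracket M Z (sp \<gamma>) p))
      + (-1) * (v h * \<alpha> p (sp \<beta> p) + v k * \<alpha> p (sp \<gamma> p))"
    by (simp only: cotangent_lincomb[OF ca tangent_comb[OF tb] tangent_comb[OF ts]] cotangent_lincomb[OF ca tb] cotangent_lincomb[OF ca ts])
  moreover have "\<alpha> p (lie_bracket M (sp \<delta>) Z p) = - \<alpha> p (lie_bracket M Z (sp \<delta>) p)" if "form_near p \<delta>" for \<delta>
    using cotangent_lincomb[OF ca vf_near_tangent[OF lie_bracket_vf_near[OF Z(1) sp_vf_near[OF that]]] tangent_zero[OF p], of "-1" 0]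
    by (subst lie_bracket_antisym) simp
  moreover have "\<alpha> p (sp \<beta> p) = - \<pi> p (\<alpha> p) (\<beta> p)" "\<alpha> p (sp \<gamma> p) = - \<pi> p (\<alpha> p) (\<gamma> p)"
    using sp_apply[OF f(2) ca] pi_antisym[OF p form_near_cotangent[OF f(2)] ca]
      sp_apply[OF f(3) ca] pi_antisym[OF p form_near_cotangent[OF f(3)] ca] by simp_all
  ultimately have 3: "\<alpha> p (lie_bracket M (sp ?\<delta>) Z p) = (h p * \<alpha> p (lie_bracket M (sp \<beta>) Z p) + k p * \<alpha> p (lie_bracket M (sp \<gamma>) Z p))
      + (v h * \<pi> p (\<alpha> p) (\<beta> p) + v k * \<pi> p (\<alpha> p) (\<gamma> p))"
    using f by (simp add: algebra_simps)
  show "br \<alpha> ?\<delta> p v = 1 * (h p * br \<alpha> \<beta> p v + k p * br \<alpha> \<gamma> p v) + 1 * (sp \<alpha> p h * \<beta> p v + sp \<alpha> p k * \<gamma> p v)"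
    unfolding br_apply[OF f(1) fc Z(1), unfolded Z(2)] br_apply[OF f(1,2) Z(1), unfolded Z(2)]
      br_apply[OF f(1,3) Z(1), unfolded Z(2)] 1 2 3 sp_comb[OF f(2,3), of h k]
    by (simp add: algebra_simps)
qed


subsection \<open>The Koszul formula\<close>

definition koszul :: "('a \<Rightarrow> 'a covec) \<Rightarrow> ('a \<Rightarrow> 'a covec) \<Rightarrow> ('a \<Rightarrow> 'a covec) \<Rightarrow> 'a \<Rightarrow> real" where
  "koszul \<alpha> \<beta> \<gamma> p = sp \<alpha> p (\<lambda>q. ct q (\<beta> q) (\<gamma> q)) + sp \<beta> p (\<lambda>q. ct q (\<alpha> q) (\<gamma> q))
    - sp \<gamma> p (\<lambda>q. ct q (\<alpha> q) (\<beta> q)) + ct p (br \<gamma> \<alpha> p) (\<beta> p) + ct p (br \<gamma> \<beta> p) (\<alpha> p) + ct p (br \<alpha> \<beta> p) (\<gamma> p)"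

lemma sp_here: "\<alpha> p = \<beta> p \<Longrightarrow> sp \<alpha> p = sp \<beta> p"
  by (simp add: sharp_form_def)

lemma koszul_cong:
  assumes f: "form_near p \<alpha>" "form_near p \<beta>" "form_near p \<gamma>"
    and e: "\<forall>\<^sub>F q in nhdsin (topo M) p. \<alpha> q = \<alpha>' q" "\<forall>\<^sub>F q in nhdsin (topo M) p. \<beta> q = \<beta>' q"
      "\<forall>\<^sub>F q in nhdsin (topo M) p. \<gamma> q = \<gamma>' q"
  shows "koszul \<alpha> \<beta> \<gamma> p = koszul \<alpha>' \<beta>' \<gamma>' p"
proof -
  have p: "p \<in> carrier M" using form_near_carrier[OF f(1)] .
  note h = ev_here[OF p e(1)] ev_here[OF p e(2)] ev_here[OF p e(3)]
  have s: "sp \<alpha> p = sp \<alpha>' p" "sp \<beta> p = sp \<beta>' p" "sp \<gamma> p = sp \<gamma>' p"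
    using h sp_here by blast+
  have b: "br \<gamma> \<alpha> p = br \<gamma>' \<alpha>' p" "br \<gamma> \<beta> p = br \<gamma>' \<beta>' p" "br \<alpha> \<beta> p = br \<alpha>' \<beta>' p"
    by (rule br_cong[OF f(3,1) e(3,1)] br_cong[OF f(3,2) e(3,2)] br_cong[OF f(1,2) e(1,2)])+
  have "sp \<alpha> p (\<lambda>q. ct q (\<beta> q) (\<gamma> q)) = sp \<alpha> p (\<lambda>q. ct q (\<beta>' q) (\<gamma>' q))"
    by (rule tangent_cong[OF p sp_tangent[OF f(1)]], use e in eventually_elim) simp
  moreover have "sp \<beta> p (\<lambda>q. ct q (\<alpha> q) (\<gamma> q)) = sp \<beta> p (\<lambda>q. ct q (\<alpha>' q) (\<gamma>' q))"
    by (rule tangent_cong[OF p sp_tangent[OF f(2)]], use e in eventually_elim) simp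
  moreover have "sp \<gamma> p (\<lambda>q. ct q (\<alpha> q) (\<beta> q)) = sp \<gamma> p (\<lambda>q. ct q (\<alpha>' q) (\<beta>' q))"
    by (rule tangent_cong[OF p sp_tangent[OF f(3)]], use e in eventually_elim) simp
  ultimately show ?thesis
    unfolding koszul_def b h using s by simp
qed

lemma koszul_smooth:
  assumes "form_near p \<alpha>" "form_near p \<beta>" "form_near p \<gamma>"
  shows "smooth_near M p (koszul \<alpha> \<beta> \<gamma>)"
proof -
  have "smooth_near M p (\<lambda>p. koszul \<alpha> \<beta> \<gamma> p)"
    unfolding koszul_def
    by (intro smooth_near_add smooth_near_diff vf_near_smooth[OF sp_vf_near] ct_smooth br_form_near assms)
  then show ?thesis .
qed

lemma ct_swap_ev:
  assumes f: "form_near p \<alpha>" "form_near p \<beta>" and v: "v \<in> tangent M p"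
  shows "v (\<lambda>q. ct q (\<alpha> q) (\<beta> q)) = v (\<lambda>q. ct q (\<beta> q) (\<alpha> q))"
  by (rule tangent_cong[OF form_near_carrier[OF f(1)] v], use form_near_ev[OF f(1)] form_near_ev[OF f(2)] in eventually_elim)
    (rule ct_sym[OF form_near_carrier form_near_cotangent form_near_cotangent])

lemma ct_br_antisym:
  assumes f: "form_near p \<alpha>" "form_near p \<beta>" and c: "c \<in> cotangent M p"
  shows "ct p (br \<alpha> \<beta> p) c = - ct p (br \<beta> \<alpha> p) c"
proof -
  have p: "p \<in> carrier M" using form_near_carrier[OF f(1)] .
  have "br \<alpha> \<beta> p = (\<lambda>v. (-1) * br \<beta> \<alpha> p v + 0 * c v)" using br_antisym[OF f] by auto
  then have "ct p (br \<alpha> \<beta> p) c = (-1) * ct p (br \<beta> \<alpha> p) c + 0 * ct p c c"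
    by (simp only: ct_comb_left[OF p br_cotangent[OF f(2,1)] c c])
  then show ?thesis by simp
qed

lemma sp_ct_comb:
  assumes f: "form_near p \<alpha>" "form_near p \<beta>" and s: "smooth_near M p h" "smooth_near M p k"
    and x: "form_near p \<xi>" and z: "form_near p \<zeta>"
  shows "sp \<xi> p (\<lambda>q. ct q (\<lambda>v. h q * \<alpha> q v + k q * \<beta> q v) (\<zeta> q)) =
    (h p * sp \<xi> p (\<lambda>q. ct q (\<alpha> q) (\<zeta> q)) + k p * sp \<xi> p (\<lambda>q. ct q (\<beta> q) (\<zeta> q)))
      + (sp \<xi> p h * ct p (\<alpha> p) (\<zeta> p) + sp \<xi> p k * ct p (\<beta> p) (\<zeta> p))"
  by (rule tangent_deriv_comb[OF sp_tangent[OF x] s ct_smooth[OF f(1) z] ct_smooth[OF f(2) z] ct_comb_ev[OF f z]])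

lemma ct_br_comb:
  assumes f: "form_near p \<alpha>" "form_near p \<beta>" and s: "smooth_near M p h" "smooth_near M p k"
    and x: "form_near p \<xi>" and z: "form_near p \<zeta>"
  shows "ct p (br \<xi> (\<lambda>q v. h q * \<alpha> q v + k q * \<beta> q v) p) (\<zeta> p) =
    (h p * ct p (br \<xi> \<alpha> p) (\<zeta> p) + k p * ct p (br \<xi> \<beta> p) (\<zeta> p))
      + (sp \<xi> p h * ct p (\<alpha> p) (\<zeta> p) + sp \<xi> p k * ct p (\<beta> p) (\<zeta> p))"
proof -
  have p: "p \<in> carrier M" using form_near_carrier[OF x] .
  note zc = form_near_cotangent[OF z] and c = form_near_cotangent[OF f(1)] form_near_cotangent[OF f(2)]
  note bc = br_cotangent[OF x f(1)] br_cotangent[OF x f(2)]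
  show ?thesis
    unfolding br_comb_right[OF x f s] ct_comb_left[OF p cotangent_comb[OF bc] cotangent_comb[OF c] zc]
      ct_comb_left[OF p bc zc] ct_comb_left[OF p c zc] by simp
qed

text \<open>The derivative terms produced by a function coefficient cancel between the derivatives of the
  cometric and the brackets.\<close>

lemma koszul_comb_third:
  assumes f: "form_near p \<alpha>" "form_near p \<beta>" "form_near p \<gamma>" "form_near p \<delta>"
    and s: "smooth_near M p h" "smooth_near M p k"
  shows "koszul \<alpha> \<beta> (\<lambda>q v. h q * \<gamma> q v + k q * \<delta> q v) p = h p * koszul \<alpha> \<beta> \<gamma> p + k p * koszul \<alpha> \<beta> \<delta> p"
proof -
  have p: "p \<in> carrier M" using form_near_carrier[OF f(1)] .
  let ?c = "\<lambda>q v. h q * \<gamma> q v + k q * \<delta> q v"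
  note fc = form_near_comb[OF f(3,4) s]
  note c = form_near_cotangent[OF f(1)] form_near_cotangent[OF f(2)] form_near_cotangent[OF f(3)] form_near_cotangent[OF f(4)]
  have sp: "sp \<xi> p (\<lambda>q. ct q (\<zeta> q) (?c q)) = (h p * sp \<xi> p (\<lambda>q. ct q (\<zeta> q) (\<gamma> q)) + k p * sp \<xi> p (\<lambda>q. ct q (\<zeta> q) (\<delta> q)))
      + (sp \<xi> p h * ct p (\<gamma> p) (\<zeta> p) + sp \<xi> p k * ct p (\<delta> p) (\<zeta> p))"
    if x: "form_near p \<xi>" and z: "form_near p \<zeta>" for \<xi> \<zeta>
    using sp_ct_comb[OF f(3,4) s x z] ct_swap_ev[OF z fc sp_tangent[OF x]]
      ct_swap_ev[OF z f(3) sp_tangent[OF x]] ct_swap_ev[OF z f(4) sp_tangent[OF x]] by simp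
  have br: "ct p (br ?c \<xi> p) (\<zeta> p) = (h p * ct p (br \<gamma> \<xi> p) (\<zeta> p) + k p * ct p (br \<delta> \<xi> p) (\<zeta> p))
      - (sp \<xi> p h * ct p (\<gamma> p) (\<zeta> p) + sp \<xi> p k * ct p (\<delta> p) (\<zeta> p))"
    if x: "form_near p \<xi>" and z: "form_near p \<zeta>" for \<xi> \<zeta>
    using ct_br_comb[OF f(3,4) s x z] ct_br_antisym[OF fc x form_near_cotangent[OF z]]
      ct_br_antisym[OF f(3) x form_near_cotangent[OF z]] ct_br_antisym[OF f(4) x form_near_cotangent[OF z]]
    by (simp add: algebra_simps)
  have last: "ct p (br \<alpha> \<beta> p) (?c p) = h p * ct p (br \<alpha> \<beta> p) (\<gamma> p) + k p * ct p (br \<alpha> \<beta> p) (\<delta> p)"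
    by (rule ct_comb_right[OF p c(3,4) br_cotangent[OF f(1,2)]])
  show ?thesis
    unfolding koszul_def last sp[OF f(1,2)] sp[OF f(2,1)] br[OF f(1,2)] br[OF f(2,1)] sp_comb[OF f(3,4)]
    by (simp add: algebra_simps)
qed

text \<open>Substituting \<open>flat\<close> of a field for \<gamma> turns the Koszul functional on
  forms into one on fields, to which \<open>tensorial_covector\<close> applies. By
  \<open>ct_flat\<close> the cometric pairing of \<delta> with that form is \<delta> evaluated on
  the field, and \<open>raise_form\<close> shows that every \<gamma> arises in this way.\<close>

lemma conn_ex1:
  assumes f: "form_near p \<alpha>" "form_near p \<beta>"
  shows "\<exists>!\<delta>. \<delta> \<in> cotangent M p \<and> (\<forall>\<gamma>. form_near p \<gamma> \<longrightarrow> 2 * ct p \<delta> (\<gamma> p) = koszul \<alpha> \<beta> \<gamma> p)"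
proof -
  have p: "p \<in> carrier M" using form_near_carrier[OF f(1)] .
  let ?R = "\<lambda>Z. koszul \<alpha> \<beta> (\<lambda>q. flat q (Z q)) p / 2"
  have ex: "\<exists>!\<delta>. \<delta> \<in> cotangent M p \<and> (\<forall>Z. vf_near p Z \<longrightarrow> \<delta> (Z p) = ?R Z)"
  proof (rule tensorial_covector[OF p])
    fix X Y assume X: "vf_near p X" and Y: "vf_near p Y" and e: "\<forall>\<^sub>F q in nhdsin (topo M) p. X q = Y q"
    have "koszul \<alpha> \<beta> (\<lambda>q. flat q (X q)) p = koszul \<alpha> \<beta> (\<lambda>q. flat q (Y q)) p"
      by (rule koszul_cong[OF f flat_form_near[OF X]], simp, simp, use e in eventually_elim, simp)
    then show "?R X = ?R Y" by simp
  next
    fix X Y h k assume X: "vf_near p X" and Y: "vf_near p Y" and s: "smooth_near M p h" "smooth_near M p k"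
    have ev: "\<forall>\<^sub>F q in nhdsin (topo M) p. flat q (\<lambda>f. h q * X q f + k q * Y q f) = (\<lambda>v. h q * flat q (X q) v + k q * flat q (Y q) v)"
      using vf_near_ev[OF X] vf_near_ev[OF Y]
      by eventually_elim (rule flat_comb[OF vf_near_carrier vf_near_tangent vf_near_tangent])
    have "koszul \<alpha> \<beta> (\<lambda>q. flat q (\<lambda>f. h q * X q f + k q * Y q f)) p =
        koszul \<alpha> \<beta> (\<lambda>q v. h q * flat q (X q) v + k q * flat q (Y q) v) p"
      by (rule koszul_cong[OF f flat_form_near[OF vf_near_comb[OF X Y s]] _ _ ev]) simp_all
    then show "?R (\<lambda>q f. h q * X q f + k q * Y q f) = h p * ?R X + k p * ?R Y"
      using koszul_comb_third[OF f flat_form_near[OF X] flat_form_near[OF Y] s] by (simp add: add_divide_distrib)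
  qed
  have "(\<forall>Z. vf_near p Z \<longrightarrow> \<delta> (Z p) = ?R Z) \<longleftrightarrow> (\<forall>\<gamma>. form_near p \<gamma> \<longrightarrow> 2 * ct p \<delta> (\<gamma> p) = koszul \<alpha> \<beta> \<gamma> p)"
    if d: "\<delta> \<in> cotangent M p" for \<delta>
  proof (intro iffI allI impI)
    fix \<gamma> assume R: "\<forall>Z. vf_near p Z \<longrightarrow> \<delta> (Z p) = ?R Z" and \<gamma>: "form_near p \<gamma>"
    obtain Z where Z: "vf_near p Z" "\<forall>\<^sub>F q in nhdsin (topo M) p. flat q (Z q) = \<gamma> q" using raise_form[OF \<gamma>] .
    have "koszul \<alpha> \<beta> (\<lambda>q. flat q (Z q)) p = koszul \<alpha> \<beta> \<gamma> p"
      by (rule koszul_cong[OF f flat_form_near[OF Z(1)] _ _ Z(2)]) simp_all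
    moreover have "ct p \<delta> (\<gamma> p) = \<delta> (Z p)"
      using ct_flat(2)[OF p vf_near_tangent[OF Z(1)] d] ev_here[OF p Z(2)] by simp
    ultimately show "2 * ct p \<delta> (\<gamma> p) = koszul \<alpha> \<beta> \<gamma> p" using R Z(1) by simp
  next
    fix Z assume R: "\<forall>\<gamma>. form_near p \<gamma> \<longrightarrow> 2 * ct p \<delta> (\<gamma> p) = koszul \<alpha> \<beta> \<gamma> p" and Z: "vf_near p Z"
    show "\<delta> (Z p) = ?R Z"
      using R[rule_format, OF flat_form_near[OF Z]] ct_flat(2)[OF p vf_near_tangent[OF Z] d] by simp
  qed
  then have "(\<delta> \<in> cotangent M p \<and> (\<forall>Z. vf_near p Z \<longrightarrow> \<delta> (Z p) = ?R Z)) \<longleftrightarrow>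
      (\<delta> \<in> cotangent M p \<and> (\<forall>\<gamma>. form_near p \<gamma> \<longrightarrow> 2 * ct p \<delta> (\<gamma> p) = koszul \<alpha> \<beta> \<gamma> p))" for \<delta>
    by (rule conj_cong[OF refl])
  then show ?thesis using ex by (simp only:)
qed

lemma conn_props:
  assumes f: "form_near p \<alpha>" "form_near p \<beta>"
  shows "conn \<alpha> \<beta> p \<in> cotangent M p"
    and "form_near p \<gamma> \<Longrightarrow> 2 * ct p (conn \<alpha> \<beta> p) (\<gamma> p) = koszul \<alpha> \<beta> \<gamma> p"
proof -
  have "(\<forall>\<gamma>. form_near p \<gamma> \<longrightarrow> P \<gamma>) \<longleftrightarrow>
      (\<forall>W \<gamma>. openin (topo M) W \<and> p \<in> W \<and> \<gamma> \<in> one_forms M W \<longrightarrow> P \<gamma>)" for P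
    by (meson form_nearE form_nearI)
  then have "\<exists>!\<delta>. \<delta> \<in> cotangent M p \<and> (\<forall>W \<gamma>. openin (topo M) W \<and> p \<in> W \<and> \<gamma> \<in> one_forms M W \<longrightarrow>
      2 * ct p \<delta> (\<gamma> p) = koszul \<alpha> \<beta> \<gamma> p)"
    using conn_ex1[OF f] by simp
  from theI'[OF this, unfolded koszul_def, folded contra_conn_def, folded koszul_def]
  have L: "conn \<alpha> \<beta> p \<in> cotangent M p \<and> (\<forall>W \<gamma>. openin (topo M) W \<and> p \<in> W \<and> \<gamma> \<in> one_forms M W \<longrightarrow>
     2 * ct p (conn \<alpha> \<beta> p) (\<gamma> p) = koszul \<alpha> \<beta> \<gamma> p)" .
  then show "conn \<alpha> \<beta> p \<in> cotangent M p" by blast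
  show "2 * ct p (conn \<alpha> \<beta> p) (\<gamma> p) = koszul \<alpha> \<beta> \<gamma> p" if "form_near p \<gamma>"
    using L form_nearE[OF that] by metis
qed

text \<open>Evaluated on a field Z, the connection is half the Koszul expression with third argument
  \<open>flat\<close> of Z, which is smooth.\<close>

lemma conn_form_near:
  assumes f: "form_near p \<alpha>" "form_near p \<beta>" shows "form_near p (conn \<alpha> \<beta>)"
proof (rule form_nearI_ev)
  show p: "p \<in> carrier M" using form_near_carrier[OF f(1)] .
  show "\<forall>\<^sub>F q in nhdsin (topo M) p. conn \<alpha> \<beta> q \<in> cotangent M q"
    using form_near_ev[OF f(1)] form_near_ev[OF f(2)] by eventually_elim (rule conn_props(1))
  show "\<forall>\<^sub>F q in nhdsin (topo M) p. \<forall>Z. vf_near q Z \<longrightarrow> smooth_near M q (\<lambda>r. conn \<alpha> \<beta> r (Z r))"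
    using form_near_ev[OF f(1)] form_near_ev[OF f(2)]
  proof (eventually_elim, intro allI impI)
    fix q Z assume f: "form_near q \<alpha>" "form_near q \<beta>" and Z: "vf_near q Z"
    have "smooth_near M q (\<lambda>r. (1/2) * koszul \<alpha> \<beta> (\<lambda>q. flat q (Z q)) r)"
      by (intro smooth_near_mult smooth_near_const koszul_smooth flat_form_near f Z vf_near_carrier[OF Z])
    then show "smooth_near M q (\<lambda>r. conn \<alpha> \<beta> r (Z r))"
    proof (rule smooth_near_cong, use form_near_ev[OF f(1)] form_near_ev[OF f(2)] vf_near_ev[OF Z] in eventually_elim)
      case (elim r)
      show ?case
        using conn_props(2)[OF elim(1,2) flat_form_near[OF elim(3)]]
          ct_flat(2)[OF vf_near_carrier[OF elim(3)] vf_near_tangent[OF elim(3)] conn_props(1)[OF elim(1,2)]] by simp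
    qed
  qed
qed

lemma conn_cong:
  assumes f: "form_near p \<alpha>" "form_near p \<beta>"
    and e: "\<forall>\<^sub>F q in nhdsin (topo M) p. \<alpha> q = \<alpha>' q" "\<forall>\<^sub>F q in nhdsin (topo M) p. \<beta> q = \<beta>' q"
  shows "conn \<alpha> \<beta> p = conn \<alpha>' \<beta>' p"
proof (rule ct_eqI)
  note f' = form_near_cong[OF f(1) e(1)] form_near_cong[OF f(2) e(2)]
  show "p \<in> carrier M" "conn \<alpha> \<beta> p \<in> cotangent M p" "conn \<alpha>' \<beta>' p \<in> cotangent M p"
    using form_near_carrier[OF f(1)] conn_props(1)[OF f] conn_props(1)[OF f'] by auto
  fix \<gamma> assume g: "form_near p \<gamma>"
  have "koszul \<alpha> \<beta> \<gamma> p = koszul \<alpha>' \<beta>' \<gamma> p"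
    by (rule koszul_cong[OF f g e]) simp
  then show "ct p (conn \<alpha> \<beta> p) (\<gamma> p) = ct p (conn \<alpha>' \<beta>' p) (\<gamma> p)"
    using conn_props(2)[OF f g] conn_props(2)[OF f' g] by simp
qed

text \<open>Exchanging \<alpha> and \<beta> in the Koszul formula swaps the first two derivatives
  and the two brackets with \<gamma>. Only [\<alpha>, \<beta>] changes sign.\<close>

lemma conn_torsion_free:
  assumes f: "form_near p \<alpha>" "form_near p \<beta>"
  shows "conn \<alpha> \<beta> p = (\<lambda>v. 1 * conn \<beta> \<alpha> p v + 1 * br \<alpha> \<beta> p v)"
proof (rule ct_eqI)
  show p: "p \<in> carrier M" using form_near_carrier[OF f(1)] .
  note d = conn_props(1)[OF f] conn_props(1)[OF f(2,1)] br_cotangent[OF f]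
  show "conn \<alpha> \<beta> p \<in> cotangent M p" by (rule d(1))
  show "(\<lambda>v. 1 * conn \<beta> \<alpha> p v + 1 * br \<alpha> \<beta> p v) \<in> cotangent M p"
    by (rule cotangent_comb[OF d(2,3)])
  fix \<gamma> assume g: "form_near p \<gamma>"
  have "ct p (\<lambda>v. 1 * conn \<beta> \<alpha> p v + 1 * br \<alpha> \<beta> p v) (\<gamma> p) = 1 * ct p (conn \<beta> \<alpha> p) (\<gamma> p) + 1 * ct p (br \<alpha> \<beta> p) (\<gamma> p)"
    by (rule ct_comb_left[OF p d(2,3) form_near_cotangent[OF g]])
  then show "ct p (conn \<alpha> \<beta> p) (\<gamma> p) = ct p (\<lambda>v. 1 * conn \<beta> \<alpha> p v + 1 * br \<alpha> \<beta> p v) (\<gamma> p)"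
    using conn_props(2)[OF f g] conn_props(2)[OF f(2,1) g] ct_swap_ev[OF f sp_tangent[OF g]]
      ct_br_antisym[OF f form_near_cotangent[OF g]]
    unfolding koszul_def by linarith
qed

text \<open>In the sum of the Koszul expressions for \<beta>, \<gamma> and for \<gamma>, \<beta> the
  brackets cancel in pairs, and so do the derivatives along #\<beta> and #\<gamma>. Twice the
  derivative along #\<alpha> remains.\<close>

lemma conn_metric:
  assumes f: "form_near p \<alpha>" "form_near p \<beta>" "form_near p \<gamma>"
  shows "sp \<alpha> p (\<lambda>q. ct q (\<beta> q) (\<gamma> q)) = ct p (conn \<alpha> \<beta> p) (\<gamma> p) + ct p (\<beta> p) (conn \<alpha> \<gamma> p)"
proof -
  have p: "p \<in> carrier M" using form_near_carrier[OF f(1)] .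
  have "2 * ct p (conn \<alpha> \<beta> p) (\<gamma> p) + 2 * ct p (conn \<alpha> \<gamma> p) (\<beta> p) = koszul \<alpha> \<beta> \<gamma> p + koszul \<alpha> \<gamma> \<beta> p"
    using conn_props(2)[OF f] conn_props(2)[OF f(1,3,2)] by simp
  also have "\<dots> = 2 * sp \<alpha> p (\<lambda>q. ct q (\<beta> q) (\<gamma> q))"
    using ct_swap_ev[OF f(2,3) sp_tangent[OF f(1)]]
      ct_br_antisym[OF f(3,1) form_near_cotangent[OF f(2)]]
      ct_br_antisym[OF f(3,2) form_near_cotangent[OF f(1)]] ct_br_antisym[OF f(2,1) form_near_cotangent[OF f(3)]]
    unfolding koszul_def by linarith
  finally show ?thesis
    using ct_sym[OF p form_near_cotangent[OF f(2)] conn_props(1)[OF f(1,3)]] by linarith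
qed

text \<open>With h \<alpha> in the first slot, the derivatives of h along the sharps of the other
  two forms occur once in a derivative of the cometric and once, with opposite sign, in a
  bracket.\<close>

lemma conn_comb_left:
  assumes f: "form_near p \<alpha>" "form_near p \<beta>" "form_near p \<gamma>" and s: "smooth_near M p h" "smooth_near M p k"
  shows "conn (\<lambda>q v. h q * \<alpha> q v + k q * \<beta> q v) \<gamma> p = (\<lambda>v. h p * conn \<alpha> \<gamma> p v + k p * conn \<beta> \<gamma> p v)"
proof (rule ct_eqI)
  show p: "p \<in> carrier M" using form_near_carrier[OF f(1)] .
  let ?c = "\<lambda>q v. h q * \<alpha> q v + k q * \<beta> q v"
  note fc = form_near_comb[OF f(1,2) s]
  note d = conn_props(1)[OF f(1,3)] conn_props(1)[OF f(2,3)]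
  note c = form_near_cotangent[OF f(1)] form_near_cotangent[OF f(2)] form_near_cotangent[OF f(3)]
  show "conn ?c \<gamma> p \<in> cotangent M p" using conn_props(1)[OF fc f(3)] .
  show "(\<lambda>v. h p * conn \<alpha> \<gamma> p v + k p * conn \<beta> \<gamma> p v) \<in> cotangent M p" by (rule cotangent_comb[OF d])
  fix \<delta> assume g: "form_near p \<delta>"
  note gc = form_near_cotangent[OF g]
  note sp = sp_ct_comb[OF f(1,2) s] and br = ct_br_comb[OF f(1,2) s]
  have k3: "koszul ?c \<gamma> \<delta> p = h p * koszul \<alpha> \<gamma> \<delta> p + k p * koszul \<beta> \<gamma> \<delta> p"
    unfolding koszul_def sp[OF f(3) g] sp[OF g f(3)] sp_comb[OF f(1,2)] br[OF g f(3)]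
      ct_comb_right[OF p c(1,2) br_cotangent[OF g f(3)]]
      ct_br_antisym[OF fc f(3) gc] br[OF f(3) g] ct_br_antisym[OF f(1,3) gc] ct_br_antisym[OF f(2,3) gc]
    by (simp add: algebra_simps)
  have "ct p (\<lambda>v. h p * conn \<alpha> \<gamma> p v + k p * conn \<beta> \<gamma> p v) (\<delta> p) =
      h p * ct p (conn \<alpha> \<gamma> p) (\<delta> p) + k p * ct p (conn \<beta> \<gamma> p) (\<delta> p)"
    by (rule ct_comb_left[OF p d gc])
  then show "ct p (conn ?c \<gamma> p) (\<delta> p) = ct p (\<lambda>v. h p * conn \<alpha> \<gamma> p v + k p * conn \<beta> \<gamma> p v) (\<delta> p)"
    using k3 conn_props(2)[OF fc f(3) g]
    unfolding conn_props(2)[OF f(1,3) g, symmetric] conn_props(2)[OF f(2,3) g, symmetric] by (simp add: algebra_simps)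
qed

text \<open>By torsion-freeness the slots may be exchanged at the cost of a bracket, so the
  derivative terms are exactly those of \<open>br_comb_right\<close>.\<close>

lemma conn_comb_right:
  assumes f: "form_near p \<alpha>" "form_near p \<beta>" "form_near p \<gamma>" and s: "smooth_near M p h" "smooth_near M p k"
  shows "conn \<alpha> (\<lambda>q v. h q * \<beta> q v + k q * \<gamma> q v) p =
    (\<lambda>v. (h p * conn \<alpha> \<beta> p v + k p * conn \<alpha> \<gamma> p v) + (sp \<alpha> p h * \<beta> p v + sp \<alpha> p k * \<gamma> p v))"
  unfolding conn_torsion_free[OF f(1) form_near_comb[OF f(2,3) s]] conn_comb_left[OF f(2,3,1) s]
    br_comb_right[OF f s] conn_torsion_free[OF f(1,2)] conn_torsion_free[OF f(1,3)]
  by (simp add: algebra_simps)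

end

subsection \<open>Compatible pairs\<close>

locale compatible_pair = metric_bivector +
  assumes compatible: "contra_compatible M g \<pi>"
begin

text \<open>Compatibility for germs. Both sides depend only on the germs of the three forms at p, so
  these may be replaced by forms on all of M.\<close>

lemma conn_pi:
  assumes f: "form_near p \<alpha>" "form_near p \<beta>" "form_near p \<gamma>"
  shows "sp \<alpha> p (\<lambda>q. \<pi> q (\<beta> q) (\<gamma> q)) = \<pi> p (conn \<alpha> \<beta> p) (\<gamma> p) + \<pi> p (\<beta> p) (conn \<alpha> \<gamma> p)"
proof -
  have p: "p \<in> carrier M" using form_near_carrier[OF f(1)] .
  obtain \<alpha>' where a: "\<alpha>' \<in> one_forms M (carrier M)" "\<forall>\<^sub>F q in nhdsin (topo M) p. \<alpha> q = \<alpha>' q" using form_globalize[OF f(1)] .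
  obtain \<beta>' where b: "\<beta>' \<in> one_forms M (carrier M)" "\<forall>\<^sub>F q in nhdsin (topo M) p. \<beta> q = \<beta>' q" using form_globalize[OF f(2)] .
  obtain \<gamma>' where c: "\<gamma>' \<in> one_forms M (carrier M)" "\<forall>\<^sub>F q in nhdsin (topo M) p. \<gamma> q = \<gamma>' q" using form_globalize[OF f(3)] .
  have "sp \<alpha>' p (\<lambda>q. \<pi> q (\<beta>' q) (\<gamma>' q)) - \<pi> p (conn \<alpha>' \<beta>' p) (\<gamma>' p) - \<pi> p (\<beta>' p) (conn \<alpha>' \<gamma>' p) = 0"
    using compatible a(1) b(1) c(1) p unfolding contra_compatible_def by blast
  moreover have "sp \<alpha> p (\<lambda>q. \<pi> q (\<beta> q) (\<gamma> q)) = sp \<alpha> p (\<lambda>q. \<pi> q (\<beta>' q) (\<gamma>' q))"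
    by (rule tangent_cong[OF p sp_tangent[OF f(1)]], use b(2) c(2) in eventually_elim) simp
  moreover have "sp \<alpha> p = sp \<alpha>' p" using ev_here[OF p a(2)] by (rule sp_here)
  ultimately show ?thesis
    using conn_cong[OF f(1,2) a(2) b(2)] conn_cong[OF f(1,3) a(2) c(2)] ev_here[OF p b(2)] ev_here[OF p c(2)] by simp
qed

lemma pi_swap_ev:
  assumes f: "form_near p \<alpha>" "form_near p \<beta>" and v: "v \<in> tangent M p"
  shows "v (\<lambda>q. \<pi> q (\<alpha> q) (\<beta> q)) = - v (\<lambda>q. \<pi> q (\<beta> q) (\<alpha> q))"
proof -
  have "v (\<lambda>q. \<pi> q (\<alpha> q) (\<beta> q)) = v (\<lambda>q. - \<pi> q (\<beta> q) (\<alpha> q))"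
    by (rule tangent_cong[OF form_near_carrier[OF f(1)] v], use form_near_ev[OF f(1)] form_near_ev[OF f(2)] in eventually_elim)
      (rule pi_antisym[OF form_near_carrier form_near_cotangent form_near_cotangent])
  then show ?thesis using tangent_minus[OF v pi_smooth[OF f(2,1)]] by simp
qed

text \<open>The defect \<open>\<pi>([\<alpha>,\<beta>]\<^sub>\<pi>,\<gamma>) - \<gamma>([#\<alpha>,#\<beta>])\<close> equals the cyclic sum of \<open>#\<alpha>\<cdot>\<pi>(\<beta>,\<gamma>)\<close> minus that of
  \<open>\<gamma>([#\<alpha>,#\<beta>])\<close>, hence is invariant under cyclic permutations. Compatibility together with
  torsion-freeness turns the first cyclic sum into that of \<open>\<pi>([\<alpha>,\<beta>]\<^sub>\<pi>,\<gamma>)\<close>, so that the defect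
  is three times itself.\<close>

lemma sharp_br:
  assumes f: "form_near p \<alpha>" "form_near p \<beta>"
  shows "sp (br \<alpha> \<beta>) p = lie_bracket M (sp \<alpha>) (sp \<beta>) p"
proof (rule tangent_eqI)
  have p: "p \<in> carrier M" using form_near_carrier[OF f(1)] .
  show "sp (br \<alpha> \<beta>) p \<in> tangent M p" by (rule sp_tangent[OF br_form_near[OF f]])
  show "lie_bracket M (sp \<alpha>) (sp \<beta>) p \<in> tangent M p"
    by (rule vf_near_tangent[OF lie_bracket_vf_near[OF sp_vf_near[OF f(1)] sp_vf_near[OF f(2)]]])
  fix c assume "c \<in> cotangent M p"
  then obtain \<gamma> where g: "form_near p \<gamma>" "\<gamma> p = c" using cotangent_extend[OF p] by blast
  let ?L = "\<lambda>\<alpha> \<beta> \<gamma>. \<gamma> p (lie_bracket M (sp \<alpha>) (sp \<beta>) p)"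
  let ?P = "\<lambda>\<alpha> \<beta> \<gamma>. sp \<alpha> p (\<lambda>q. \<pi> q (\<beta> q) (\<gamma> q))"
  have defect: "\<pi> p (br \<alpha> \<beta> p) (\<gamma> p) = ?P \<alpha> \<beta> \<gamma> + ?P \<beta> \<gamma> \<alpha> + ?P \<gamma> \<alpha> \<beta> - ?L \<gamma> \<alpha> \<beta> - ?L \<beta> \<gamma> \<alpha>"
    if f: "form_near p \<alpha>" "form_near p \<beta>" "form_near p \<gamma>" for \<alpha> \<beta> \<gamma>
  proof -
    note c = form_near_cotangent[OF f(1)] form_near_cotangent[OF f(2)] form_near_cotangent[OF f(3)]
    have pair: "v (\<lambda>q. \<xi> q (sp \<gamma> q)) = - v (\<lambda>q. \<pi> q (\<xi> q) (\<gamma> q))" if x: "form_near p \<xi>" and v: "v \<in> tangent M p" for \<xi> v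
    proof -
      have "v (\<lambda>q. \<xi> q (sp \<gamma> q)) = v (\<lambda>q. \<pi> q (\<gamma> q) (\<xi> q))"
        by (rule tangent_cong[OF p v], use form_near_ev[OF x] form_near_ev[OF f(3)] in eventually_elim)
          (rule sp_apply[OF _ form_near_cotangent])
      then show ?thesis using pi_swap_ev[OF f(3) x v] by simp
    qed
    have lb: "\<beta> p (lie_bracket M (sp \<alpha>) (sp \<gamma>) p) = - ?L \<gamma> \<alpha> \<beta>"
      using cotangent_lincomb[OF c(2) vf_near_tangent[OF lie_bracket_vf_near[OF sp_vf_near[OF f(3)] sp_vf_near[OF f(1)]]] tangent_zero[OF p], of "-1" 0]
      by (subst lie_bracket_antisym) simp
    have "\<pi> p (br \<alpha> \<beta> p) (\<gamma> p) = - br \<alpha> \<beta> p (sp \<gamma> p)"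
      using sp_apply[OF f(3) br_cotangent[OF f(1,2)]] pi_antisym[OF p br_cotangent[OF f(1,2)] c(3)] by simp
    then show ?thesis
      using br_apply[OF f(1,2) sp_vf_near[OF f(3)]] pair[OF f(2) sp_tangent[OF f(1)]] pair[OF f(1) sp_tangent[OF f(2)]]
        lb pi_swap_ev[OF f(1,3) sp_tangent[OF f(2)]] by simp
  qed
  have tors: "\<pi> p (conn \<alpha> \<beta> p) (\<gamma> p) + \<pi> p (\<gamma> p) (conn \<beta> \<alpha> p) = \<pi> p (br \<alpha> \<beta> p) (\<gamma> p)"
    if f: "form_near p \<alpha>" "form_near p \<beta>" "form_near p \<gamma>" for \<alpha> \<beta> \<gamma>
    unfolding conn_torsion_free[OF f(1,2)]
    using pi_comb_left[OF p form_near_cotangent[OF f(3)] conn_props(1)[OF f(2,1)] br_cotangent[OF f(1,2)], of 1 1]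
      pi_antisym[OF p conn_props(1)[OF f(2,1)] form_near_cotangent[OF f(3)]] by simp
  have cyc: "?P \<alpha> \<beta> \<gamma> + ?P \<beta> \<gamma> \<alpha> + ?P \<gamma> \<alpha> \<beta> =
      \<pi> p (br \<alpha> \<beta> p) (\<gamma> p) + \<pi> p (br \<beta> \<gamma> p) (\<alpha> p) + \<pi> p (br \<gamma> \<alpha> p) (\<beta> p)"
    using conn_pi[OF f g(1)] conn_pi[OF f(2) g(1) f(1)] conn_pi[OF g(1) f]
      tors[OF f g(1)] tors[OF f(2) g(1) f(1)] tors[OF g(1) f] by linarith
  have "\<pi> p (br \<alpha> \<beta> p) (\<gamma> p) = ?L \<alpha> \<beta> \<gamma>"
    using cyc defect[OF f g(1)] defect[OF f(2) g(1) f(1)] defect[OF g(1) f] by linarith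
  then show "c (sp (br \<alpha> \<beta>) p) = c (lie_bracket M (sp \<alpha>) (sp \<beta>) p)"
    using sp_apply[OF br_form_near[OF f] form_near_cotangent[OF g(1)]] g(2) by simp
qed

lemma sp_conn_apply:
  assumes f: "form_near p \<alpha>" "form_near p \<beta>" "form_near p \<gamma>"
  shows "\<gamma> p (sp (conn \<alpha> \<beta>) p) = sp \<alpha> p (\<lambda>q. \<gamma> q (sp \<beta> q)) - conn \<alpha> \<gamma> p (sp \<beta> p)"
proof -
  have p: "p \<in> carrier M" using form_near_carrier[OF f(1)] .
  have "sp \<alpha> p (\<lambda>q. \<gamma> q (sp \<beta> q)) = sp \<alpha> p (\<lambda>q. \<pi> q (\<beta> q) (\<gamma> q))"
    by (rule tangent_cong[OF p sp_tangent[OF f(1)]], use form_near_ev[OF f(2)] form_near_ev[OF f(3)] in eventually_elim)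
      (rule sp_apply[OF _ form_near_cotangent])
  then show ?thesis
    using conn_pi[OF f] sp_apply[OF conn_form_near[OF f(1,2)] form_near_cotangent[OF f(3)]]
      sp_apply[OF f(2) conn_props(1)[OF f(1,3)]] by simp
qed

lemma sp_conn_torsion:
  assumes f: "form_near p \<alpha>" "form_near p \<beta>"
  shows "sp (conn \<alpha> \<beta>) p = (\<lambda>h. sp (conn \<beta> \<alpha>) p h + lie_bracket M (sp \<alpha>) (sp \<beta>) p h)"
proof -
  have p: "p \<in> carrier M" using form_near_carrier[OF f(1)] .
  have "sp (conn \<alpha> \<beta>) p = (\<lambda>h. 1 * sp (conn \<beta> \<alpha>) p h + 1 * sp (br \<alpha> \<beta>) p h)"
    using sharp_biv_comb[OF p conn_props(1)[OF f(2,1)] br_cotangent[OF f], of 1 1]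
    unfolding sharp_form_def conn_torsion_free[OF f] .
  then show ?thesis using sharp_br[OF f] by simp
qed

text \<open>Let \<open>ct (J \<beta>) = \<pi> \<beta>\<close>, i.e. \<open>J \<beta> = flat (sp \<beta>)\<close>. Since \<open>D\<close> preserves both \<open>ct\<close> and \<open>\<pi>\<close>, it
  commutes with \<open>J\<close>, and \<open>g(#\<beta>, #\<gamma>) = ct (J \<beta>) (J \<gamma>)\<close>.\<close>

lemma sp_conn_metric:
  assumes f: "form_near p \<alpha>" "form_near p \<beta>" "form_near p \<gamma>"
  shows "sp \<alpha> p (\<lambda>q. g q (sp \<beta> q) (sp \<gamma> q)) =
    g p (sp (conn \<alpha> \<beta>) p) (sp \<gamma> p) + g p (sp \<beta> p) (sp (conn \<alpha> \<gamma>) p)"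
proof -
  have p: "p \<in> carrier M" using form_near_carrier[OF f(1)] .
  let ?J = "\<lambda>\<beta> q. flat q (sp \<beta> q)"
  have J: "form_near p (?J \<beta>)" if "form_near p \<beta>" for \<beta>
    by (rule flat_form_near[OF sp_vf_near[OF that]])
  have ctJ: "ct q (?J \<beta> q) c = c (sp \<beta> q)" if "form_near q \<beta>" "c \<in> cotangent M q" for \<beta> c q
    by (rule ct_flat(1)[OF form_near_carrier[OF that(1)] sp_tangent[OF that(1)] that(2)])
  have DJ: "ct p (conn \<alpha> (?J \<beta>) p) (?J \<gamma> p) = g p (sp \<gamma> p) (sp (conn \<alpha> \<beta>) p)"
    if b: "form_near p \<beta>" and c: "form_near p \<gamma>" for \<beta> \<gamma>
  proof -
    have "sp \<alpha> p (\<lambda>q. ct q (?J \<beta> q) (?J \<gamma> q)) = sp \<alpha> p (\<lambda>q. \<pi> q (\<beta> q) (?J \<gamma> q))"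
    proof (rule tangent_cong[OF p sp_tangent[OF f(1)]], use form_near_ev[OF b] form_near_ev[OF J[OF c]] in eventually_elim)
      case (elim q)
      show ?case using ctJ[OF elim(1) form_near_cotangent[OF elim(2)]] sp_apply[OF elim(1) form_near_cotangent[OF elim(2)]] by simp
    qed
    \<comment> \<open>The term with \<open>conn \<alpha> (?J \<gamma>)\<close> is thus common to
      metricity and compatibility. Subtracting it leaves the commutation of the connection with J,
      paired with J \<gamma>.\<close>
    moreover have "ct p (?J \<beta> p) (conn \<alpha> (?J \<gamma>) p) = \<pi> p (\<beta> p) (conn \<alpha> (?J \<gamma>) p)"
      using ctJ[OF b conn_props(1)[OF f(1) J[OF c]]] sp_apply[OF b conn_props(1)[OF f(1) J[OF c]]] by simp
    ultimately have "ct p (conn \<alpha> (?J \<beta>) p) (?J \<gamma> p) = \<pi> p (conn \<alpha> \<beta> p) (?J \<gamma> p)"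
      using conn_metric[OF f(1) J[OF b] J[OF c]] conn_pi[OF f(1) b J[OF c]] by simp
    also have "\<dots> = flat p (sp \<gamma> p) (sp (conn \<alpha> \<beta>) p)"
      using sp_apply[OF conn_form_near[OF f(1) b] form_near_cotangent[OF J[OF c]]] by simp
    also have "\<dots> = g p (sp \<gamma> p) (sp (conn \<alpha> \<beta>) p)"
      by (rule flat_apply[OF sp_tangent[OF conn_form_near[OF f(1) b]]])
    finally show ?thesis .
  qed
  have 1: "sp \<alpha> p (\<lambda>q. g q (sp \<beta> q) (sp \<gamma> q)) = sp \<alpha> p (\<lambda>q. ct q (?J \<gamma> q) (?J \<beta> q))"
  proof (rule tangent_cong[OF p sp_tangent[OF f(1)]], use form_near_ev[OF f(3)] form_near_ev[OF J[OF f(2)]] in eventually_elim)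
    case (elim q)
    show ?case using ctJ[OF elim(1) form_near_cotangent[OF elim(2)]] flat_apply[OF sp_tangent[OF elim(1)]] by simp
  qed
  note 2 = conn_metric[OF f(1) J[OF f(3)] J[OF f(2)]]
  note 3 = ct_sym[OF p form_near_cotangent[OF J[OF f(3)]] conn_props(1)[OF f(1) J[OF f(2)]]]
  note 4 = g_sym[OF p sp_tangent[OF f(3)] sp_tangent[OF conn_form_near[OF f(1,2)]]]
  show ?thesis unfolding 1 2 3 DJ[OF f(2,3)] DJ[OF f(3,2)] 4 by (rule add.commute)
qed


lemma sharp_biv_sum:
  assumes p: "p \<in> carrier M"
  shows "(\<And>i. i \<in> I \<Longrightarrow> a i \<in> cotangent M p) \<Longrightarrow>
    sharp_biv M \<pi> p (\<lambda>v. \<Sum>i\<in>I. k i * a i v) = (\<lambda>f. \<Sum>i\<in>I. k i * sharp_biv M \<pi> p (a i) f)"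
proof (induction I rule: infinite_finite_induct)
  case (insert i I)
  then show ?case
    using sharp_biv_comb[OF p, of "a i" "\<lambda>v. \<Sum>i\<in>I. k i * a i v" "k i" 1] cotangent_sum_comb[of I a p k] by simp
qed (use sharp_biv_comb[OF p cotangent_zero cotangent_zero, of 0 0] in simp_all)

end

section \<open>Immersed submanifolds\<close>

locale immersion = manifold M + S: manifold S for M S :: "('a, 'e::euclidean_space) mfd" +
  assumes immersed: "immersed_submanifold M S"
begin

abbreviation "inc \<equiv> incl_deriv M"

lemma sub_carrier: "x \<in> carrier S \<Longrightarrow> x \<in> carrier M"
  using immersed unfolding immersed_submanifold_def by blast

lemma inc_inj: "x \<in> carrier S \<Longrightarrow> inj_on (inc x) (tangent S x)"
  using immersed unfolding immersed_submanifold_def by blast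

lemma sub_open: "openin (topo M) U \<Longrightarrow> openin (topo S) {y \<in> carrier S. y \<in> U}"
proof -
  assume U: "openin (topo M) U"
  have "continuous_map (topo S) (topo M) (\<lambda>x. x)"
    using immersed unfolding immersed_submanifold_def by (elim conjE)
  from openin_continuous_map_preimage[OF this U]
  show "openin (topo S) {y \<in> carrier S. y \<in> U}" .
qed

lemma sub_ev:
  assumes x: "x \<in> carrier S" and ev: "eventually P (nhdsin (topo M) x)"
  shows "eventually P (nhdsin (topo S) x)"
proof -
  obtain U where U: "openin (topo M) U" "x \<in> U" "\<forall>q\<in>U. P q"
    using ev ev_nhdsin[OF sub_carrier[OF x]] by blast
  then show ?thesis using x by (intro S.ev_nhdsinI[OF sub_open[OF U(1)]]) auto
qed

text \<open>Smoothness of the inclusion is given only on the part of the chart of S that lies in E.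
  Continuity of the inclusion makes this part open in S, so N can be shrunk until it contains no
  other points of D.\<close>

lemma chart_comparison:
  assumes c: "(D, \<phi>) \<in> atlas S" "x \<in> D" and d: "(E, \<psi>) \<in> atlas M" "x \<in> E"
  obtains N G where "Cinf N G" "\<phi> x \<in> N" "\<And>q. q \<in> D \<Longrightarrow> \<phi> q \<in> N \<Longrightarrow> q \<in> E \<and> \<psi> q = G (\<phi> q)"
proof -
  have "\<forall>(D, \<phi>)\<in>atlas S. \<forall>(E, \<psi>)\<in>atlas M. smooth_on (\<phi> ` (D \<inter> E)) (\<psi> \<circ> inv_into D \<phi>)"
    using immersed unfolding immersed_submanifold_def by (elim conjE)
  then have "smooth_on (\<phi> ` (D \<inter> E)) (\<psi> \<circ> inv_into D \<phi>)" using c(1) d(1) by auto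
  then obtain N G where G: "Cinf N G" "\<phi> x \<in> N" "\<forall>y\<in>N \<inter> \<phi> ` (D \<inter> E). G y = (\<psi> \<circ> inv_into D \<phi>) y"
    unfolding smooth_on_iff_Cinf using c(2) d(2) by blast
  obtain N' where N': "open N'" "\<And>q. q \<in> D \<Longrightarrow> \<phi> q \<in> N' \<Longrightarrow> q \<in> {y \<in> carrier S. y \<in> E}"
    "\<phi> ` ({y \<in> carrier S. y \<in> E} \<inter> D) = model S \<inter> N'"
    using S.chart_image_open[OF c(1) sub_open[OF chart_props(1)[OF d(1)]]] by blast
  have x: "x \<in> carrier S" using S.chart_subset[OF c(1)] c(2) by blast
  show thesis
  proof (rule that[of "N \<inter> N'" G])
    show "Cinf (N \<inter> N') G" using G(1) N'(1) Cinf_open by (intro Cinf_subset[OF G(1)]) auto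
    show "\<phi> x \<in> N \<inter> N'" using G(2) N'(3) x c(2) d(2) by blast
    fix q assume q: "q \<in> D" "\<phi> q \<in> N \<inter> N'"
    then have "q \<in> E" using N'(2) by blast
    then show "q \<in> E \<and> \<psi> q = G (\<phi> q)" using G(3) q S.chart_inv[OF c(1)] by auto
  qed
qed

lemma smooth_near_restrict:
  assumes x: "x \<in> carrier S" and f: "smooth_near M x f"
  shows "smooth_near S x f"
proof -
  obtain D \<phi> where c: "(D, \<phi>) \<in> atlas S" "x \<in> D" using S.chart_exists[OF x] .
  obtain E \<psi> where d: "(E, \<psi>) \<in> atlas M" "x \<in> E" using chart_exists[OF sub_carrier[OF x]] .
  obtain N F where F: "Cinf N F" "\<psi> x \<in> N" "\<forall>q\<in>E. \<psi> q \<in> N \<longrightarrow> f q = F (\<psi> q)"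
    using f smooth_near_chart[OF d] by blast
  obtain N' G where G: "Cinf N' G" "\<phi> x \<in> N'" "\<And>q. q \<in> D \<Longrightarrow> \<phi> q \<in> N' \<Longrightarrow> q \<in> E \<and> \<psi> q = G (\<phi> q)"
    using chart_comparison[OF c d] by blast
  have o: "open (N' \<inter> G -` N)" by (rule Cinf_open_vimage[OF G(1) Cinf_open[OF F(1)]])
  have "Cinf (N' \<inter> G -` N) (\<lambda>z. F (G z))"
    by (rule Cinf_compose[OF Cinf_subset[OF G(1) o] F(1)]) auto
  moreover have "\<phi> x \<in> N' \<inter> G -` N" using G(2) G(3)[OF c(2) G(2)] F(2) by auto
  moreover have "f q = F (G (\<phi> q))" if "q \<in> D" "\<phi> q \<in> N' \<inter> G -` N" for q
    using that G(3)[of q] F(3) by auto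
  ultimately show ?thesis unfolding S.smooth_near_chart[OF c]
    by (intro exI[of _ "N' \<inter> G -` N"] exI[of _ "\<lambda>z. F (G z)"]) blast
qed

lemma inc_apply: "smooth_near M x f \<Longrightarrow> inc x v f = v f"
  by (simp add: incl_deriv_def)

lemma inc_comb: "inc x (\<lambda>f. a * v f + b * w f) = (\<lambda>f. a * inc x v f + b * inc x w f)"
  by (auto simp: incl_deriv_def)

lemma inc_tangent:
  assumes x: "x \<in> carrier S" and v: "v \<in> tangent S x" shows "inc x v \<in> tangent M x"
proof -
  have "v (\<lambda>q. c * f q + d * h q) = c * v f + d * v h \<and> v (\<lambda>q. f q * h q) = f x * v h + h x * v f"
    if "smooth_near M x f" "smooth_near M x h" for f h c d
    using S.tangent_lincomb[OF v] S.tangent_mult[OF v] smooth_near_restrict[OF x] that by blast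
  then show ?thesis
    unfolding tangent_def incl_deriv_def by (simp add: smooth_near_lincomb smooth_near_mult)
qed

lemma inc_zero: "inc x (\<lambda>f. 0) = (\<lambda>f. 0)"
  by (auto simp: incl_deriv_def)

text \<open>Immersions are locally embeddings: a left inverse \<open>T\<close> of the differential makes
  \<open>T \<circ> \<psi>\<close> a coordinate system on \<open>S\<close> around \<open>x\<close>, for \<open>\<psi>\<close> a chart of \<open>M\<close>.
  The summand \<open>z - model_proj z\<close> extends the coordinate change to an open set.\<close>

lemma smooth_near_extend:
  assumes x: "x \<in> carrier S" and h: "smooth_near S x h"
  obtains H where "smooth_near M x H" "\<forall>\<^sub>F y in nhdsin (topo S) x. H y = h y"
proof -
  obtain D \<phi> where c: "(D, \<phi>) \<in> atlas S" "x \<in> D" using S.chart_exists[OF x] .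
  obtain E \<psi> where d: "(E, \<psi>) \<in> atlas M" "x \<in> E" using chart_exists[OF sub_carrier[OF x]] .
  obtain N G where G: "Cinf N G" "\<phi> x \<in> N" "\<And>q. q \<in> D \<Longrightarrow> \<phi> q \<in> N \<Longrightarrow> q \<in> E \<and> \<psi> q = G (\<phi> q)"
    using chart_comparison[OF c d] by blast
  let ?P = "S.model_proj" and ?L = "frechet_derivative G (at (\<phi> x))"
  have dG: "(G has_derivative ?L) (at (\<phi> x))" using Cinf_has_derivative[OF G(1,2)] .
  have linL: "linear ?L" using has_derivative_linear[OF dG] .
  have "w = 0" if w: "w \<in> model S" "?L w = 0" for w
  proof -
    \<comment> \<open>Immersivity is given for derivations. A vector w of the model in the kernel of
      the Jacobian becomes the tangent vector with components w. Its image in M kills all coordinate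
      functions, hence is 0 by \<open>tangent_expand\<close>; so v = 0, and its components
      vanish.\<close>
    define v where "v = (\<lambda>f. \<Sum>b\<in>S.model_basis. (w \<bullet> b) * S.coord_deriv D \<phi> b x f)"
    have v: "v \<in> tangent S x"
      unfolding v_def by (rule S.tangent_sum_comb[OF x S.coord_deriv_tangent[OF c]])
    have wsum: "(\<Sum>b\<in>S.model_basis. (w \<bullet> b) *\<^sub>R b) = w"
      using S.model_proj_id[OF w(1)] by (simp add: S.model_proj_def)
    have "v (\<lambda>q. \<psi> q \<bullet> c') = 0" for c'
    proof -
      have "S.coord_deriv D \<phi> b x (\<lambda>q. \<psi> q \<bullet> c') = ?L b \<bullet> c'" if b: "b \<in> S.model_basis" for b
      proof -
        have "S.coord_deriv D \<phi> b x (\<lambda>q. \<psi> q \<bullet> c') = frechet_derivative (\<lambda>z. G z \<bullet> c') (at (\<phi> x)) b"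
          by (rule S.coord_deriv_eq[OF c b Cinf_inner[OF G(1) Cinf_const[OF Cinf_open[OF G(1)]]] G(2)])
            (use G(3) in auto)
        moreover have "((\<lambda>z. G z \<bullet> c') has_derivative (\<lambda>u. ?L u \<bullet> c')) (at (\<phi> x))"
          by (rule has_derivative_inner_left[OF dG])
        ultimately show ?thesis by (simp add: frechet_derivative_at[symmetric])
      qed
      then have "v (\<lambda>q. \<psi> q \<bullet> c') = (\<Sum>b\<in>S.model_basis. (w \<bullet> b) *\<^sub>R ?L b) \<bullet> c'"
        by (simp add: v_def inner_sum_left)
      also have "(\<Sum>b\<in>S.model_basis. (w \<bullet> b) *\<^sub>R ?L b) = ?L w"
        by (subst wsum[symmetric]) (simp add: linear_sum[OF linL] linear_cmul[OF linL])
      finally show ?thesis using w(2) by simp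
    qed
    then have "inc x v (\<lambda>q. \<psi> q \<bullet> c') = 0" for c'
      by (simp add: incl_deriv_def)
    then have "inc x v f = 0" for f
      using tangent_expand[OF d inc_tangent[OF x v], of f] by simp
    then have "inc x v = inc x (\<lambda>f. 0)"
      by (simp add: inc_zero fun_eq_iff)
    then have v0: "v = (\<lambda>f. 0)"
      by (rule inj_onD[OF inc_inj[OF x] _ v S.tangent_zero[OF x]])
    have "w \<bullet> b = 0" if b: "b \<in> S.model_basis" for b
    proof -
      have "v (\<lambda>r. \<phi> r \<bullet> b) = (\<Sum>b'\<in>S.model_basis. if b' = b then w \<bullet> b' else 0)"
        unfolding v_def using S.coord_deriv_coord[OF c _ b] by (intro sum.cong) auto
      then show ?thesis using v0 b S.model_basis(2) by simp
    qed
    then show "w = 0" using wsum by simp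
  qed
  then have injL: "inj_on ?L (model S)"
    using linear_injective_on_subspace_0[OF linL S.subspace_model] by blast
  obtain T where T: "range T \<subseteq> model S" "linear T" "\<forall>v\<in>model S. T (?L v) = v"
    using linear_exists_left_inverse_on[OF linL S.subspace_model injL] by blast
  have Px: "?P (\<phi> x) = \<phi> x" using S.model_proj_id[OF S.chart_model[OF c]] .
  have CP: "Cinf UNIV ?P" by (rule Cinf_linear[OF S.linear_model_proj]) simp
  have o: "open (?P -` N)" using Cinf_open_vimage[OF CP Cinf_open[OF G(1)]] by simp
  define \<Phi> where "\<Phi> z = T (G (?P z)) + (z + (-1) *\<^sub>R ?P z)" for z
  have "Cinf (?P -` N) (\<lambda>z. G (?P z))"
    by (rule Cinf_compose[OF Cinf_subset[OF CP o] G(1)]) auto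
  then have "Cinf (?P -` N) (\<lambda>z. T (G (?P z)))"
    by (rule Cinf_compose[OF _ Cinf_linear[OF T(2) open_UNIV]]) simp
  then have C\<Phi>: "Cinf (?P -` N) \<Phi>"
    unfolding \<Phi>_def
    by (intro Cinf_add Cinf_scaleR Cinf_const Cinf_subset[OF CP] Cinf_linear[OF bounded_linear.linear[OF bounded_linear_ident]] o) auto
  have xN: "\<phi> x \<in> ?P -` N" using Px G(2) by simp
  have "(?P has_derivative ?P) (at (\<phi> x))"
    using S.linear_model_proj by (simp add: bounded_linear_imp_has_derivative linear_conv_bounded_linear)
  moreover have "(T has_derivative T) (at y)" for y
    using T(2) by (simp add: bounded_linear_imp_has_derivative linear_conv_bounded_linear)
  moreover have "(G has_derivative ?L) (at (?P (\<phi> x)))" using dG Px by simp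
  ultimately have "((\<lambda>z. T (G (?P z))) has_derivative (\<lambda>v. T (?L (?P v)))) (at (\<phi> x))"
    using has_derivative_compose[of ?P ?P "\<phi> x" UNIV G ?L] has_derivative_compose[of "\<lambda>z. G (?P z)" "\<lambda>v. ?L (?P v)" "\<phi> x" UNIV T T]
    by blast
  then have "(\<Phi> has_derivative (\<lambda>v. T (?L (?P v)) + (v + (-1) *\<^sub>R ?P v))) (at (\<phi> x))"
    unfolding \<Phi>_def using \<open>(?P has_derivative ?P) (at (\<phi> x))\<close>
    by (intro has_derivative_add has_derivative_scaleR_right has_derivative_ident)
  \<comment> \<open>T inverts ?L on \<open>model S\<close>, where all the vectors ?P v lie. The
    first summand is therefore ?P v, and the derivative of \<open>\<Phi>\<close> at
    \<open>\<phi> x\<close> is the identity.\<close>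
  moreover have "(\<lambda>v. T (?L (?P v)) + (v + (-1) *\<^sub>R ?P v)) = (\<lambda>v. v)"
    using T(3) S.model_proj_in by auto
  ultimately have "frechet_derivative \<Phi> (at (\<phi> x)) = (\<lambda>v. v)"
    by (metis frechet_derivative_at)
  then have "inj (frechet_derivative \<Phi> (at (\<phi> x)))" by (simp add: inj_on_def)
  then obtain N' V \<Psi> where \<Psi>: "open N'" "N' \<subseteq> ?P -` N" "\<phi> x \<in> N'" "\<Phi> (\<phi> x) \<in> V" "Cinf V \<Psi>"
    "\<And>z. z \<in> N' \<Longrightarrow> \<Phi> z \<in> V \<and> \<Psi> (\<Phi> z) = z"
    using Cinf_inverse_function[OF C\<Phi> xN] by blast
  have \<Phi>\<phi>: "T (\<psi> q) = \<Phi> (\<phi> q)" if "q \<in> D" "\<phi> q \<in> N'" for q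
  proof -
    have "?P (\<phi> q) = \<phi> q" using S.model_proj_id[OF S.chart_model[OF c(1) that(1)]] .
    moreover have "\<phi> q \<in> N" using \<Psi>(2) that(2) calculation by auto
    ultimately show ?thesis using G(3)[OF that(1)] by (simp add: \<Phi>_def)
  qed
  obtain Nh hh where hh: "Cinf Nh hh" "\<phi> x \<in> Nh" "\<forall>q\<in>D. \<phi> q \<in> Nh \<longrightarrow> h q = hh (\<phi> q)"
    using h S.smooth_near_chart[OF c] by blast
  let ?W = "T -` (V \<inter> \<Psi> -` Nh)"
  have CT: "Cinf UNIV T" by (rule Cinf_linear[OF T(2)]) simp
  have oV: "open (V \<inter> \<Psi> -` Nh)" by (rule Cinf_open_vimage[OF \<Psi>(5) Cinf_open[OF hh(1)]])
  have oW: "open ?W" using Cinf_open_vimage[OF CT oV] by simp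
  have "Cinf (V \<inter> \<Psi> -` Nh) (\<lambda>y. hh (\<Psi> y))"
    by (rule Cinf_compose[OF Cinf_subset[OF \<Psi>(5) oV] hh(1)]) auto
  then have CH: "Cinf ?W (\<lambda>z. hh (\<Psi> (T z)))"
    by (rule Cinf_compose[OF Cinf_subset[OF CT oW subset_UNIV]]) auto
  \<comment> \<open>On S near x, T (\<psi> q) is \<Phi> (\<phi> q), from which \<Psi> recovers
    \<phi> q; there H reads h in the chart of S.\<close>
  define H where "H q = hh (\<Psi> (T (\<psi> q)))" for q
  show thesis
  proof (rule that)
    show "smooth_near M x H" unfolding smooth_near_chart[OF d]
    proof (intro exI conjI)
      show "Cinf ?W (\<lambda>z. hh (\<Psi> (T z)))" by (rule CH)
      show "\<psi> x \<in> ?W" using \<Phi>\<phi>[OF c(2) \<Psi>(3)] \<Psi>(6)[OF \<Psi>(3)] hh(2) by simp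
    qed (simp add: H_def)
    show "\<forall>\<^sub>F y in nhdsin (topo S) x. H y = h y"
    proof (rule S.ev_nhdsinI[OF S.chart_preimage_open[OF c(1)]])
      show "open (N' \<inter> Nh)" using \<Psi>(1) Cinf_open[OF hh(1)] by blast
      show "x \<in> {q \<in> D. \<phi> q \<in> N' \<inter> Nh}" using c(2) \<Psi>(3) hh(2) by simp
      fix q assume "q \<in> {q \<in> D. \<phi> q \<in> N' \<inter> Nh}"
      then show "H q = h q" using \<Phi>\<phi>[of q] \<Psi>(6)[of "\<phi> q"] hh(3) by (simp add: H_def)
    qed
  qed
qed

text \<open>The passage between S and M: a derivative along S of a function on S is computed on any
  local extension to M.\<close>

lemma tangent_sub_eq:
  assumes x: "x \<in> carrier S" and v: "v \<in> tangent S x" and H: "smooth_near M x H"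
    and e: "\<forall>\<^sub>F y in nhdsin (topo S) x. H y = h y"
  shows "inc x v H = v h"
  using S.tangent_cong[OF x v e] inc_apply[OF H] by simp

end

section \<open>The leaf connection\<close>

locale integral_leaf = compatible_pair M g \<pi> + immersion M S
  for M S :: "('a, 'e::euclidean_space) mfd" and g \<pi> +
  assumes tangent_leaf: "\<And>x. x \<in> carrier S \<Longrightarrow> inc x ` tangent S x = sharp_biv M \<pi> x ` cotangent M x"
begin

text \<open>#\<alpha> regarded as a vector field on the leaf. The preimage picked by
  \<open>inv_into\<close> is unique, as the inclusion is an immersion.\<close>

definition res :: "('a \<Rightarrow> 'a covec) \<Rightarrow> 'a \<Rightarrow> 'a tvec" where
  "res \<alpha> y = inv_into (tangent S y) (inc y) (sp \<alpha> y)"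

lemma res_props:
  assumes x: "x \<in> carrier S" and \<alpha>: "form_near x \<alpha>"
  shows "res \<alpha> x \<in> tangent S x" "inc x (res \<alpha> x) = sp \<alpha> x"
proof -
  have "sp \<alpha> x \<in> inc x ` tangent S x"
    using tangent_leaf[OF x] form_near_cotangent[OF \<alpha>] by (auto simp: sharp_form_def)
  then show "res \<alpha> x \<in> tangent S x" "inc x (res \<alpha> x) = sp \<alpha> x"
    unfolding res_def by (rule inv_into_into, rule f_inv_into_f)
qed

text \<open>To differentiate f on S, extend it to F on M. There #\<alpha> F is smooth, and its
  restriction to S is the derivative of f along \<open>res \<alpha>\<close>.\<close>

lemma res_vf_near:
  assumes x: "x \<in> carrier S" and \<alpha>: "form_near x \<alpha>"
  shows "S.vf_near x (res \<alpha>)"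
proof (rule S.vf_nearI_ev[OF x])
  note ev = S.ev_carrier[OF x] sub_ev[OF x form_near_ev[OF \<alpha>]]
  show "\<forall>\<^sub>F y in nhdsin (topo S) x. res \<alpha> y \<in> tangent S y"
    using ev by eventually_elim (rule res_props)
  show "\<forall>\<^sub>F y in nhdsin (topo S) x. \<forall>f. smooth_near S y f \<longrightarrow> smooth_near S y (\<lambda>r. res \<alpha> r f)"
    using ev
  proof (eventually_elim, intro allI impI)
    fix y f assume y: "y \<in> carrier S" and \<alpha>: "form_near y \<alpha>" and f: "smooth_near S y f"
    obtain F where F: "smooth_near M y F" "\<forall>\<^sub>F r in nhdsin (topo S) y. F r = f r"
      using smooth_near_extend[OF y f] .
    show "smooth_near S y (\<lambda>r. res \<alpha> r f)"
    proof (rule S.smooth_near_cong[OF smooth_near_restrict[OF y vf_near_smooth[OF sp_vf_near[OF \<alpha>] F(1)]]],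
        use S.ev_carrier[OF y] sub_ev[OF y form_near_ev[OF \<alpha>]] sub_ev[OF y smooth_near_ev[OF F(1)]] S.ev_ev[OF y F(2)] in eventually_elim)
      case (elim r)
      show ?case
        using tangent_sub_eq[OF elim(1) res_props(1)[OF elim(1,2)] elim(3,4)] res_props(2)[OF elim(1,2)] by simp
    qed
  qed
qed

section \<open>Lifts of vector fields on the leaf to 1-forms\<close>

definition lift_near :: "('a \<Rightarrow> 'a tvec) \<Rightarrow> 'a \<Rightarrow> ('a \<Rightarrow> 'a covec) \<Rightarrow> bool" where
  "lift_near X x \<alpha> \<longleftrightarrow> form_near x \<alpha> \<and> (\<forall>\<^sub>F y in nhdsin (topo S) x. sp \<alpha> y = inc y (X y))"

text \<open>The domain of the form is open in M and the region of equality is open in S. The latter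
  can be shrunk into the former because the inclusion is continuous.\<close>

lemma local_lift_iff:
  assumes x: "x \<in> carrier S"
  shows "local_lift M \<pi> S X x \<alpha> \<longleftrightarrow> lift_near X x \<alpha>"
proof
  assume "local_lift M \<pi> S X x \<alpha>"
  then obtain U W where UW: "openin (topo M) U" "\<alpha> \<in> one_forms M U" "openin (topo S) W" "x \<in> W" "W \<subseteq> U"
    "\<forall>y\<in>W. sp \<alpha> y = inc y (X y)"
    unfolding local_lift_def by blast
  have "form_near x \<alpha>" by (rule form_nearI[OF UW(2,1)]) (use UW in blast)
  moreover have "\<forall>\<^sub>F y in nhdsin (topo S) x. sp \<alpha> y = inc y (X y)"
    by (rule S.ev_nhdsinI[OF UW(3,4)]) (use UW(6) in blast)
  ultimately show "lift_near X x \<alpha>" by (simp add: lift_near_def)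
next
  assume l: "lift_near X x \<alpha>"
  then obtain U where U: "openin (topo M) U" "x \<in> U" "\<alpha> \<in> one_forms M U"
    unfolding lift_near_def by (auto elim: form_nearE)
  obtain W where W: "openin (topo S) W" "x \<in> W" "\<forall>y\<in>W. sp \<alpha> y = inc y (X y)"
    using l S.ev_nhdsin[OF x] unfolding lift_near_def by blast
  show "local_lift M \<pi> S X x \<alpha>"
    unfolding local_lift_def
  proof (intro exI conjI)
    show "openin (topo S) (W \<inter> {y \<in> carrier S. y \<in> U})" using W(1) sub_open[OF U(1)] by blast
  qed (use U W x in auto)
qed

lemma lift_near_form: "lift_near X x \<alpha> \<Longrightarrow> form_near x \<alpha>"
  by (simp add: lift_near_def)

lemma lift_near_here: "x \<in> carrier S \<Longrightarrow> lift_near X x \<alpha> \<Longrightarrow> sp \<alpha> x = inc x (X x)"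
  unfolding lift_near_def using S.ev_here by blast

lemma lift_near_ev:
  assumes x: "x \<in> carrier S" and l: "lift_near X x \<alpha>"
  shows "\<forall>\<^sub>F y in nhdsin (topo S) x. lift_near X y \<alpha>"
proof -
  have "form_near x \<alpha>" "\<forall>\<^sub>F y in nhdsin (topo S) x. sp \<alpha> y = inc y (X y)"
    using l by (simp_all add: lift_near_def)
  from sub_ev[OF x form_near_ev[OF this(1)]] S.ev_ev[OF x this(2)]
  show ?thesis by eventually_elim (simp add: lift_near_def)
qed

text \<open>The rank of \<pi> may jump off S, so the problem is solved on S. Covectors over the
  frame vectors at x, extended to forms, give fields \<open>res (\<alpha> b)\<close> on S that agree
  with the frame at x. Near x, X is a combination of them with coefficients smooth on S; these
  coefficients extend to M and become those of the lift.\<close>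

lemma lift_exists:
  assumes x: "x \<in> carrier S" and X: "S.vf_near x X"
  obtains \<alpha> where "lift_near X x \<alpha>"
proof -
  have xM: "x \<in> carrier M" using sub_carrier[OF x] .
  obtain U B E y where f: "S.coord_frame U B E y" "x \<in> U" using S.coord_frame_exists[OF x] .
  note fr = S.coord_frameD[OF f]
  have "\<exists>\<alpha>. form_near x \<alpha> \<and> sp \<alpha> x = inc x (E b x)" if b: "b \<in> B" for b
  proof -
    have "inc x (E b x) \<in> sharp_biv M \<pi> x ` cotangent M x"
      using tangent_leaf[OF x] fr(8)[OF b] by blast
    then obtain a where a: "a \<in> cotangent M x" "inc x (E b x) = sharp_biv M \<pi> x a" by blast
    obtain \<alpha> where "form_near x \<alpha>" "\<alpha> x = a" using cotangent_extend[OF xM a(1)] .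
    then show ?thesis using a by (auto simp: sharp_form_def)
  qed
  then obtain \<alpha> where \<alpha>: "\<And>b. b \<in> B \<Longrightarrow> form_near x (\<alpha> b)" "\<And>b. b \<in> B \<Longrightarrow> sp (\<alpha> b) x = inc x (E b x)"
    by metis
  have rx: "res (\<alpha> b) x = E b x" if b: "b \<in> B" for b
    using res_props[OF x \<alpha>(1)[OF b]] \<alpha>(2)[OF b] inj_onD[OF inc_inj[OF x] _ _ fr(8)[OF b]] by simp
  obtain k where k: "\<And>c. c \<in> B \<Longrightarrow> smooth_near S x (k c)"
    "\<forall>\<^sub>F q in nhdsin (topo S) x. \<forall>b\<in>B. (\<Sum>c\<in>B. res (\<alpha> c) q (y b) * k c q) = X q (y b)"
  proof (rule S.smooth_linear_solve[OF x fr(1) fr(3), of "\<lambda>b c q. res (\<alpha> c) q (y b)" "\<lambda>b q. X q (y b)"])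
    show "smooth_near S x (\<lambda>q. res (\<alpha> c) q (y b))" if "b \<in> B" "c \<in> B" for b c
      by (rule S.vf_near_smooth[OF res_vf_near[OF x \<alpha>(1)[OF that(2)]] fr(5)[OF that(1)]])
    show "smooth_near S x (\<lambda>q. X q (y b))" if "b \<in> B" for b
      by (rule S.vf_near_smooth[OF X fr(5)[OF that]])
    \<comment> \<open>At x the fields \<open>res (\<alpha> c)\<close> are the frame fields, so the
      matrix of the system is the identity there.\<close>
    fix z c assume z: "\<And>b. b \<in> B \<Longrightarrow> (\<Sum>c\<in>B. res (\<alpha> c) x (y b) * z c) = 0" and c: "c \<in> B"
    have "(\<Sum>c'\<in>B. res (\<alpha> c') x (y c) * z c') = (\<Sum>c'\<in>B. if c' = c then z c' else 0)"
      using rx fr(6)[OF _ c] by (intro sum.cong) auto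
    then show "z c = 0" using z[OF c] c fr(1) by simp
  qed (assumption | rule that)+
  have "\<exists>K. smooth_near M x K \<and> (\<forall>\<^sub>F q in nhdsin (topo S) x. K q = k c q)" if "c \<in> B" for c
    using smooth_near_extend[OF x k(1)[OF that]] by blast
  then obtain K where K: "\<And>c. c \<in> B \<Longrightarrow> smooth_near M x (K c)"
    "\<And>c. c \<in> B \<Longrightarrow> \<forall>\<^sub>F q in nhdsin (topo S) x. K c q = k c q"
    by metis
  define \<beta> where "\<beta> q = (\<lambda>v. \<Sum>c\<in>B. K c q * \<alpha> c q v)" for q
  have \<beta>: "form_near x \<beta>"
    unfolding \<beta>_def by (rule form_near_sum[OF xM \<alpha>(1) K(1)])
  have evK: "\<forall>\<^sub>F q in nhdsin (topo S) x. \<forall>c\<in>B. K c q = k c q"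
    using K(2) fr(1) by (simp add: eventually_ball_finite_distrib)
  have ev\<alpha>: "\<forall>\<^sub>F q in nhdsin (topo S) x. \<forall>c\<in>B. form_near q (\<alpha> c)"
    using sub_ev[OF x form_near_ev[OF \<alpha>(1)]] fr(1) by (simp add: eventually_ball_finite_distrib)
  have "\<forall>\<^sub>F q in nhdsin (topo S) x. sp \<beta> q = inc q (X q)"
    using k(2) evK ev\<alpha> fr(9) S.ev_carrier[OF x] S.vf_near_ev[OF X]
  proof eventually_elim
    case (elim q)
    note fq = S.coord_frameD[OF f(1) elim(4)]
    have Xq: "X q \<in> tangent S q" using S.vf_near_tangent elim(6) by blast
    let ?Y = "\<lambda>f. \<Sum>c\<in>B. k c q * res (\<alpha> c) q f"
    have Y: "?Y \<in> tangent S q"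
      by (rule S.tangent_sum_comb[OF elim(5)]) (use res_props(1)[OF elim(5)] elim(3) in blast)
    have "?Y = X q"
    proof
      fix h
      have "?Y (y b) = X q (y b)" if "b \<in> B" for b
        using elim(1) that by (simp add: mult.commute)
      then show "?Y h = X q h"
        using fq(7)[OF Y, of h] fq(7)[OF Xq, of h] by simp
    qed
    have "sp \<beta> q = (\<lambda>h. \<Sum>c\<in>B. K c q * sp (\<alpha> c) q h)"
      unfolding sharp_form_def \<beta>_def
      by (rule sharp_biv_sum[OF sub_carrier[OF elim(5)]]) (use elim(3) form_near_cotangent in blast)
    also have "\<dots> = (\<lambda>h. \<Sum>c\<in>B. k c q * inc q (res (\<alpha> c) q) h)"
      using elim(2,3) res_props(2)[OF elim(5)] by (intro ext sum.cong) auto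
    also have "\<dots> = inc q ?Y" by (auto simp: incl_deriv_def)
    finally show ?case using \<open>?Y = X q\<close> by simp
  qed
  then show thesis using that \<beta> by (simp add: lift_near_def)
qed

text \<open>Vectors \<open>#(\<alpha>)\<close> are tangent to \<open>S\<close>, so they only see the values of a function along \<open>S\<close>.\<close>

lemma sp_cong_leaf:
  assumes x: "x \<in> carrier S" and \<alpha>: "form_near x \<alpha>" and f: "smooth_near M x f" "smooth_near M x h"
    and e: "\<forall>\<^sub>F y in nhdsin (topo S) x. f y = h y"
  shows "sp \<alpha> x f = sp \<alpha> x h"
  using tangent_sub_eq[OF x res_props(1)[OF x \<alpha>] f(1) e] inc_apply[OF f(2)] res_props(2)[OF x \<alpha>] by metis

lemma sp_conn_cong_right:
  assumes x: "x \<in> carrier S" and f: "form_near x \<alpha>" "form_near x \<beta>" "form_near x \<beta>'"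
    and e: "\<forall>\<^sub>F y in nhdsin (topo S) x. sp \<beta> y = sp \<beta>' y"
  shows "sp (conn \<alpha> \<beta>) x = sp (conn \<alpha> \<beta>') x"
proof (rule tangent_eqI[of _ x])
  show "sp (conn \<alpha> \<beta>) x \<in> tangent M x" "sp (conn \<alpha> \<beta>') x \<in> tangent M x"
    by (rule sp_tangent[OF conn_form_near[OF f(1,2)]], rule sp_tangent[OF conn_form_near[OF f(1,3)]])
  fix c assume "c \<in> cotangent M x"
  then obtain \<gamma> where g: "form_near x \<gamma>" "\<gamma> x = c" using cotangent_extend[OF sub_carrier[OF x]] by blast
  have "sp \<alpha> x (\<lambda>q. \<gamma> q (sp \<beta> q)) = sp \<alpha> x (\<lambda>q. \<gamma> q (sp \<beta>' q))"
    by (rule sp_cong_leaf[OF x f(1) form_near_smooth[OF g(1) sp_vf_near[OF f(2)]] form_near_smooth[OF g(1) sp_vf_near[OF f(3)]]],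
        use e in eventually_elim) simp
  then show "c (sp (conn \<alpha> \<beta>) x) = c (sp (conn \<alpha> \<beta>') x)"
    using sp_conn_apply[OF f(1,2) g(1)] sp_conn_apply[OF f(1,3) g(1)] S.ev_here[OF x e] g(2) by simp
qed

lemma sp_conn_cong_left:
  assumes x: "x \<in> carrier S" and f: "form_near x \<alpha>" "form_near x \<alpha>'" "form_near x \<beta>"
    and e: "\<forall>\<^sub>F y in nhdsin (topo S) x. sp \<alpha> y = sp \<alpha>' y"
  shows "sp (conn \<alpha> \<beta>) x = sp (conn \<alpha>' \<beta>) x"
proof -
  have "lie_bracket M (sp \<alpha>) (sp \<beta>) x h = lie_bracket M (sp \<alpha>') (sp \<beta>) x h" for h
  proof (cases "smooth_near M x h")
    case True
    have "sp \<beta> x (\<lambda>q. sp \<alpha> q h) = sp \<beta> x (\<lambda>q. sp \<alpha>' q h)"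
      by (rule sp_cong_leaf[OF x f(3) vf_near_smooth[OF sp_vf_near[OF f(1)] True] vf_near_smooth[OF sp_vf_near[OF f(2)] True]],
          use e in eventually_elim) simp
    then show ?thesis using S.ev_here[OF x e] by (simp add: lie_bracket_def)
  qed (simp add: lie_bracket_def)
  then show ?thesis
    unfolding sp_conn_torsion[OF f(1,3)] sp_conn_torsion[OF f(2,3)] sp_conn_cong_right[OF x f(3,1,2) e] by simp
qed

lemma sp_conn_lift_indep:
  assumes x: "x \<in> carrier S" and l: "lift_near X x \<alpha>" "lift_near X x \<alpha>'" "lift_near Y x \<beta>" "lift_near Y x \<beta>'"
  shows "sp (conn \<alpha> \<beta>) x = sp (conn \<alpha>' \<beta>') x"
proof -
  have e: "\<forall>\<^sub>F y in nhdsin (topo S) x. sp \<gamma> y = sp \<gamma>' y" if "lift_near Z x \<gamma>" "lift_near Z x \<gamma>'" for Z \<gamma> \<gamma>'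
    using that[unfolded lift_near_def, THEN conjunct2] by eventually_elim simp
  note f = l[THEN lift_near_form]
  show ?thesis
    using sp_conn_cong_left[OF x f(1,2,3) e[OF l(1,2)]] sp_conn_cong_right[OF x f(2,3,4) e[OF l(3,4)]] by simp
qed

section \<open>The connection on the leaf\<close>

abbreviation "nabla \<equiv> leaf_conn M g \<pi> S"

lemma nabla_eqI:
  assumes x: "x \<in> carrier S" and l: "lift_near X x \<alpha>" "lift_near Y x \<beta>"
    and v: "v \<in> tangent S x" "inc x v = sp (conn \<alpha> \<beta>) x"
  shows "nabla X Y x = v"
  unfolding leaf_conn_def
proof (rule the_equality)
  show "v \<in> tangent S x \<and> (\<exists>\<alpha> \<beta>. local_lift M \<pi> S X x \<alpha> \<and> local_lift M \<pi> S Y x \<beta> \<and>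
      inc x v = sp (conn \<alpha> \<beta>) x)"
    using v l local_lift_iff[OF x] by blast
  fix w assume "w \<in> tangent S x \<and> (\<exists>\<alpha> \<beta>. local_lift M \<pi> S X x \<alpha> \<and> local_lift M \<pi> S Y x \<beta> \<and>
      inc x w = sp (conn \<alpha> \<beta>) x)"
  then obtain \<alpha>' \<beta>' where w: "w \<in> tangent S x" "lift_near X x \<alpha>'" "lift_near Y x \<beta>'" "inc x w = sp (conn \<alpha>' \<beta>') x"
    using local_lift_iff[OF x] by blast
  then have "inc x w = inc x v" using sp_conn_lift_indep[OF x l(1) w(2) l(2) w(3)] v(2) by simp
  then show "w = v" using inj_onD[OF inc_inj[OF x] _ w(1) v(1)] by blast
qed

lemma nabla_props:
  assumes x: "x \<in> carrier S" and l: "lift_near X x \<alpha>" "lift_near Y x \<beta>"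
  shows "nabla X Y x = res (conn \<alpha> \<beta>) x" "nabla X Y x \<in> tangent S x" "inc x (nabla X Y x) = sp (conn \<alpha> \<beta>) x"
proof -
  note r = res_props[OF x conn_form_near[OF lift_near_form[OF l(1)] lift_near_form[OF l(2)]]]
  show n: "nabla X Y x = res (conn \<alpha> \<beta>) x" by (rule nabla_eqI[OF x l r])
  show "nabla X Y x \<in> tangent S x" "inc x (nabla X Y x) = sp (conn \<alpha> \<beta>) x" unfolding n by (rule r)+
qed

text \<open>Lifts at x are also lifts at all nearby points of S. Near x the connection is thus
  \<open>res\<close> of the single form \<open>conn \<alpha> \<beta>\<close>.\<close>

lemma nabla_vf_near:
  assumes x: "x \<in> carrier S" and X: "S.vf_near x X" and Y: "S.vf_near x Y"
  shows "S.vf_near x (nabla X Y)"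
proof -
  obtain \<alpha> where a: "lift_near X x \<alpha>" using lift_exists[OF x X] .
  obtain \<beta> where b: "lift_near Y x \<beta>" using lift_exists[OF x Y] .
  show ?thesis
  proof (rule S.vf_near_cong[OF res_vf_near[OF x conn_form_near[OF lift_near_form[OF a] lift_near_form[OF b]]]],
      use S.ev_carrier[OF x] lift_near_ev[OF x a] lift_near_ev[OF x b] in eventually_elim)
    case (elim y)
    then show ?case using nabla_props(1) by simp
  qed
qed

text \<open>The coefficients are functions on S, but multiplying 1-forms takes functions on M; hence
  the extensions H and K.\<close>

lemma lift_near_comb:
  assumes x: "x \<in> carrier S" and l: "lift_near X x \<alpha>" "lift_near Y x \<beta>"
    and s: "smooth_near M x H" "smooth_near M x K"
    and e: "\<forall>\<^sub>F y in nhdsin (topo S) x. H y = h y" "\<forall>\<^sub>F y in nhdsin (topo S) x. K y = k y"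
  shows "lift_near (\<lambda>q f. h q * X q f + k q * Y q f) x (\<lambda>q v. H q * \<alpha> q v + K q * \<beta> q v)"
  unfolding lift_near_def
proof
  note f = lift_near_form[OF l(1)] lift_near_form[OF l(2)]
  show "form_near x (\<lambda>q v. H q * \<alpha> q v + K q * \<beta> q v)" by (rule form_near_comb[OF f s])
  show "\<forall>\<^sub>F y in nhdsin (topo S) x. sp (\<lambda>q v. H q * \<alpha> q v + K q * \<beta> q v) y = inc y (\<lambda>f. h y * X y f + k y * Y y f)"
    using sub_ev[OF x sp_comb_ev[OF f, of H K]] e l[unfolded lift_near_def, THEN conjunct2]
    by eventually_elim (simp add: inc_comb)
qed

text \<open>Coefficients h = k = 1 give additivity, and k = 0 gives linearity over functions. The
  analogue for the second argument is used in the same way.\<close>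

lemma nabla_comb_left:
  assumes x: "x \<in> carrier S" and v: "S.vf_near x X" "S.vf_near x Y" "S.vf_near x Z"
    and s: "smooth_near S x h" "smooth_near S x k"
  shows "nabla (\<lambda>q f. h q * X q f + k q * Y q f) Z x = (\<lambda>f. h x * nabla X Z x f + k x * nabla Y Z x f)"
proof -
  obtain \<alpha> where a: "lift_near X x \<alpha>" using lift_exists[OF x v(1)] .
  obtain \<beta> where b: "lift_near Y x \<beta>" using lift_exists[OF x v(2)] .
  obtain \<gamma> where c: "lift_near Z x \<gamma>" using lift_exists[OF x v(3)] .
  obtain H where H: "smooth_near M x H" "\<forall>\<^sub>F y in nhdsin (topo S) x. H y = h y" using smooth_near_extend[OF x s(1)] .
  obtain K where K: "smooth_near M x K" "\<forall>\<^sub>F y in nhdsin (topo S) x. K y = k y" using smooth_near_extend[OF x s(2)] .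
  note f = lift_near_form[OF a] lift_near_form[OF b] lift_near_form[OF c]
  show ?thesis
  proof (rule nabla_eqI[OF x lift_near_comb[OF x a b H(1) K(1) H(2) K(2)] c])
    show "(\<lambda>f. h x * nabla X Z x f + k x * nabla Y Z x f) \<in> tangent S x"
      by (rule S.tangent_comb[OF nabla_props(2)[OF x a c] nabla_props(2)[OF x b c]])
    show "inc x (\<lambda>f. h x * nabla X Z x f + k x * nabla Y Z x f) = sp (conn (\<lambda>q v. H q * \<alpha> q v + K q * \<beta> q v) \<gamma>) x"
      unfolding inc_comb nabla_props(3)[OF x a c] nabla_props(3)[OF x b c]
      using sharp_biv_comb[OF sub_carrier[OF x] conn_props(1)[OF f(1,3)] conn_props(1)[OF f(2,3)]]
        S.ev_here[OF x H(2)] S.ev_here[OF x K(2)]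
      by (simp add: sharp_form_def conn_comb_left[OF f H(1) K(1)])
  qed
qed

lemma nabla_comb_right:
  assumes x: "x \<in> carrier S" and v: "S.vf_near x X" "S.vf_near x Y" "S.vf_near x Z"
    and s: "smooth_near S x h" "smooth_near S x k"
  shows "nabla X (\<lambda>q f. h q * Y q f + k q * Z q f) x =
    (\<lambda>f. 1 * (h x * nabla X Y x f + k x * nabla X Z x f) + 1 * (X x h * Y x f + X x k * Z x f))"
proof -
  obtain \<alpha> where a: "lift_near X x \<alpha>" using lift_exists[OF x v(1)] .
  obtain \<beta> where b: "lift_near Y x \<beta>" using lift_exists[OF x v(2)] .
  obtain \<gamma> where c: "lift_near Z x \<gamma>" using lift_exists[OF x v(3)] .
  obtain H where H: "smooth_near M x H" "\<forall>\<^sub>F y in nhdsin (topo S) x. H y = h y" using smooth_near_extend[OF x s(1)] .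
  obtain K where K: "smooth_near M x K" "\<forall>\<^sub>F y in nhdsin (topo S) x. K y = k y" using smooth_near_extend[OF x s(2)] .
  note f = lift_near_form[OF a] lift_near_form[OF b] lift_near_form[OF c]
  note cc = form_near_cotangent[OF f(2)] form_near_cotangent[OF f(3)]
  note dc = conn_props(1)[OF f(1,2)] conn_props(1)[OF f(1,3)]
  \<comment> \<open>The Leibniz rule in M differentiates the extensions. Since #\<alpha> = X at x is
    tangent to S, it sees only h and k.\<close>
  have XH: "sp \<alpha> x H = X x h" "sp \<alpha> x K = X x k"
    using tangent_sub_eq[OF x S.vf_near_tangent[OF v(1)] H] tangent_sub_eq[OF x S.vf_near_tangent[OF v(1)] K]
      lift_near_here[OF x a] by simp_all
  have "sp (conn \<alpha> (\<lambda>q v. H q * \<beta> q v + K q * \<gamma> q v)) x =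
      sharp_biv M \<pi> x (\<lambda>v. 1 * (H x * conn \<alpha> \<beta> x v + K x * conn \<alpha> \<gamma> x v) + 1 * (sp \<alpha> x H * \<beta> x v + sp \<alpha> x K * \<gamma> x v))"
    by (simp add: sharp_form_def[of M \<pi> "conn \<alpha> (\<lambda>q v. H q * \<beta> q v + K q * \<gamma> q v)"] conn_comb_right[OF f H(1) K(1)])
  also have "\<dots> = (\<lambda>h'. 1 * (H x * sp (conn \<alpha> \<beta>) x h' + K x * sp (conn \<alpha> \<gamma>) x h') + 1 * (sp \<alpha> x H * sp \<beta> x h' + sp \<alpha> x K * sp \<gamma> x h'))"
    unfolding sharp_biv_comb[OF sub_carrier[OF x] cotangent_comb[OF dc] cotangent_comb[OF cc]]
      sharp_biv_comb[OF sub_carrier[OF x] dc] sharp_biv_comb[OF sub_carrier[OF x] cc] sharp_form_def ..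
  finally have eq: "sp (conn \<alpha> (\<lambda>q v. H q * \<beta> q v + K q * \<gamma> q v)) x = \<dots>" .
  show ?thesis
  proof (rule nabla_eqI[OF x a lift_near_comb[OF x b c H(1) K(1) H(2) K(2)]])
    show "(\<lambda>f. 1 * (h x * nabla X Y x f + k x * nabla X Z x f) + 1 * (X x h * Y x f + X x k * Z x f)) \<in> tangent S x"
      by (intro S.tangent_comb nabla_props(2)[OF x a b] nabla_props(2)[OF x a c] S.vf_near_tangent v)
    show "inc x (\<lambda>f. 1 * (h x * nabla X Y x f + k x * nabla X Z x f) + 1 * (X x h * Y x f + X x k * Z x f)) =
        sp (conn \<alpha> (\<lambda>q v. H q * \<beta> q v + K q * \<gamma> q v)) x"
      unfolding inc_comb nabla_props(3)[OF x a b] nabla_props(3)[OF x a c] eq XH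
        lift_near_here[OF x b] lift_near_here[OF x c] S.ev_here[OF x H(2)] S.ev_here[OF x K(2)] ..
  qed
qed

lemma leaf_vector_fields: "X \<in> vector_fields S (carrier S) \<Longrightarrow> x \<in> carrier S \<Longrightarrow> S.vf_near x X"
  by (rule S.vf_nearI) auto

lemma nabla_covariant: "covariant_connection S nabla"
  unfolding covariant_connection_def Let_def
proof (intro conjI ballI allI impI)
  fix X X' Y Y' p assume v: "X \<in> vector_fields S (carrier S)" "Y \<in> vector_fields S (carrier S)"
    and eq: "\<forall>p\<in>carrier S. X p = X' p \<and> Y p = Y' p" and p: "p \<in> carrier S"
  obtain \<alpha> where a: "lift_near X p \<alpha>" using lift_exists[OF p leaf_vector_fields[OF v(1) p]] .
  obtain \<beta> where b: "lift_near Y p \<beta>" using lift_exists[OF p leaf_vector_fields[OF v(2) p]] .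
  \<comment> \<open>Fields on S may differ as functions off its carrier. A lift involves only values
    near p in S, so equal sections have the same lifts.\<close>
  have lift: "lift_near Z' p \<gamma>" if l: "lift_near Z p \<gamma>" and e: "\<And>q. q \<in> carrier S \<Longrightarrow> Z q = Z' q" for Z Z' \<gamma>
    unfolding lift_near_def
  proof
    show "form_near p \<gamma>" using lift_near_form[OF l] .
    show "\<forall>\<^sub>F q in nhdsin (topo S) p. sp \<gamma> q = inc q (Z' q)"
      using S.ev_carrier[OF p] l[unfolded lift_near_def, THEN conjunct2] by eventually_elim (simp add: e)
  qed
  have "lift_near X' p \<alpha>" "lift_near Y' p \<beta>"
    using lift[OF a] lift[OF b] eq by simp_all
  then show "nabla X Y p = nabla X' Y' p" using nabla_props(1)[OF p] a b by metis
next
  fix X Y assume "X \<in> vector_fields S (carrier S)" "Y \<in> vector_fields S (carrier S)"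
  then show "nabla X Y \<in> vector_fields S (carrier S)"
    by (simp add: S.vector_fields_iff S.vf_near_at nabla_vf_near leaf_vector_fields)
next
  fix X X' Y p assume "X \<in> vector_fields S (carrier S)" "X' \<in> vector_fields S (carrier S)"
    "Y \<in> vector_fields S (carrier S)" and p: "p \<in> carrier S"
  then show "nabla (\<lambda>q f. X q f + X' q f) Y p = (\<lambda>f. nabla X Y p f + nabla X' Y p f)"
    using nabla_comb_left[OF p, of X X' Y "\<lambda>_. 1" "\<lambda>_. 1"] leaf_vector_fields S.smooth_near_const[OF p] by simp
next
  fix X Y Y' p assume v: "X \<in> vector_fields S (carrier S)" "Y \<in> vector_fields S (carrier S)"
    "Y' \<in> vector_fields S (carrier S)" and p: "p \<in> carrier S"
  then show "nabla X (\<lambda>q f. Y q f + Y' q f) p = (\<lambda>f. nabla X Y p f + nabla X Y' p f)"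
    using nabla_comb_right[OF p, of X Y Y' "\<lambda>_. 1" "\<lambda>_. 1"] leaf_vector_fields S.smooth_near_const[OF p]
      S.tangent_const[OF p S.vf_near_tangent[OF leaf_vector_fields[OF v(1) p]]] by simp
next
  fix h X Y p assume h: "smooth_fun S (carrier S) h" and v: "X \<in> vector_fields S (carrier S)"
    "Y \<in> vector_fields S (carrier S)" and p: "p \<in> carrier S"
  have hs: "smooth_near S p h" using h p S.smooth_fun_iff_near[of "carrier S"] by simp
  note vX = leaf_vector_fields[OF v(1) p] and vY = leaf_vector_fields[OF v(2) p]
  show "nabla (\<lambda>q f. h q * X q f) Y p = (\<lambda>f. h p * nabla X Y p f)"
    using nabla_comb_left[OF p vX vX vY hs S.smooth_near_const[OF p, of 0]] by simp
  show "nabla X (\<lambda>q f. h q * Y q f) p = (\<lambda>f. X p h * Y p f + h p * nabla X Y p f)"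
    using nabla_comb_right[OF p vX vY vY hs S.smooth_near_const[OF p, of 0]]
      S.tangent_const[OF p S.vf_near_tangent[OF vX], of 0] by (simp add: add.commute)
qed

text \<open>\<pi>(a, b) = b(#a) depends on a only through #a, and by antisymmetry on b only through
  #b. So the description in \<open>leaf_form\<close> is independent of the covectors chosen.\<close>

lemma leaf_form_eq:
  assumes x: "x \<in> carrier S" and a: "a \<in> cotangent M x" "sharp_biv M \<pi> x a = inc x u"
    and b: "b \<in> cotangent M x" "sharp_biv M \<pi> x b = inc x v"
  shows "leaf_form M \<pi> x u v = \<pi> x a b"
  unfolding leaf_form_def
proof (rule the_equality)
  show "\<exists>a'\<in>cotangent M x. \<exists>b'\<in>cotangent M x.
     sharp_biv M \<pi> x a' = inc x u \<and> sharp_biv M \<pi> x b' = inc x v \<and> \<pi> x a b = \<pi> x a' b'"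
    using a b by blast
  fix r assume "\<exists>a'\<in>cotangent M x. \<exists>b'\<in>cotangent M x.
     sharp_biv M \<pi> x a' = inc x u \<and> sharp_biv M \<pi> x b' = inc x v \<and> r = \<pi> x a' b'"
  then obtain a' b' where ab: "a' \<in> cotangent M x" "b' \<in> cotangent M x"
    "sharp_biv M \<pi> x a' = inc x u" "sharp_biv M \<pi> x b' = inc x v" "r = \<pi> x a' b'" by blast
  have xM: "x \<in> carrier M" using sub_carrier[OF x] .
  have "\<pi> x a' b' = \<pi> x a b'"
    using sharp_biv_props(2)[OF xM ab(1,2)] sharp_biv_props(2)[OF xM a(1) ab(2)] ab(3) a(2) by simp
  also have "\<dots> = \<pi> x a b"
    using sharp_biv_props(2)[OF xM ab(2) a(1)] sharp_biv_props(2)[OF xM b(1) a(1)] ab(4) b(2)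
      pi_antisym[OF xM a(1) ab(2)] pi_antisym[OF xM a(1) b(1)] by simp
  finally show "r = \<pi> x a b" using ab(5) by simp
qed

lemma lift_leaf_form:
  assumes x: "x \<in> carrier S" and f: "form_near x \<alpha>" "form_near x \<beta>" and e: "sp \<alpha> x = inc x u" "sp \<beta> x = inc x v"
  shows "leaf_form M \<pi> x u v = \<pi> x (\<alpha> x) (\<beta> x)"
  using e by (intro leaf_form_eq[OF x]) (simp_all add: sharp_form_def form_near_cotangent f)

lemma nabla_parallel_form: "parallel_form S nabla (leaf_form M \<pi>)"
  unfolding parallel_form_def Let_def
proof (intro ballI)
  fix X Y Z p assume v: "X \<in> vector_fields S (carrier S)" "Y \<in> vector_fields S (carrier S)" "Z \<in> vector_fields S (carrier S)"
    and p: "p \<in> carrier S"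
  note vX = leaf_vector_fields[OF v(1) p]
  obtain \<alpha> where a: "lift_near X p \<alpha>" using lift_exists[OF p vX] .
  obtain \<beta> where b: "lift_near Y p \<beta>" using lift_exists[OF p leaf_vector_fields[OF v(2) p]] .
  obtain \<gamma> where c: "lift_near Z p \<gamma>" using lift_exists[OF p leaf_vector_fields[OF v(3) p]] .
  note f = lift_near_form[OF a] lift_near_form[OF b] lift_near_form[OF c]
  have "\<forall>\<^sub>F q in nhdsin (topo S) p. \<pi> q (\<beta> q) (\<gamma> q) = leaf_form M \<pi> q (Y q) (Z q)"
    using S.ev_carrier[OF p] lift_near_ev[OF p b] lift_near_ev[OF p c]
    by eventually_elim (rule lift_leaf_form[OF _ lift_near_form lift_near_form lift_near_here lift_near_here, symmetric])
  from tangent_sub_eq[OF p S.vf_near_tangent[OF vX] pi_smooth[OF f(2,3)] this]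
  have "X p (\<lambda>q. leaf_form M \<pi> q (Y q) (Z q)) = sp \<alpha> p (\<lambda>q. \<pi> q (\<beta> q) (\<gamma> q))"
    using lift_near_here[OF p a] by simp
  moreover have "leaf_form M \<pi> p (nabla X Y p) (Z p) = \<pi> p (conn \<alpha> \<beta> p) (\<gamma> p)"
    by (rule lift_leaf_form[OF p conn_form_near[OF f(1,2)] f(3) nabla_props(3)[OF p a b, symmetric] lift_near_here[OF p c]])
  moreover have "leaf_form M \<pi> p (Y p) (nabla X Z p) = \<pi> p (\<beta> p) (conn \<alpha> \<gamma> p)"
    by (rule lift_leaf_form[OF p f(2) conn_form_near[OF f(1,3)] lift_near_here[OF p b] nabla_props(3)[OF p a c, symmetric]])
  ultimately show "X p (\<lambda>q. leaf_form M \<pi> q (Y q) (Z q)) - leaf_form M \<pi> p (nabla X Y p) (Z p)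
      - leaf_form M \<pi> p (Y p) (nabla X Z p) = 0"
    using conn_pi[OF f] by simp
qed

lemma nabla_parallel_metric: "parallel_form S nabla (restricted_metric M g)"
  unfolding parallel_form_def Let_def
proof (intro ballI)
  fix X Y Z p assume v: "X \<in> vector_fields S (carrier S)" "Y \<in> vector_fields S (carrier S)" "Z \<in> vector_fields S (carrier S)"
    and p: "p \<in> carrier S"
  note vX = leaf_vector_fields[OF v(1) p]
  obtain \<alpha> where a: "lift_near X p \<alpha>" using lift_exists[OF p vX] .
  obtain \<beta> where b: "lift_near Y p \<beta>" using lift_exists[OF p leaf_vector_fields[OF v(2) p]] .
  obtain \<gamma> where c: "lift_near Z p \<gamma>" using lift_exists[OF p leaf_vector_fields[OF v(3) p]] .
  note f = lift_near_form[OF a] lift_near_form[OF b] lift_near_form[OF c]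
  have "\<forall>\<^sub>F q in nhdsin (topo S) p. g q (sp \<beta> q) (sp \<gamma> q) = restricted_metric M g q (Y q) (Z q)"
    using S.ev_carrier[OF p] lift_near_ev[OF p b] lift_near_ev[OF p c]
    by eventually_elim (simp add: restricted_metric_def lift_near_here)
  from tangent_sub_eq[OF p S.vf_near_tangent[OF vX] g_smooth[OF sp_vf_near[OF f(2)] sp_vf_near[OF f(3)]] this]
  have "X p (\<lambda>q. restricted_metric M g q (Y q) (Z q)) = sp \<alpha> p (\<lambda>q. g q (sp \<beta> q) (sp \<gamma> q))"
    using lift_near_here[OF p a] by simp
  then show "X p (\<lambda>q. restricted_metric M g q (Y q) (Z q)) - restricted_metric M g p (nabla X Y p) (Z p)
      - restricted_metric M g p (Y p) (nabla X Z p) = 0"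
    using sp_conn_metric[OF f] nabla_props(3)[OF p a b] nabla_props(3)[OF p a c] lift_near_here[OF p b] lift_near_here[OF p c]
    by (simp add: restricted_metric_def)
qed

lemma nabla_torsion_free: "torsion_free S nabla"
  unfolding torsion_free_def Let_def
proof (intro ballI ext)
  fix X Y p h assume v: "X \<in> vector_fields S (carrier S)" "Y \<in> vector_fields S (carrier S)" and p: "p \<in> carrier S"
  note vX = leaf_vector_fields[OF v(1) p] and vY = leaf_vector_fields[OF v(2) p]
  obtain \<alpha> where a: "lift_near X p \<alpha>" using lift_exists[OF p vX] .
  obtain \<beta> where b: "lift_near Y p \<beta>" using lift_exists[OF p vY] .
  note f = lift_near_form[OF a] lift_near_form[OF b]
  show "nabla X Y p h - nabla Y X p h = lie_bracket S X Y p h"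
  proof (cases "smooth_near S p h")
    case False
    then show ?thesis
      using S.tangent_nonsmooth[OF nabla_props(2)[OF p a b] False] S.tangent_nonsmooth[OF nabla_props(2)[OF p b a] False]
      by (simp add: lie_bracket_def)
  next
    case True
    obtain H where H: "smooth_near M p H" "\<forall>\<^sub>F y in nhdsin (topo S) p. H y = h y" using smooth_near_extend[OF p True] .
    \<comment> \<open>Iterated derivatives transfer by using \<open>tangent_sub_eq\<close> twice:
      the function #\<zeta> H on M extends W h, and can in turn be differentiated along S.\<close>
    have second: "sp \<xi> p (\<lambda>q. sp \<zeta> q H) = V p (\<lambda>q. W q h)"
      if l: "lift_near V p \<xi>" "lift_near W p \<zeta>" and vf: "S.vf_near p V" "S.vf_near p W" for \<xi> \<zeta> V W
    proof -
      have "\<forall>\<^sub>F q in nhdsin (topo S) p. sp \<zeta> q H = W q h"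
        using S.ev_carrier[OF p] S.ev_ev[OF p H(2)] sub_ev[OF p smooth_near_ev[OF H(1)]]
          lift_near_ev[OF p l(2)] S.vf_near_ev[OF vf(2)]
      proof eventually_elim
        case (elim q)
        then show ?case
          using tangent_sub_eq[OF elim(1) S.vf_near_tangent[OF elim(5)] elim(3,2)] lift_near_here[OF elim(1,4)] by simp
      qed
      from tangent_sub_eq[OF p S.vf_near_tangent[OF vf(1)] vf_near_smooth[OF sp_vf_near[OF lift_near_form[OF l(2)]] H(1)] this]
      show ?thesis using lift_near_here[OF p l(1)] by simp
    qed
    have "nabla X Y p h - nabla Y X p h = sp (conn \<alpha> \<beta>) p H - sp (conn \<beta> \<alpha>) p H"
      using tangent_sub_eq[OF p nabla_props(2)[OF p a b] H] tangent_sub_eq[OF p nabla_props(2)[OF p b a] H]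
        nabla_props(3)[OF p a b] nabla_props(3)[OF p b a] by simp
    also have "\<dots> = lie_bracket M (sp \<alpha>) (sp \<beta>) p H"
      using sp_conn_torsion[OF f] by simp
    also have "\<dots> = lie_bracket S X Y p h"
      using True H(1) second[OF a b vX vY] second[OF b a vY vX] by (simp add: lie_bracket_def)
    finally show ?thesis .
  qed
qed

end

theorem mainTheorem2:
  fixes M S :: "('a, 'e::euclidean_space) mfd"
    and g :: "'a \<Rightarrow> 'a tvec \<Rightarrow> 'a tvec \<Rightarrow> real"
    and \<pi> :: "'a \<Rightarrow> 'a covec \<Rightarrow> 'a covec \<Rightarrow> real"
  assumes "smooth_manifold M"
    and "pseudo_riemannian M g"
    and "bivector_field M \<pi>"
    and "contra_compatible M g \<pi>"
    and "symplectic_leaf M \<pi> S"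
  shows
    "((\<forall>X\<in>vector_fields S (carrier S). \<forall>x\<in>carrier S. \<exists>\<alpha>. local_lift M \<pi> S X x \<alpha>)
      \<and> (\<forall>X\<in>vector_fields S (carrier S). \<forall>Y\<in>vector_fields S (carrier S). \<forall>x\<in>carrier S.
           \<forall>\<alpha> \<alpha>' \<beta> \<beta>'. local_lift M \<pi> S X x \<alpha> \<and> local_lift M \<pi> S X x \<alpha>' \<and>
             local_lift M \<pi> S Y x \<beta> \<and> local_lift M \<pi> S Y x \<beta>' \<longrightarrow>
             sharp_form M \<pi> (contra_conn M g \<pi> \<alpha> \<beta>) x = sharp_form M \<pi> (contra_conn M g \<pi> \<alpha>' \<beta>') x
             \<and> incl_deriv M x (leaf_conn M g \<pi> S X Y x) = sharp_form M \<pi> (contra_conn M g \<pi> \<alpha> \<beta>) x)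
      \<and> covariant_connection S (leaf_conn M g \<pi> S))
     \<and> parallel_form S (leaf_conn M g \<pi> S) (leaf_form M \<pi>)
     \<and> ((\<forall>x\<in>carrier S. nondegenerate_over (tangent S x) (restricted_metric M g x)) \<longrightarrow>
          levi_civita S (restricted_metric M g) (leaf_conn M g \<pi> S))"
proof -
  have int: "integral_submanifold M \<pi> S" using assms(5) unfolding symplectic_leaf_def by blast
  interpret integral_leaf M S g \<pi>
  proof
    show "smooth_manifold S" "immersed_submanifold M S"
      using int unfolding integral_submanifold_def immersed_submanifold_def by blast+
    show "incl_deriv M x ` tangent S x = sharp_biv M \<pi> x ` cotangent M x" if "x \<in> carrier S" for x
      using int that unfolding integral_submanifold_def by blast
  qed (use assms in auto)
  \<comment> \<open>Existence of lifts keeps the independence claim from being vacuous.\<close>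
  have "\<exists>\<alpha>. local_lift M \<pi> S X x \<alpha>" if "X \<in> vector_fields S (carrier S)" "x \<in> carrier S" for X x
    using lift_exists[OF that(2) leaf_vector_fields[OF that]] local_lift_iff[OF that(2)] by metis
  moreover have "sp (conn \<alpha> \<beta>) x = sp (conn \<alpha>' \<beta>') x \<and> incl_deriv M x (nabla X Y x) = sp (conn \<alpha> \<beta>) x"
    if "x \<in> carrier S" "local_lift M \<pi> S X x \<alpha>" "local_lift M \<pi> S X x \<alpha>'"
      "local_lift M \<pi> S Y x \<beta>" "local_lift M \<pi> S Y x \<beta>'" for X Y x \<alpha> \<alpha>' \<beta> \<beta>'
    using that(2-) sp_conn_lift_indep[OF that(1)] nabla_props(3)[OF that(1)]
    unfolding local_lift_iff[OF that(1)] by metis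
  ultimately show ?thesis
    using nabla_covariant nabla_parallel_form nabla_parallel_metric nabla_torsion_free
    unfolding levi_civita_def by blast
qed

end
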